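(* Let $\theta=7/64$. There exists a fixed unbounded subset $\mathcal N\subset\mathbb N$ such that for every sequence of positive numbers $\{y_n\}_{n\in\mathbb N}$ satisfying $y_n\ll n^{-2+4\theta}$, and for Lebesgue-almost every $x\in\mathbb R/\mathbb Z$, both $\delta_{n,x,y_n}$ and $\delta^{\rm pr}_{n,x,y_n}$ converge weakly to $\mu_{\mathcal M}$ as $n\to\infty$ along $n\in\mathcal N$.
   Context: $\mathcal M=\Gamma\backslash\mathbb H$ with $\Gamma=\mathrm{SL}_2(\mathbb Z)$; $\mu_{\mathcal M}$ is the normalized hyperbolic area $\frac3\pi\frac{dx\,dy}{y^2}$. $\delta_{n,x,y}=\frac1n\sum_{j=0}^{n-1}\delta_{\Gamma(x+j/n+iy)}$ and $\delta^{\rm pr}_{n,x,y}=\frac1{\varphi(n)}\sum_{j\in(\mathbb Z/n\mathbb Z)^\times}\delta_{\Gamma(x+j/n+iy)}$ are probability measures on $\mathcal M$. *)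

theory Defs
  imports "HOL-Analysis.Analysis" "HOL-Number_Theory.Number_Theory"
begin

definition upper_half_plane :: "complex set" where
  "upper_half_plane = {z. Im z > 0}"

definition moebius_int :: "int \<Rightarrow> int \<Rightarrow> int \<Rightarrow> int \<Rightarrow> complex \<Rightarrow> complex" where
  "moebius_int a b c d z = (of_int a * z + of_int b) / (of_int c * z + of_int d)"

definition SL2Z_invariant :: "(complex \<Rightarrow> real) \<Rightarrow> bool" where
  "SL2Z_invariant f \<longleftrightarrow>
     (\<forall>a b c d. a * d - b * c = 1 \<longrightarrow>
        (\<forall>z \<in> upper_half_plane. f (moebius_int a b c d z) = f z))"

text \<open>Bounded continuous functions on M = SL2(Z)\H, i.e. bounded continuous
  SL2(Z)-invariant functions on H (quotient topology).\<close>
definition Cb_modular :: "(complex \<Rightarrow> real) set" where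
  "Cb_modular = {f. continuous_on upper_half_plane f \<and>
                    (\<exists>B. \<forall>z \<in> upper_half_plane. \<bar>f z\<bar> \<le> B) \<and>
                    SL2Z_invariant f}"

definition fund_domain :: "complex set" where
  "fund_domain = {z. Im z > 0 \<and> \<bar>Re z\<bar> \<le> 1/2 \<and> cmod z \<ge> 1}"

text \<open>Integral against the normalized hyperbolic area mu_M = (3/pi) dx dy / y^2.\<close>
definition mu_M_integral :: "(complex \<Rightarrow> real) \<Rightarrow> real" where
  "mu_M_integral f = (3 / pi) * (LINT z : fund_domain | lborel. f z / (Im z)\<^sup>2)"

definition delta_integral :: "nat \<Rightarrow> real \<Rightarrow> real \<Rightarrow> (complex \<Rightarrow> real) \<Rightarrow> real" where
  "delta_integral n x y f =
     (1 / real n) * (\<Sum>j<n. f (Complex (x + real j / real n) y))"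

definition delta_pr_integral :: "nat \<Rightarrow> real \<Rightarrow> real \<Rightarrow> (complex \<Rightarrow> real) \<Rightarrow> real" where
  "delta_pr_integral n x y f =
     (1 / real (totient n)) * (\<Sum>j \<in> {j. j < n \<and> coprime j n}. f (Complex (x + real j / real n) y))"

definition theta :: real where "theta = 7 / 64"

end

theory Submission
  imports Defs "HOL-Complex_Analysis.Great_Picard"
begin

text \<open>
  For \<open>n = 2\<^sup>k\<close> the averages are iterates of one operator: \<open>\<delta>\<close> of a test function \<open>f\<close> at \<open>(n, x, y)\<close> is
  \<open>U\<^sup>k f\<close> at \<open>2\<^sup>k (x + iy)\<close> with \<open>U h(z) = (h(z/2) + h((z+1)/2)) / 2\<close>, and \<open>\<delta>\<^sup>p\<^sup>r\<close> is a combination of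
  the values for \<open>2\<^sup>k\<close> and \<open>2\<^sup>k\<^sup>-\<^sup>1\<close>. The operator \<open>U\<close> acts on functions invariant under \<open>\<Gamma>\<^sub>0(2)\<close>, preserves the
  hyperbolic area and does not increase hyperbolic Lipschitz constants. The \<open>L\<^sup>2\<close> norm of \<open>U\<^sup>k h\<close> is decreasing
  in \<open>k\<close>; a limit of functions along which it stays constant has \<open>h(z) = h(z + 1/2\<^sup>k)\<close> for all \<open>k\<close>, hence is
  invariant under all real translations and under \<open>\<Gamma>\<^sub>0(2)\<close>, hence is constant. By compactness
  \<open>U\<^sup>k h\<close> tends to the mean of \<open>h\<close> locally uniformly modulo \<open>\<Gamma>\<^sub>0(2)\<close>, uniformly over bounded Lipschitz \<open>h\<close>. No rate
  is needed because the set of admissible \<open>n\<close> may be chosen sparse. Finally, the part of the closed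
  horocycle of height \<open>Y \<le> 1\<close> lying above height \<open>H\<close> in the cusp has proportion \<open>O(1/H)\<close>, so by Borel-Cantelli
  almost every \<open>x\<close> eventually avoids a slowly receding neighbourhood of the cusp.
\<close>

section \<open>The hyperbolic area and its invariance\<close>

text \<open>The obstacle is uniformity. The set of admissible n is fixed before the heights y_n, and
  the point at which U^k h is evaluated moves with n and x. So decay is proved at once for the whole
  ball of bounded Lipschitz functions and for all points whose reduction has height at most H. Level
  two enters because U destroys SL_2(Z)-invariance: the branches z/2 and (z+1)/2 are permuted only
  by matrices with even lower left entry. That U preserves area comes from the Fricke involution z
  -> -1/(2z): if g is the Fricke transform of h, then 2 U h is the trace of g to level one minus g.
  Stage i of the construction treats Lipschitz bound i+1, cusp height 2^i and error 1/(i+1); the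
  geometric heights make the O(1/H) exceptional sets summable. The exponent of the theorem enters
  through n y_n -> 0: the stretched horocycles then have height at most 1, and only rows (c, d) with
  c nonzero can push a point into the cusp.\<close>

lemma lborel_complex:
  "lborel = distr (lborel \<Otimes>\<^sub>M lborel) borel (\<lambda>(x, y). Complex x y)"
proof (rule lborel_eqI)
  have [measurable]: "(\<lambda>(x, y). Complex x y) \<in> borel_measurable (lborel \<Otimes>\<^sub>M lborel)"
    unfolding case_prod_beta Complex_eq by measurable
  fix l u :: complex
  assume "\<And>b. b \<in> Basis \<Longrightarrow> l \<bullet> b \<le> u \<bullet> b"
  from this[of 1] this[of \<i>] have le: "Re l \<le> Re u" "Im l \<le> Im u"
    by (auto simp: Basis_complex_def)
  have eq: "(\<lambda>(x, y). Complex x y) -` box l u \<inter> space (lborel \<Otimes>\<^sub>M lborel)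
      = {Re l<..<Re u} \<times> {Im l<..<Im u}"
    by (auto simp: box_def Basis_complex_def space_pair_measure)
  show "emeasure (distr (lborel \<Otimes>\<^sub>M lborel) borel (\<lambda>(x, y). Complex x y)) (box l u)
      = (\<Prod>b\<in>Basis. (u - l) \<bullet> b)"
    by (subst emeasure_distr, simp, simp, subst eq, subst lborel.emeasure_pair_measure_Times)
      (use le in \<open>auto simp: Basis_complex_def ennreal_mult\<close>)
qed simp

lemma nn_integral_lborel_complex:
  fixes f :: "complex \<Rightarrow> ennreal"
  assumes [measurable]: "f \<in> borel_measurable borel"
  shows "(\<integral>\<^sup>+z. f z \<partial>lborel) = (\<integral>\<^sup>+y. \<integral>\<^sup>+x. f (Complex x y) \<partial>lborel \<partial>lborel)"
proof -
  have [measurable]: "(\<lambda>p. Complex (fst p) (snd p)) \<in> borel_measurable (lborel \<Otimes>\<^sub>M lborel)"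
    unfolding Complex_eq by measurable
  show ?thesis
    by (subst lborel_complex, subst nn_integral_distr)
      (auto simp: case_prod_beta lborel_pair.nn_integral_snd[symmetric])
qed

text \<open>The area dx dy / y^2 is extended by zero to the whole plane, so that Moebius maps can be
  used as total Borel maps of the type \<open>complex\<close>.\<close>

definition hyp :: "complex measure" where
  "hyp = density lborel (\<lambda>z. ennreal (indicator upper_half_plane z / (Im z)\<^sup>2))"

lemma sets_hyp [simp, measurable_cong]: "sets hyp = sets borel"
  and space_hyp [simp]: "space hyp = UNIV"
  by (simp_all add: hyp_def)

lemma upper_half_plane_measurable [measurable]: "upper_half_plane \<in> sets borel"
  unfolding upper_half_plane_def by measurable

lemma nn_integral_hyp:
  assumes [measurable]: "f \<in> borel_measurable borel"
  shows "(\<integral>\<^sup>+z. f z \<partial>hyp) =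
    (\<integral>\<^sup>+y. \<integral>\<^sup>+x. ennreal (indicator {0<..} y / y\<^sup>2) * f (Complex x y) \<partial>lborel \<partial>lborel)"
  unfolding hyp_def
  by (subst nn_integral_density) (auto simp: nn_integral_lborel_complex upper_half_plane_def
      indicator_def intro!: nn_integral_cong)

text \<open>The substitution x = t y turns dx dy / y^2 into dt dy / y. In these coordinates a
  scaling acts on y alone and the inversion acts by t -> -t together with y -> c / y, so both
  invariances reduce to those of dy / y.\<close>

lemma hyp_shear:
  assumes [measurable]: "f \<in> borel_measurable borel"
  shows "(\<integral>\<^sup>+z. f z \<partial>hyp) =
    (\<integral>\<^sup>+t. \<integral>\<^sup>+y. ennreal (indicator {0<..} y / y) * f (Complex (t * y) y) \<partial>lborel \<partial>lborel)"
proof -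
  have C [measurable]: "(\<lambda>p. Complex (fst p * snd p) (snd p)) \<in> borel_measurable (lborel \<Otimes>\<^sub>M lborel)"
    unfolding Complex_eq by measurable
  have C1 [measurable]: "(\<lambda>x. Complex x y) \<in> borel_measurable borel" for y
    unfolding Complex_eq by measurable
  have "(\<integral>\<^sup>+x. ennreal (indicator {0<..} y / y\<^sup>2) * f (Complex x y) \<partial>lborel)
      = (\<integral>\<^sup>+t. ennreal (indicator {0<..} y / y) * f (Complex (t * y) y) \<partial>lborel)" for y :: real
  proof (cases "y > 0")
    case True
    have "(\<integral>\<^sup>+x. ennreal (indicator {0<..} y / y\<^sup>2) * f (Complex x y) \<partial>lborel)
        = ennreal y * (\<integral>\<^sup>+t. ennreal (indicator {0<..} y / y\<^sup>2) * f (Complex (0 + y * t) y) \<partial>lborel)"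
      using True by (subst nn_integral_real_affine[where c = y and t = 0]) auto
    also have "\<dots> = (\<integral>\<^sup>+t. ennreal y * (ennreal (indicator {0<..} y / y\<^sup>2) * f (Complex (0 + y * t) y)) \<partial>lborel)"
      by (rule nn_integral_cmult[symmetric]) (simp add: Complex_eq)
    also have "\<dots> = (\<integral>\<^sup>+t. ennreal (indicator {0<..} y / y) * f (Complex (t * y) y) \<partial>lborel)"
      using True by (auto intro!: nn_integral_cong simp: mult.assoc[symmetric] ennreal_mult[symmetric]
          power2_eq_square mult.commute)
    finally show ?thesis .
  qed simp
  then show ?thesis
    by (simp add: nn_integral_hyp lborel_pair.Fubini'[where f = "\<lambda>t y. ennreal (indicator {0<..} y / y) * f (Complex (t * y) y)"] case_prod_beta)
qed

lemma nn_integral_reciprocal_invariant: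
  fixes f :: "real \<Rightarrow> ennreal"
  assumes [measurable]: "f \<in> borel_measurable borel" and c: "c > 0"
  shows "(\<integral>\<^sup>+y. ennreal (indicator {0<..} y / y) * f (c / y) \<partial>lborel) =
    (\<integral>\<^sup>+y. ennreal (indicator {0<..} y / y) * f y \<partial>lborel)"
proof -
  \<comment> \<open>The substitution rule wants an increasing map on a compact interval. Hence c / y
    is replaced by its negative, \<open>h\<close> absorbs the sign, and the half-line is exhausted
    by the intervals \<open>A n\<close> and \<open>B n\<close>.\<close>
  define g where "g = (\<lambda>y::real. - c / y)"
  define h where "h = (\<lambda>x::real. ennreal (indicator {0<..} (-x) / (-x)) * f (- x))"
  have [measurable]: "h \<in> borel_measurable borel"
    unfolding h_def by measurable
  define A where "A n = {1 / real (Suc n)..real (Suc n)}" for n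
  define B where "B n = {c / real (Suc n)..c * real (Suc n)}" for n
  have step: "(\<integral>\<^sup>+y. ennreal (indicator {0<..} y / y) * f y * indicator (B n) y \<partial>lborel) =
      (\<integral>\<^sup>+y. ennreal (indicator {0<..} y / y) * f (c / y) * indicator (A n) y \<partial>lborel)" if "n > 0" for n
  proof -
    have 1: "1 / real (Suc n) < real (Suc n)"
      using that by (simp add: field_simps) (smt (verit) of_nat_0_less_iff zero_less_mult_iff)
    have "(\<integral>\<^sup>+y. ennreal (indicator {0<..} y / y) * f y * indicator (B n) y \<partial>lborel)
        = (\<integral>\<^sup>+y. h y * indicator (B n) (- y) \<partial>lborel)"
      by (subst nn_integral_real_affine[where c = "-1" and t = 0]) (simp_all add: h_def B_def)
    also have "\<dots> = (\<integral>\<^sup>+y. h y * indicator {g (1 / real (Suc n))..g (real (Suc n))} y \<partial>lborel)"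
      by (intro nn_integral_cong) (auto simp: indicator_def B_def g_def field_simps)
    also have "\<dots> = (\<integral>\<^sup>+y. h (g y) * ennreal (c / y\<^sup>2) * indicator {1 / real (Suc n)..real (Suc n)} y \<partial>lborel)"
    proof (rule nn_integral_substitution_aux)
      fix x assume "x \<in> {1 / real (Suc n)..real (Suc n)}"
      then have "x > 0"
        by (smt (verit) atLeastAtMost_iff of_nat_0_less_iff zero_less_Suc zero_less_divide_1_iff)
      then show "(g has_real_derivative c / x\<^sup>2) (at x)"
        unfolding g_def by (auto intro!: derivative_eq_intros simp: power2_eq_square)
    next
      show "continuous_on {1 / real (Suc n)..real (Suc n)} (\<lambda>y. c / y\<^sup>2)"
        by (intro continuous_intros) (auto simp: le_divide_eq field_simps)
    qed (use c 1 in auto)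
    also have "\<dots> = (\<integral>\<^sup>+y. ennreal (indicator {0<..} y / y) * f (c / y) * indicator (A n) y \<partial>lborel)"
    proof (intro nn_integral_cong)
      fix y :: real
      show "h (g y) * ennreal (c / y\<^sup>2) * indicator {1 / real (Suc n)..real (Suc n)} y
          = ennreal (indicator {0<..} y / y) * f (c / y) * indicator (A n) y"
      proof (cases "y \<in> A n")
        case True
        then have y: "y > 0"
          by (smt (verit) A_def atLeastAtMost_iff of_nat_0_less_iff zero_less_Suc zero_less_divide_1_iff)
        have "ennreal (y / c) * ennreal (c / y\<^sup>2) = ennreal (1 / y)"
          using y c by (simp add: ennreal_mult[symmetric] power2_eq_square)
        then show ?thesis
          using y c True by (simp add: A_def h_def g_def) (metis mult.assoc mult.commute)
      qed (simp add: A_def)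
    qed
    finally show ?thesis .
  qed
  have lim: "(\<integral>\<^sup>+y. ennreal (indicator {0<..} y / y) * k y \<partial>lborel) =
      (SUP n. \<integral>\<^sup>+y. ennreal (indicator {0<..} y / y) * k y * indicator {b / real (Suc n)..b * real (Suc n)} y \<partial>lborel)"
    if [measurable]: "k \<in> borel_measurable borel" and b: "b > 0" for k :: "real \<Rightarrow> ennreal" and b
  proof -
    have inc: "incseq (\<lambda>n y. ennreal (indicator {0<..} y / y) * k y * indicator {b / real (Suc n)..b * real (Suc n)} y)"
    proof (intro incseq_SucI le_funI mult_left_mono)
      fix n and y :: real
      have "b / real (Suc (Suc n)) \<le> b / real (Suc n)" "b * real (Suc n) \<le> b * real (Suc (Suc n))"
        using b by (auto intro!: divide_left_mono)
      then show "indicator {b / real (Suc n)..b * real (Suc n)} y \<le> (indicator {b / real (Suc (Suc n))..b * real (Suc (Suc n))} y :: ennreal)"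
        by (auto simp: indicator_def)
    qed simp
    have "(SUP n. ennreal (indicator {0<..} y / y) * k y * indicator {b / real (Suc n)..b * real (Suc n)} y)
      = ennreal (indicator {0<..} y / y) * k y" for y :: real
    proof (cases "y > 0")
      case True
      obtain n where n: "real n \<ge> max (b / y) (y / b)"
        using real_arch_simple by blast
      have "b / y \<le> real (Suc n)" "y / b \<le> real (Suc n)"
        using n by auto
      then have "y \<in> {b / real (Suc n)..b * real (Suc n)}"
        using True b by (auto simp: field_simps)
      then show ?thesis
        by (intro antisym SUP_least SUP_upper2[of n]) (auto simp: indicator_def)
    qed simp
    then show ?thesis
      using nn_integral_monotone_convergence_SUP[OF inc, of lborel] by simp
  qed
  have "(SUP n. \<integral>\<^sup>+y. ennreal (indicator {0<..} y / y) * f y * indicator (B n) y \<partial>lborel)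
      = (SUP n. \<integral>\<^sup>+y. ennreal (indicator {0<..} y / y) * f (c / y) * indicator (A n) y \<partial>lborel)"
  proof (intro SUP_cong refl)
    fix n
    show "(\<integral>\<^sup>+y. ennreal (indicator {0<..} y / y) * f y * indicator (B n) y \<partial>lborel) =
      (\<integral>\<^sup>+y. ennreal (indicator {0<..} y / y) * f (c / y) * indicator (A n) y \<partial>lborel)"
    \<comment> \<open>For n = 0 both intervals shrink to a point, which the substitution rule
      excludes; both integrals are then zero.\<close>
    proof (cases "n = 0")
      case True
      have "(\<integral>\<^sup>+y. k y * indicator {a} y \<partial>lborel) = 0" for k :: "real \<Rightarrow> ennreal" and a
        by (rule nn_integral_null_set) (auto intro: null_setsI)
      then show ?thesis using True by (simp add: A_def B_def)
    qed (use step in simp)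
  qed
  then show ?thesis
    using lim[of f c] lim[of "\<lambda>y. f (c / y)" 1] c by (simp add: A_def B_def)
qed

lemma distr_hyp_eqI:
  assumes [measurable]: "\<phi> \<in> borel_measurable borel"
    and "\<And>f. f \<in> borel_measurable borel \<Longrightarrow> (\<integral>\<^sup>+z. f (\<phi> z) \<partial>hyp) = (\<integral>\<^sup>+z. f z \<partial>hyp)"
  shows "distr hyp borel \<phi> = hyp"
proof (rule measure_eqI)
  fix A assume "A \<in> sets (distr hyp borel \<phi>)"
  then have [measurable]: "A \<in> sets borel" by simp
  have "emeasure (distr hyp borel \<phi>) A = (\<integral>\<^sup>+z. indicator A z \<partial>distr hyp borel \<phi>)"
    by simp
  also have "\<dots> = (\<integral>\<^sup>+z. indicator A (\<phi> z) \<partial>hyp)"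
    by (subst nn_integral_distr) auto
  also have "\<dots> = emeasure hyp A"
    by (subst assms(2)) auto
  finally show "emeasure (distr hyp borel \<phi>) A = emeasure hyp A" .
qed simp

lemma borel_measurable_Complex [measurable]:
  assumes [measurable]: "f \<in> borel_measurable M" "g \<in> borel_measurable M"
  shows "(\<lambda>x. Complex (f x) (g x)) \<in> borel_measurable M"
  unfolding Complex_eq by measurable

lemma hyp_translate: "distr hyp borel (\<lambda>z. z + of_real t) = hyp"
proof (rule distr_hyp_eqI)
  fix f :: "complex \<Rightarrow> ennreal" assume [measurable]: "f \<in> borel_measurable borel"
  have "(\<integral>\<^sup>+x. ennreal (indicator {0<..} y / y\<^sup>2) * f (Complex x y) \<partial>lborel) =
      (\<integral>\<^sup>+x. ennreal (indicator {0<..} y / y\<^sup>2) * f (Complex x y + of_real t) \<partial>lborel)" for y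
    by (subst nn_integral_real_affine[where c = 1 and t = t]) (simp_all add: Complex_eq add_ac)
  then show "(\<integral>\<^sup>+z. f (z + of_real t) \<partial>hyp) = (\<integral>\<^sup>+z. f z \<partial>hyp)"
    by (simp add: nn_integral_hyp)
qed simp

lemma hyp_scale:
  assumes "r > 0"
  shows "distr hyp borel (\<lambda>z. of_real r * z) = hyp"
proof (rule distr_hyp_eqI)
  fix f :: "complex \<Rightarrow> ennreal" assume [measurable]: "f \<in> borel_measurable borel"
  have "(\<integral>\<^sup>+y. ennreal (indicator {0<..} y / y) * f (Complex (t * y) y) \<partial>lborel) =
      (\<integral>\<^sup>+y. ennreal (indicator {0<..} y / y) * f (of_real r * Complex (t * y) y) \<partial>lborel)" for t
  proof -
    have "(\<integral>\<^sup>+y. ennreal (indicator {0<..} y / y) * f (Complex (t * y) y) \<partial>lborel) =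
        (\<integral>\<^sup>+y. ennreal r * (ennreal (indicator {0<..} (r * y) / (r * y)) * f (Complex (t * (r * y)) (r * y))) \<partial>lborel)"
      using assms by (subst nn_integral_real_affine[where c = r and t = 0]) (auto simp: nn_integral_cmult)
    also have "\<dots> = (\<integral>\<^sup>+y. ennreal (indicator {0<..} y / y) * f (of_real r * Complex (t * y) y) \<partial>lborel)"
    proof (intro nn_integral_cong)
      fix y :: real
      have "ennreal r * ennreal (indicator {0<..} (r * y) / (r * y)) = ennreal (indicator {0<..} y / y)"
        using assms by (auto simp: ennreal_mult[symmetric] indicator_def zero_less_mult_iff)
      moreover have "Complex (t * (r * y)) (r * y) = of_real r * Complex (t * y) y"
        by (simp add: complex_eq_iff)
      ultimately show "ennreal r * (ennreal (indicator {0<..} (r * y) / (r * y)) * f (Complex (t * (r * y)) (r * y)))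
          = ennreal (indicator {0<..} y / y) * f (of_real r * Complex (t * y) y)"
        by (metis mult.assoc)
    qed
    finally show ?thesis .
  qed
  then show "(\<integral>\<^sup>+z. f (of_real r * z) \<partial>hyp) = (\<integral>\<^sup>+z. f z \<partial>hyp)"
    by (simp add: hyp_shear)
qed simp

lemma hyp_inversion: "distr hyp borel (\<lambda>z. - 1 / z) = hyp"
proof (rule distr_hyp_eqI)
  fix f :: "complex \<Rightarrow> ennreal" assume [measurable]: "f \<in> borel_measurable borel"
  have "(\<integral>\<^sup>+y. ennreal (indicator {0<..} y / y) * f (- 1 / Complex (t * y) y) \<partial>lborel) =
      (\<integral>\<^sup>+y. ennreal (indicator {0<..} y / y) * f (Complex (- t * y) y) \<partial>lborel)" for t
  proof -
    \<comment> \<open>For z = (t + i) y one has -1/z = (-t + i) c / y with this c.\<close>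
    define c where "c = 1 / (1 + t\<^sup>2)"
    have c: "c > 0" unfolding c_def by (simp add: add_pos_nonneg)
    have *: "- 1 / Complex (t * y) y = Complex (- t * (c / y)) (c / y)" if "y > 0" for y
    proof -
      have "c * (1 + t\<^sup>2) = 1" using c by (simp add: c_def)
      then have "Complex (- t * (c / y)) (c / y) * Complex (t * y) y = - 1"
        using that by (simp add: complex_eq_iff power2_eq_square algebra_simps)
      moreover have "Complex (t * y) y \<noteq> 0" using that by (simp add: complex_eq_iff)
      ultimately show ?thesis by (metis nonzero_mult_div_cancel_right)
    qed
    have "(\<integral>\<^sup>+y. ennreal (indicator {0<..} y / y) * f (- 1 / Complex (t * y) y) \<partial>lborel) =
      (\<integral>\<^sup>+y. ennreal (indicator {0<..} y / y) * f (Complex (- t * (c / y)) (c / y)) \<partial>lborel)"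
      using * by (intro nn_integral_cong) (auto simp: indicator_def)
    also have "\<dots> = (\<integral>\<^sup>+y. ennreal (indicator {0<..} y / y) * f (Complex (- t * y) y) \<partial>lborel)"
      using nn_integral_reciprocal_invariant[of "\<lambda>y. f (Complex (- t * y) y)" c] c by simp
    finally show ?thesis .
  qed
  then have "(\<integral>\<^sup>+z. f (- 1 / z) \<partial>hyp) =
      (\<integral>\<^sup>+t. \<integral>\<^sup>+y. ennreal (indicator {0<..} y / y) * f (Complex (- t * y) y) \<partial>lborel \<partial>lborel)"
    by (simp add: hyp_shear)
  also have "\<dots> = (\<integral>\<^sup>+z. f z \<partial>hyp)"
    using nn_integral_real_affine[of "\<lambda>t. \<integral>\<^sup>+y. ennreal (indicator {0<..} y / y) * f (Complex (t * y) y) \<partial>lborel" "-1" 0]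
    by (simp add: hyp_shear)
  finally show "(\<integral>\<^sup>+z. f (- 1 / z) \<partial>hyp) = (\<integral>\<^sup>+z. f z \<partial>hyp)" .
qed simp

section \<open>The operator U preserves the area of level two\<close>

lemma fund_domain_measurable [measurable]: "fund_domain \<in> sets borel"
  unfolding fund_domain_def by measurable

text \<open>A way to discard boundaries: vertical lines and the unit circle meet every horizontal
  line in finitely many points, hence are null sets.\<close>

lemma AE_hyp_finite_slices:
  assumes [measurable]: "Measurable.pred borel P"
    and fin: "\<And>y. finite {x. P (Complex x y)}"
  shows "AE z in hyp. \<not> P z"
proof -
  have "(\<integral>\<^sup>+x. ennreal (indicator {0<..} y / y\<^sup>2) * indicator {z. P z} (Complex x y) \<partial>lborel) = 0" for y :: real
  proof -
    have "AE x in lborel. x \<notin> {x. P (Complex x y)}"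
      by (rule AE_not_in) (rule finite_imp_null_set_lborel[OF fin])
    then show ?thesis
      by (subst nn_integral_0_iff_AE) (simp, elim eventually_mono, simp)
  qed
  then have "emeasure hyp {z. P z} = 0"
    by (simp add: nn_integral_hyp flip: nn_integral_indicator)
  then show ?thesis
    by (intro AE_I[where N = "{z. P z}"]) auto
qed

lemma AE_hyp_Re_neq: "AE z in hyp. Re z \<noteq> c"
  by (rule AE_hyp_finite_slices) auto

lemma AE_hyp_cmod_neq: "AE z in hyp. cmod z \<noteq> 1"
proof (rule AE_hyp_finite_slices)
  show "finite {x. cmod (Complex x y) = 1}" for y
  proof (rule finite_subset)
    show "{x. cmod (Complex x y) = 1} \<subseteq> {sqrt (1 - y\<^sup>2), - sqrt (1 - y\<^sup>2)}"
    proof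
      fix x assume "x \<in> {x. cmod (Complex x y) = 1}"
      then have "x\<^sup>2 = 1 - y\<^sup>2" by (simp add: cmod_def)
      then have "sqrt (1 - y\<^sup>2) = \<bar>x\<bar>" by (metis real_sqrt_abs)
      then show "x \<in> {sqrt (1 - y\<^sup>2), - sqrt (1 - y\<^sup>2)}" by auto
    qed
  qed simp
qed measurable

lemma AE_hyp_upper: "AE z in hyp. Im z > 0"
  unfolding hyp_def by (subst AE_density) (auto simp: indicator_def upper_half_plane_def)

text \<open>Integrating first in y from the arc upwards leaves 1 / sqrt(1 - x^2), whose primitive is
  arcsin. The value explains the factor 3 / pi in \<open>mu_M_integral\<close>.\<close>

lemma emeasure_hyp_fund_domain: "emeasure hyp fund_domain = ennreal (pi / 3)"
proof -
  have "emeasure hyp fund_domain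
      = (\<integral>\<^sup>+y. \<integral>\<^sup>+x. ennreal (indicator {0<..} y / y\<^sup>2) * indicator fund_domain (Complex x y) \<partial>lborel \<partial>lborel)"
    by (subst nn_integral_hyp[symmetric]) simp_all
  also have "\<dots> = (\<integral>\<^sup>+x. \<integral>\<^sup>+y. ennreal (indicator {0<..} y / y\<^sup>2) * indicator fund_domain (Complex x y) \<partial>lborel \<partial>lborel)"
    by (rule lborel_pair.Fubini') (simp add: case_prod_beta)
  also have "\<dots> = (\<integral>\<^sup>+x. ennreal (1 / sqrt (1 - x\<^sup>2)) * indicator {-1/2..1/2} x \<partial>lborel)"
  proof (intro nn_integral_cong)
    fix x :: real
    show "(\<integral>\<^sup>+y. ennreal (indicator {0<..} y / y\<^sup>2) * indicator fund_domain (Complex x y) \<partial>lborel)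
        = ennreal (1 / sqrt (1 - x\<^sup>2)) * indicator {-1/2..1/2} x"
    proof (cases "\<bar>x\<bar> \<le> 1/2")
      case True
      then have "x\<^sup>2 \<le> (1/2)\<^sup>2" by (metis abs_le_square_iff abs_of_nonneg zero_le_divide_1_iff zero_le_numeral)
      then have x2: "1 - x\<^sup>2 > 0" by (simp add: power2_eq_square)
      define s where "s = sqrt (1 - x\<^sup>2)"
      have s: "s > 0" using x2 by (simp add: s_def)
      have mem: "Complex x y \<in> fund_domain \<longleftrightarrow> y \<ge> s" if "y > 0" for y
      proof -
        have "cmod (Complex x y) \<ge> 1 \<longleftrightarrow> x\<^sup>2 + y\<^sup>2 \<ge> 1"
          by (simp add: cmod_def)
        also have "\<dots> \<longleftrightarrow> sqrt (1 - x\<^sup>2) \<le> sqrt (y\<^sup>2)"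
          by (simp only: real_sqrt_le_iff) linarith
        finally show ?thesis
          using that True by (simp add: fund_domain_def s_def)
      qed
      have "(\<integral>\<^sup>+y. ennreal (indicator {0<..} y / y\<^sup>2) * indicator fund_domain (Complex x y) \<partial>lborel)
        = (\<integral>\<^sup>+y. ennreal (1 / y\<^sup>2) * indicator {s..} y \<partial>lborel)"
        using mem s by (intro nn_integral_cong) (auto simp: indicator_def fund_domain_def)
      also have "\<dots> = ennreal (0 - (- 1 / s))"
      proof (rule nn_integral_FTC_atLeast)
        show "((\<lambda>y::real. - 1 / y) \<longlongrightarrow> 0) at_top"
          by (intro tendsto_divide_0[OF tendsto_const] filterlim_at_top_imp_at_infinity filterlim_ident)
        show "((\<lambda>y. - 1 / y) has_real_derivative 1 / y\<^sup>2) (at y)" if "s \<le> y" for y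
          using that s by (auto intro!: derivative_eq_intros simp: power2_eq_square)
      qed auto
      finally show ?thesis using True by (auto simp: s_def indicator_def)
    qed (auto simp: indicator_def fund_domain_def)
  qed
  also have "\<dots> = ennreal (arcsin (1/2) - arcsin (-1/2))"
  proof (rule nn_integral_FTC_Icc)
    fix x :: real assume x: "x \<in> {-1/2..1/2}"
    then show "(arcsin has_real_derivative 1 / sqrt (1 - x\<^sup>2)) (at x)"
      by (auto intro!: derivative_eq_intros simp: inverse_eq_divide)
    show "0 \<le> 1 / sqrt (1 - x\<^sup>2)"
      using x by (auto simp: abs_square_le_1)
  qed auto
  also have "arcsin (1/2) = pi / 6"
    using arcsin_sin[of "pi / 6"] by (simp add: sin_30)
  also have "arcsin (-1/2) = - (pi / 6)"
    using arcsin_minus[of "1/2"] \<open>arcsin (1/2) = pi / 6\<close> by simp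
  finally show ?thesis by (simp add: field_simps)
qed

text \<open>A strip of width one above two half-circles of radius 1/2 that touch at 0. Its cusps are
  infinity and 0, and z -> -1/(2z) exchanges them.\<close>

definition cusp_domain :: "complex set" where
  "cusp_domain = {z. Im z > 0 \<and> \<bar>Re z\<bar> \<le> 1/2 \<and> cmod (z - 1/2) \<ge> 1/2 \<and> cmod (z + 1/2) \<ge> 1/2}"

lemma cusp_domain_measurable [measurable]: "cusp_domain \<in> sets borel"
  unfolding cusp_domain_def by measurable

lemma cmod_ge_iff: "r \<ge> 0 \<Longrightarrow> cmod z \<ge> r \<longleftrightarrow> (Re z)\<^sup>2 + (Im z)\<^sup>2 \<ge> r\<^sup>2"
  unfolding cmod_def by (metis real_le_rsqrt real_sqrt_ge_0_iff real_sqrt_le_iff real_sqrt_unique sum_power2_ge_zero)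

lemma cusp_domain_iff:
  "z \<in> cusp_domain \<longleftrightarrow> Im z > 0 \<and> \<bar>Re z\<bar> \<le> 1/2 \<and> (Re z)\<^sup>2 + (Im z)\<^sup>2 \<ge> \<bar>Re z\<bar>"
proof -
  have "cmod (z - 1/2) \<ge> 1/2 \<longleftrightarrow> (Re z)\<^sup>2 + (Im z)\<^sup>2 \<ge> Re z"
    by (subst cmod_ge_iff) (auto simp: power2_eq_square algebra_simps)
  moreover have "cmod (z + 1/2) \<ge> 1/2 \<longleftrightarrow> (Re z)\<^sup>2 + (Im z)\<^sup>2 \<ge> - Re z"
    by (subst cmod_ge_iff) (auto simp: power2_eq_square algebra_simps)
  ultimately show ?thesis by (auto simp: cusp_domain_def)
qed

lemma fund_domain_iff:
  "z \<in> fund_domain \<longleftrightarrow> Im z > 0 \<and> \<bar>Re z\<bar> \<le> 1/2 \<and> (Re z)\<^sup>2 + (Im z)\<^sup>2 \<ge> 1"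
  by (auto simp: fund_domain_def cmod_ge_iff)

lemma Re_Im_inversion:
  "Re (- 1 / z) = - Re z / ((Re z)\<^sup>2 + (Im z)\<^sup>2)" "Im (- 1 / z) = Im z / ((Re z)\<^sup>2 + (Im z)\<^sup>2)"
  by (simp_all add: Re_divide Im_divide)

lemma Im_inversion_pos: "Im z > 0 \<Longrightarrow> Im (- 1 / z) > 0"
  unfolding Re_Im_inversion by (intro divide_pos_pos add_nonneg_pos) auto

lemma normsq_inversion:
  assumes "z \<noteq> 0"
  shows "(Re (- 1 / z))\<^sup>2 + (Im (- 1 / z))\<^sup>2 = 1 / ((Re z)\<^sup>2 + (Im z)\<^sup>2)"
proof -
  have "(cmod (- 1 / z))\<^sup>2 = 1 / (cmod z)\<^sup>2" by (simp add: norm_divide power_divide)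
  then show ?thesis by (simp add: cmod_power2)
qed

text \<open>Under the inversion the half-circles of \<open>cusp_domain\<close> become the lines Re z
  = 1 and Re z = -1, and the lines Re z = 1/2 and Re z = -1/2 become the unit circles about -1 and
  1. The image is, up to boundary, \<open>fund_domain\<close> together with half of each horizontal
  neighbour.\<close>

lemma inversion_lower_part_iff:
  assumes "Im z > 0"
  shows "- 1 / z \<in> cusp_domain - fund_domain \<longleftrightarrow>
    \<bar>Re z\<bar> \<le> 1 \<and> (Re z)\<^sup>2 + (Im z)\<^sup>2 > 1 \<and> (Re z)\<^sup>2 + (Im z)\<^sup>2 \<ge> 2 * \<bar>Re z\<bar>"
proof -
  define n where "n = (Re z)\<^sup>2 + (Im z)\<^sup>2"
  have n: "n > 0" using assms unfolding n_def by (simp add: add_nonneg_pos)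
  have z: "z \<noteq> 0" using assms by auto
  have abs: "\<bar>- Re z / n\<bar> = \<bar>Re z\<bar> / n" using n by simp
  show ?thesis
    unfolding Diff_iff cusp_domain_iff fund_domain_iff normsq_inversion[OF z]
    unfolding Re_Im_inversion n_def[symmetric] abs using n assms by (auto simp: field_simps)
qed

lemma measure_preserving_nn_integral:
  assumes "distr hyp borel \<phi> = hyp" and [measurable]: "\<phi> \<in> borel_measurable borel" "f \<in> borel_measurable borel"
  shows "(\<integral>\<^sup>+z. f (\<phi> z) \<partial>hyp) = (\<integral>\<^sup>+z. f z \<partial>hyp)"
  by (subst (2) assms(1)[symmetric], subst nn_integral_distr) auto

text \<open>The region \<open>cusp_domain\<close> is a fundamental domain for \<open>\<Gamma>\<^sub>0(2)\<close> that is symmetric under the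
  Fricke involution; cutting it along the unit circle and along vertical lines reassembles it
  from the translates of \<open>fund_domain\<close> by the three cosets \<open>1, S, ST\<close>.\<close>

lemma cusp_domain_cut_and_paste:
  fixes g :: "complex \<Rightarrow> ennreal"
  assumes [measurable]: "g \<in> borel_measurable borel"
    and V: "\<And>z. Im z > 0 \<Longrightarrow> g (z / (2 * z + 1)) = g z"
  shows "(\<integral>\<^sup>+z. indicator cusp_domain z * g z \<partial>hyp) =
    (\<integral>\<^sup>+z. indicator fund_domain z * (g z + g (- 1 / z) + g (- 1 / (z + 1))) \<partial>hyp)"
proof -
  let ?L = "fund_domain \<inter> {z. Re z \<le> 0}" and ?R = "fund_domain \<inter> {z. Re z > 0}"
  have sub: "fund_domain \<subseteq> cusp_domain"
    by (auto simp: fund_domain_iff cusp_domain_iff)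
  have [measurable]: "?L \<in> sets borel" "?R \<in> sets borel" by measurable
  have "(\<integral>\<^sup>+z. indicator cusp_domain z * g z \<partial>hyp) =
      (\<integral>\<^sup>+z. indicator fund_domain z * g z + indicator (cusp_domain - fund_domain) z * g z \<partial>hyp)"
    using sub by (intro nn_integral_cong) (auto simp: indicator_def)
  also have "\<dots> = (\<integral>\<^sup>+z. indicator fund_domain z * g z \<partial>hyp) +
      (\<integral>\<^sup>+z. indicator (cusp_domain - fund_domain) z * g z \<partial>hyp)"
    by (rule nn_integral_add) auto
  also have "(\<integral>\<^sup>+z. indicator (cusp_domain - fund_domain) z * g z \<partial>hyp) =
      (\<integral>\<^sup>+z. indicator (cusp_domain - fund_domain) (- 1 / z) * g (- 1 / z) \<partial>hyp)"
    by (rule measure_preserving_nn_integral[OF hyp_inversion, symmetric]) auto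
  \<comment> \<open>The inverted lower part splits at Re z = 1/2 and Re z = -1/2: the middle is
    \<open>fund_domain\<close>, the right piece is its left half moved by 1, and the left piece is
    its right half moved by -1. The sets differ only on the null boundaries excluded below.\<close>
  also have "\<dots> = (\<integral>\<^sup>+z. indicator fund_domain z * g (- 1 / z) +
      (indicator ?L (z + of_real (-1)) * g (- 1 / z) + indicator ?R (z + of_real 1) * g (- 1 / z)) \<partial>hyp)"
  proof (intro nn_integral_cong_AE)
    show "AE z in hyp. indicator (cusp_domain - fund_domain) (- 1 / z) * g (- 1 / z) =
      indicator fund_domain z * g (- 1 / z) +
      (indicator ?L (z + of_real (-1)) * g (- 1 / z) + indicator ?R (z + of_real 1) * g (- 1 / z))"
      using AE_hyp_upper AE_hyp_Re_neq[of "1/2"] AE_hyp_Re_neq[of "-1/2"] AE_hyp_Re_neq[of "-1"] AE_hyp_cmod_neq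
    proof eventually_elim
      case (elim z)
      define n where "n = (Re z)\<^sup>2 + (Im z)\<^sup>2"
      have n1: "n \<noteq> 1" using elim unfolding n_def by (simp add: cmod_def)
      have F: "z \<in> fund_domain \<longleftrightarrow> \<bar>Re z\<bar> \<le> 1/2 \<and> n \<ge> 1"
        using elim by (auto simp: fund_domain_iff n_def)
      have L: "z + of_real (-1) \<in> ?L \<longleftrightarrow> 1/2 \<le> Re z \<and> Re z \<le> 1 \<and> n \<ge> 2 * Re z"
        using elim by (auto simp: fund_domain_iff n_def power2_eq_square algebra_simps)
      have R: "z + of_real 1 \<in> ?R \<longleftrightarrow> -1 < Re z \<and> Re z \<le> - 1/2 \<and> n \<ge> - 2 * Re z"
        using elim by (auto simp: fund_domain_iff n_def power2_eq_square algebra_simps)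
      have D: "- 1 / z \<in> cusp_domain - fund_domain \<longleftrightarrow> \<bar>Re z\<bar> \<le> 1 \<and> n > 1 \<and> n \<ge> 2 * \<bar>Re z\<bar>"
        using inversion_lower_part_iff[of z] elim by (simp add: n_def)
      consider "\<bar>Re z\<bar> < 1/2" | "Re z > 1/2" | "Re z < - 1/2" using elim by linarith
      then show ?case
      proof cases
        case 1
        then have "z + of_real (-1) \<notin> ?L" "z + of_real 1 \<notin> ?R"
          "- 1 / z \<in> cusp_domain - fund_domain \<longleftrightarrow> z \<in> fund_domain"
          unfolding F L R D using n1 by auto
        then show ?thesis by (simp add: indicator_def del: Int_iff Diff_iff)
      next
        case 2
        then have "z \<notin> fund_domain" "z + of_real 1 \<notin> ?R"
          "- 1 / z \<in> cusp_domain - fund_domain \<longleftrightarrow> z + of_real (-1) \<in> ?L"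
          unfolding F L R D using n1 by auto
        then show ?thesis by (simp add: indicator_def del: Int_iff Diff_iff)
      next
        case 3
        then have "z \<notin> fund_domain" "z + of_real (-1) \<notin> ?L"
          "- 1 / z \<in> cusp_domain - fund_domain \<longleftrightarrow> z + of_real 1 \<in> ?R"
          unfolding F L R D using n1 elim by auto
        then show ?thesis by (simp add: indicator_def del: Int_iff Diff_iff)
      qed
    qed
  qed
  also have "\<dots> = (\<integral>\<^sup>+z. indicator fund_domain z * g (- 1 / z) \<partial>hyp) +
      ((\<integral>\<^sup>+z. indicator ?L (z + of_real (-1)) * g (- 1 / z) \<partial>hyp) +
       (\<integral>\<^sup>+z. indicator ?R (z + of_real 1) * g (- 1 / z) \<partial>hyp))"
    by (subst nn_integral_add, simp, simp, subst nn_integral_add) auto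
  also have "(\<integral>\<^sup>+z. indicator ?L (z + of_real (-1)) * g (- 1 / z) \<partial>hyp) =
      (\<integral>\<^sup>+z. indicator ?L z * g (- 1 / (z + 1)) \<partial>hyp)"
    using measure_preserving_nn_integral[OF hyp_translate, where f = "\<lambda>z. indicator ?L z * g (- 1 / (z + 1))", of "-1"]
    by simp
  also have "(\<integral>\<^sup>+z. indicator ?R (z + of_real 1) * g (- 1 / z) \<partial>hyp) =
      (\<integral>\<^sup>+z. indicator ?R z * g (- 1 / (z - 1)) \<partial>hyp)"
    using measure_preserving_nn_integral[OF hyp_translate, where f = "\<lambda>z. indicator ?R z * g (- 1 / (z - 1))", of "1"]
    by simp
  \<comment> \<open>The points -1/(z+1) and -1/(z-1) are related by z/(2z+1), so the invariance
    \<open>V\<close> lets the two half domains use the same coset.\<close>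
  also have "\<dots> = (\<integral>\<^sup>+z. indicator ?R z * g (- 1 / (z + 1)) \<partial>hyp)"
  proof (intro nn_integral_cong)
    fix z
    show "indicator ?R z * g (- 1 / (z - 1)) = indicator ?R z * g (- 1 / (z + 1))"
    proof (cases "Im z > 0")
      case True
      then have nz: "z + 1 \<noteq> 0" "z - 1 \<noteq> 0" by (auto simp: complex_eq_iff)
      have "Im (- 1 / (z + 1)) > 0"
        using True by (intro Im_inversion_pos) simp
      from V[OF this] have "g (- 1 / (z + 1) / (2 * (- 1 / (z + 1)) + 1)) = g (- 1 / (z + 1))" .
      moreover have "- 1 / (z + 1) / (2 * (- 1 / (z + 1)) + 1) = - 1 / (z - 1)"
        using nz by (simp add: divide_simps)
      ultimately show ?thesis by simp
    qed (auto simp: indicator_def fund_domain_def)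
  qed
  also have "(\<integral>\<^sup>+z. indicator ?L z * g (- 1 / (z + 1)) \<partial>hyp) + \<dots> =
      (\<integral>\<^sup>+z. indicator ?L z * g (- 1 / (z + 1)) + indicator ?R z * g (- 1 / (z + 1)) \<partial>hyp)"
    by (rule nn_integral_add[symmetric]) auto
  also have "\<dots> = (\<integral>\<^sup>+z. indicator fund_domain z * g (- 1 / (z + 1)) \<partial>hyp)"
    by (intro nn_integral_cong) (auto simp: indicator_def)
  finally show ?thesis
    by (simp add: distrib_left nn_integral_add add.assoc)
qed

lemma hyp_fricke: "distr hyp borel (\<lambda>z. - 1 / (2 * z)) = hyp"
proof -
  have "hyp = distr (distr hyp borel (\<lambda>z. of_real 2 * z)) borel (\<lambda>z. - 1 / z)"
    by (simp only: hyp_scale[of 2, simplified] hyp_inversion of_real_numeral)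
  also have "\<dots> = distr hyp borel (\<lambda>z. - 1 / (2 * z))"
    by (subst distr_distr) (auto simp: o_def)
  finally show ?thesis by simp
qed

lemma cusp_domain_fricke:
  assumes "Im z > 0"
  shows "- 1 / (2 * z) \<in> cusp_domain \<longleftrightarrow> z \<in> cusp_domain"
proof -
  define n where "n = (Re z)\<^sup>2 + (Im z)\<^sup>2"
  have n: "n > 0" using assms unfolding n_def by (simp add: add_nonneg_pos)
  have z: "2 * z \<noteq> 0" using assms by auto
  have 4: "(Re (2 * z))\<^sup>2 + (Im (2 * z))\<^sup>2 = 4 * n" by (simp add: n_def power_mult_distrib)
  have abs: "\<bar>- Re (2 * z) / (4 * n)\<bar> = \<bar>Re z\<bar> / (2 * n)" using n by simp
  show ?thesis
    unfolding cusp_domain_iff normsq_inversion[OF z]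
    unfolding Re_Im_inversion 4 abs n_def[symmetric] using n assms by (auto simp: field_simps)
qed

text \<open>Let g be h composed with the Fricke involution and let Tr g be its sum over the three
  cosets. Then q = Tr g - g. Summing over cosets multiplies the level one function Tr g by 3 and
  sends g to Tr g, so q gives 3 Tr g - Tr g = 2 Tr g. After passing to \<open>cusp_domain\<close>,
  which the involution preserves, g can be turned back into h.\<close>

lemma nn_integral_hecke_invariant:
  fixes h :: "complex \<Rightarrow> ennreal"
  assumes [measurable]: "h \<in> borel_measurable borel"
    and T: "\<And>z. Im z > 0 \<Longrightarrow> h (z + 1) = h z"
    and V: "\<And>z. Im z > 0 \<Longrightarrow> h (z / (2 * z + 1)) = h z"
  defines "q \<equiv> \<lambda>z. h (z / 2) + h ((z + 1) / 2)"
  shows "(\<integral>\<^sup>+z. indicator fund_domain z * (q z + q (- 1 / z) + q (- 1 / (z + 1))) \<partial>hyp) =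
    2 * (\<integral>\<^sup>+z. indicator fund_domain z * (h z + h (- 1 / z) + h (- 1 / (z + 1))) \<partial>hyp)"
proof -
  define g where "g z = h (- 1 / (2 * z))" for z
  have [measurable]: "g \<in> borel_measurable borel" unfolding g_def by measurable
  have gT: "g (z + 1) = g z" if "Im z > 0" for z
  proof -
    have nz: "z \<noteq> 0" "z + 1 \<noteq> 0" using that by (auto simp: complex_eq_iff)
    have "Im (- 1 / (2 * (z + 1))) > 0"
      using that by (intro Im_inversion_pos) simp
    from V[OF this] have "h (- 1 / (2 * (z + 1)) / (2 * (- 1 / (2 * (z + 1))) + 1)) = g (z + 1)"
      by (simp only: g_def)
    also have "- 1 / (2 * (z + 1)) / (2 * (- 1 / (2 * (z + 1))) + 1) = - 1 / (2 * z)"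
    proof -
      have nz2: "2 + z * 2 \<noteq> 0" using nz(2) by (auto simp: complex_eq_iff)
      have "2 * (- 1 / (2 * (z + 1))) + 1 = z / (z + 1)"
        using nz nz2 by (simp add: field_simps)
      then show ?thesis using nz nz2 by (simp add: field_simps)
    qed
    finally show ?thesis by (simp add: g_def)
  qed
  have gV: "g (z / (2 * z + 1)) = g z" if "Im z > 0" for z
  proof -
    have nz: "z \<noteq> 0" "2 * z + 1 \<noteq> 0" using that by (auto simp: complex_eq_iff)
    have "Im (- 1 / (2 * z) - 1) > 0"
      using Im_inversion_pos[of "2 * z"] that by simp
    from T[OF this] have "h (- 1 / (2 * z)) = h (- 1 / (2 * z) - 1)" by simp
    also have "- 1 / (2 * z) - 1 = - 1 / (2 * (z / (2 * z + 1)))"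
      using nz by (simp add: field_simps)
    finally show ?thesis by (simp add: g_def)
  qed
  have gm: "g (z - 1) = g z" if "Im z > 0" for z
    using gT[of "z - 1"] that by simp
  have tr: "q z + q (- 1 / z) + q (- 1 / (z + 1)) = 2 * (g z + g (- 1 / z) + g (- 1 / (z + 1)))"
    if z: "Im z > 0" for z
  proof -
    have nz: "z \<noteq> 0" "z + 1 \<noteq> 0" "z - 1 \<noteq> 0" using z by (auto simp: complex_eq_iff)
    have im: "Im (- 1 / z) > 0" "Im (- 1 / (z + 1)) > 0" "Im (- 1 / (z - 1)) > 0"
      using Im_inversion_pos[of z] Im_inversion_pos[of "z + 1"] Im_inversion_pos[of "z - 1"] z by simp_all
    have q: "q w = g (- 1 / w) + g (- 1 / (w + 1))" for w
    proof -
      have "- 1 / (2 * (- 1 / v)) = v / 2" for v :: complex by simp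
      then show ?thesis by (simp only: q_def g_def)
    qed
    have "g (- 1 / (- 1 / z + 1)) = g (- 1 / (z - 1))"
    proof -
      have "- 1 / (- 1 / z + 1) = - 1 / (z - 1) - 1"
        using nz by (simp add: divide_simps)
      then show ?thesis using gm[OF im(3)] by simp
    qed
    also have "\<dots> = g (- 1 / (z + 1))"
      using gV[OF im(2)] nz by (simp add: divide_simps)
    finally have 1: "g (- 1 / (- 1 / z + 1)) = g (- 1 / (z + 1))" .
    have "- 1 / (- 1 / (z + 1) + 1) = - 1 / z - 1"
      using nz by (simp add: divide_simps)
    then have 2: "g (- 1 / (- 1 / (z + 1) + 1)) = g (- 1 / z)"
      using gm[OF im(1)] by simp
    show ?thesis
      using gT[OF z] nz by (simp only: q 1 2) (simp add: mult_2 add_ac)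
  qed
  have "(\<integral>\<^sup>+z. indicator fund_domain z * (q z + q (- 1 / z) + q (- 1 / (z + 1))) \<partial>hyp) =
     (\<integral>\<^sup>+z. 2 * (indicator fund_domain z * (g z + g (- 1 / z) + g (- 1 / (z + 1)))) \<partial>hyp)"
    using tr by (intro nn_integral_cong) (auto simp: indicator_def fund_domain_def)
  also have "\<dots> = 2 * (\<integral>\<^sup>+z. indicator fund_domain z * (g z + g (- 1 / z) + g (- 1 / (z + 1))) \<partial>hyp)"
    by (rule nn_integral_cmult) simp
  also have "(\<integral>\<^sup>+z. indicator fund_domain z * (g z + g (- 1 / z) + g (- 1 / (z + 1))) \<partial>hyp) =
      (\<integral>\<^sup>+z. indicator cusp_domain z * g z \<partial>hyp)"
    using gV by (intro cusp_domain_cut_and_paste[symmetric]) auto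
  also have "\<dots> = (\<integral>\<^sup>+z. indicator cusp_domain (- 1 / (2 * z)) * h (- 1 / (2 * z)) \<partial>hyp)"
    using AE_hyp_upper by (intro nn_integral_cong_AE) (elim eventually_mono, simp only: g_def indicator_def cusp_domain_fricke)
  also have "\<dots> = (\<integral>\<^sup>+z. indicator cusp_domain z * h z \<partial>hyp)"
    by (rule measure_preserving_nn_integral[OF hyp_fricke]) auto
  also have "\<dots> = (\<integral>\<^sup>+z. indicator fund_domain z * (h z + h (- 1 / z) + h (- 1 / (z + 1))) \<partial>hyp)"
    using V by (intro cusp_domain_cut_and_paste) auto
  finally show ?thesis .
qed

section \<open>Invariant Lipschitz functions of level two\<close>

lemma upper_iff: "z \<in> upper_half_plane \<longleftrightarrow> Im z > 0"
  by (simp add: upper_half_plane_def)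

text \<open>This is 2 sinh(d/2) for the hyperbolic distance d. It is comparable to d at small scale
  and its Moebius invariance is plain algebra; the price is that the triangle inequality holds only
  in a weakened form.\<close>

definition rho :: "complex \<Rightarrow> complex \<Rightarrow> real" where
  "rho z w = cmod (z - w) / sqrt (Im z * Im w)"

lemma rho_commute: "rho z w = rho w z"
  by (simp add: rho_def norm_minus_commute mult.commute)

lemma rho_nonneg: "Im z > 0 \<Longrightarrow> Im w > 0 \<Longrightarrow> rho z w \<ge> 0"
  by (simp add: rho_def)

lemma Im_moebius:
  fixes a b c d :: real and z :: complex
  shows "Im ((a * z + b) / (c * z + d)) = (a * d - b * c) * Im z / (cmod (c * z + d))\<^sup>2"
  by (simp add: Im_divide cmod_power2 algebra_simps)

lemma moebius_denom_nz:
  fixes a b c d :: real and z :: complex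
  assumes "Im z > 0" "a * d - b * c > 0"
  shows "c * z + d \<noteq> 0"
proof
  assume "c * z + d = 0"
  then have "c * Im z = 0" "c * Re z + d = 0" by (auto simp: complex_eq_iff)
  then have "c = 0" "d = 0" using assms(1) by auto
  then show False using assms(2) by simp
qed

lemma Im_moebius_pos:
  fixes a b c d :: real and z :: complex
  assumes "Im z > 0" "a * d - b * c > 0"
  shows "Im ((a * z + b) / (c * z + d)) > 0"
  unfolding Im_moebius using assms moebius_denom_nz[OF assms] by simp

lemma rho_moebius:
  fixes a b c d :: real and z w :: complex
  assumes "Im z > 0" "Im w > 0" and D: "a * d - b * c > 0"
  shows "rho ((a * z + b) / (c * z + d)) ((a * w + b) / (c * w + d)) = rho z w"
proof -
  let ?D = "a * d - b * c" and ?p = "c * z + d" and ?q = "c * w + d"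
  have nz: "?p \<noteq> 0" "?q \<noteq> 0" using moebius_denom_nz[OF assms(1) D] moebius_denom_nz[OF assms(2) D] by simp_all
  have "(a * z + b) / ?p - (a * w + b) / ?q = of_real ?D * (z - w) / (?p * ?q)"
    using nz by (simp add: diff_frac_eq) (simp add: algebra_simps)
  then have 1: "cmod ((a * z + b) / ?p - (a * w + b) / ?q) = ?D * cmod (z - w) / (cmod ?p * cmod ?q)"
    using D by (simp only: norm_divide norm_mult norm_of_real abs_of_pos)
  have "sqrt (Im ((a * z + b) / ?p) * Im ((a * w + b) / ?q)) = sqrt ((?D / (cmod ?p * cmod ?q))\<^sup>2 * (Im z * Im w))"
    unfolding Im_moebius by (simp add: power2_eq_square mult_ac)
  also have "\<dots> = ?D / (cmod ?p * cmod ?q) * sqrt (Im z * Im w)"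
    using D by (simp add: real_sqrt_mult del: real_sqrt_abs add: real_sqrt_abs abs_mult abs_divide)
  finally show ?thesis
    unfolding rho_def 1 using D nz by simp
qed

lemma rho_half: "Im z > 0 \<Longrightarrow> Im w > 0 \<Longrightarrow> rho ((z + of_real t) / 2) ((w + of_real t) / 2) = rho z w"
  using rho_moebius[of z w 1 2 t 0] by simp

lemma rho_inversion: "Im z > 0 \<Longrightarrow> Im w > 0 \<Longrightarrow> rho (- 1 / (z + of_real t)) (- 1 / (w + of_real t)) = rho z w"
  using rho_moebius[of z w 0 t "-1" 1] by simp

lemma rho_moebius_int:
  assumes "Im z > 0" "Im w > 0" "a * d - b * c = 1"
  shows "rho (moebius_int a b c d z) (moebius_int a b c d w) = rho z w"
proof -
  have "real_of_int a * real_of_int d - real_of_int b * real_of_int c > 0"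
    using assms(3) by (metis of_int_1 of_int_diff of_int_mult zero_less_one)
  then show ?thesis
    using rho_moebius[of z w "of_int a" "of_int d" "of_int b" "of_int c"] assms
    by (simp add: moebius_int_def)
qed

lemma Im_moebius_int:
  assumes "a * d - b * c = 1"
  shows "Im (moebius_int a b c d z) = Im z / (cmod (of_int c * z + of_int d))\<^sup>2"
proof -
  have "real_of_int a * real_of_int d - real_of_int b * real_of_int c = 1"
    using assms by (metis of_int_1 of_int_diff of_int_mult)
  then show ?thesis
    using Im_moebius[of "of_int a" z "of_int b" "of_int c" "of_int d"] by (simp add: moebius_int_def)
qed

lemma moebius_int_denom_nz:
  assumes "Im z > 0" "a * d - b * c = (1::int)"
  shows "of_int c * z + of_int d \<noteq> 0"
proof -
  have "real_of_int a * real_of_int d - real_of_int b * real_of_int c > 0"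
    using assms(2) by (metis of_int_1 of_int_diff of_int_mult zero_less_one)
  then show ?thesis
    using moebius_denom_nz[OF assms(1), of "of_int a" "of_int d" "of_int b" "of_int c"] by simp
qed

lemma Im_moebius_int_pos:
  assumes "Im z > 0" "a * d - b * c = 1"
  shows "Im (moebius_int a b c d z) > 0"
  using Im_moebius_int[OF assms(2), of z] moebius_int_denom_nz[OF assms] assms(1) by simp

text \<open>A bound on \<open>rho\<close> controls the change of height; this is what replaces the
  missing triangle inequality.\<close>

lemma sqrt_ratio_le:
  assumes "Im z > 0" "Im w > 0"
  shows "sqrt (Im z) / sqrt (Im w) \<le> 1 + rho z w"
proof -
  define p q where "p = sqrt (Im z)" and "q = sqrt (Im w)"
  have pq: "p > 0" "q > 0" "Im z = p\<^sup>2" "Im w = q\<^sup>2" using assms by (auto simp: p_def q_def)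
  have "\<bar>Im z - Im w\<bar> \<le> cmod (z - w)" using abs_Im_le_cmod[of "z - w"] by simp
  then have "\<bar>Im z - Im w\<bar> / (p * q) \<le> rho z w"
    using assms by (simp add: rho_def p_def q_def real_sqrt_mult divide_right_mono)
  moreover have "p / q - 1 \<le> \<bar>Im z - Im w\<bar> / (p * q)"
  proof (cases "p \<le> q")
    case True
    then have "p / q - 1 \<le> 0" using pq by simp
    also have "0 \<le> \<bar>Im z - Im w\<bar> / (p * q)" using pq by simp
    finally show ?thesis .
  next
    case False
    have "(p / q - 1) * (p * q) = p * (p - q)" using pq by (simp add: field_simps)
    also have "\<dots> \<le> (p + q) * (p - q)" using False pq by (intro mult_right_mono) auto
    also have "\<dots> \<le> \<bar>Im z - Im w\<bar>" using pq by (simp add: power2_eq_square algebra_simps)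
    finally show ?thesis using pq by (simp add: pos_le_divide_eq)
  qed
  ultimately show ?thesis unfolding p_def q_def by linarith
qed

text \<open>The Euclidean triangle inequality is divided by sqrt(Im u Im w); each term then has the
  wrong normalization, off by a ratio of heights. The form matters: the increment over
  \<open>rho z w\<close> is linear in \<open>rho z u\<close>, which is what a Lipschitz estimate in
  u needs.\<close>

lemma rho_quasi_triangle:
  assumes z: "Im z > 0" and w: "Im w > 0" and u: "Im u > 0"
  shows "rho u w \<le> rho z w + rho z u * (1 + 2 * rho z w)"
proof -
  have "cmod (u - w) \<le> cmod (z - u) + cmod (z - w)"
    using norm_triangle_ineq4[of "z - w" "z - u"] by simp
  then have "rho u w \<le> (cmod (z - u) + cmod (z - w)) / sqrt (Im u * Im w)"
    unfolding rho_def using u w by (intro divide_right_mono) auto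
  also have "\<dots> = rho z u * (sqrt (Im z) / sqrt (Im w)) + rho z w * (sqrt (Im z) / sqrt (Im u))"
    using assms by (simp add: rho_def real_sqrt_mult add_divide_distrib)
  also have "\<dots> \<le> rho z u * (1 + rho z w) + rho z w * (1 + rho z u)"
    using assms by (intro add_mono mult_left_mono sqrt_ratio_le rho_nonneg)
  finally show ?thesis by (simp add: algebra_simps)
qed

text \<open>One number bounds both the values and the Lipschitz constant, so that a single parameter
  describes an equicontinuous family stable under U.\<close>

definition lip_on_upper :: "real \<Rightarrow> (complex \<Rightarrow> real) \<Rightarrow> bool" where
  "lip_on_upper m h \<longleftrightarrow> (\<forall>z. Im z > 0 \<longrightarrow> \<bar>h z\<bar> \<le> m) \<and>
     (\<forall>z w. Im z > 0 \<longrightarrow> Im w > 0 \<longrightarrow> \<bar>h z - h w\<bar> \<le> m * rho z w)"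

lemma lip_on_upper_bound: "lip_on_upper m h \<Longrightarrow> Im z > 0 \<Longrightarrow> \<bar>h z\<bar> \<le> m"
  and lip_on_upper_rho: "lip_on_upper m h \<Longrightarrow> Im z > 0 \<Longrightarrow> Im w > 0 \<Longrightarrow> \<bar>h z - h w\<bar> \<le> m * rho z w"
  by (auto simp: lip_on_upper_def)

lemma lip_on_upper_nonneg: "lip_on_upper m h \<Longrightarrow> m \<ge> 0"
  using lip_on_upper_bound[of m h \<i>] by simp

lemma tendsto_rho_0:
  assumes "Im z > 0"
  shows "((\<lambda>w. rho w z) \<longlongrightarrow> 0) (at z within A)"
proof -
  have "((\<lambda>w. rho w z) \<longlongrightarrow> cmod (z - z) / sqrt (Im z * Im z)) (at z within A)"
    unfolding rho_def using assms by (intro tendsto_intros) auto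
  then show ?thesis by simp
qed

lemma lip_on_upper_continuous:
  assumes "lip_on_upper m h"
  shows "continuous_on upper_half_plane h"
  unfolding continuous_on_def
proof
  fix z assume z: "z \<in> upper_half_plane"
  have "((\<lambda>w. h w - h z) \<longlongrightarrow> 0) (at z within upper_half_plane)"
  proof (rule Lim_null_comparison)
    show "\<forall>\<^sub>F w in at z within upper_half_plane. norm (h w - h z) \<le> m * rho w z"
      unfolding eventually_at_filter using lip_on_upper_rho[OF assms] z
      by (auto simp: upper_iff)
    show "((\<lambda>w. m * rho w z) \<longlongrightarrow> 0) (at z within upper_half_plane)"
      using tendsto_mult_left[OF tendsto_rho_0, of z m] z by (simp add: upper_iff)
  qed
  then show "(h \<longlongrightarrow> h z) (at z within upper_half_plane)"
    by (simp add: LIM_zero_cancel)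
qed

lemma lip_on_upper_inversion:
  assumes "lip_on_upper m h"
  shows "lip_on_upper m (\<lambda>z. h (- 1 / (z + of_real t)))"
proof -
  have im: "Im (- 1 / (z + of_real t)) > 0" if "Im z > 0" for z
    using that by (intro Im_inversion_pos) simp
  show ?thesis
    unfolding lip_on_upper_def
  proof (intro conjI allI impI)
    fix z :: complex assume z: "Im z > 0"
    show "\<bar>h (- 1 / (z + of_real t))\<bar> \<le> m"
      by (rule lip_on_upper_bound[OF assms im[OF z]])
    fix w :: complex assume w: "Im w > 0"
    show "\<bar>h (- 1 / (z + of_real t)) - h (- 1 / (w + of_real t))\<bar> \<le> m * rho z w"
      using lip_on_upper_rho[OF assms im[OF z] im[OF w]] by (simp only: rho_inversion[OF z w])
  qed
qed

lemma lip_on_upper_square: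
  assumes "lip_on_upper m h"
  shows "lip_on_upper (2 * m\<^sup>2) (\<lambda>z. (h z)\<^sup>2)"
  unfolding lip_on_upper_def
proof (intro conjI allI impI)
  have m: "m \<ge> 0" using lip_on_upper_nonneg[OF assms] .
  fix z :: complex assume z: "Im z > 0"
  have "(h z)\<^sup>2 \<le> m\<^sup>2"
    using lip_on_upper_bound[OF assms z] by (metis abs_le_square_iff abs_of_nonneg m)
  then show "\<bar>(h z)\<^sup>2\<bar> \<le> 2 * m\<^sup>2" using zero_le_power2[of m] by (simp only: abs_power2)
  fix w :: complex assume w: "Im w > 0"
  have "\<bar>(h z)\<^sup>2 - (h w)\<^sup>2\<bar> = \<bar>h z + h w\<bar> * \<bar>h z - h w\<bar>"
    by (simp add: abs_mult[symmetric] power2_eq_square algebra_simps)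
  also have "\<dots> \<le> (2 * m) * (m * rho z w)"
    using lip_on_upper_bound[OF assms z] lip_on_upper_bound[OF assms w] lip_on_upper_rho[OF assms z w]
    by (intro mult_mono) auto
  finally show "\<bar>(h z)\<^sup>2 - (h w)\<^sup>2\<bar> \<le> 2 * m\<^sup>2 * rho z w"
    by (simp add: power2_eq_square mult.assoc)
qed

lemma lip_on_upper_diff:
  assumes "lip_on_upper m h" "lip_on_upper m' h'"
  shows "lip_on_upper (m + m') (\<lambda>z. h z - h' z)"
  unfolding lip_on_upper_def
proof (intro conjI allI impI)
  fix z :: complex assume z: "Im z > 0"
  show "\<bar>h z - h' z\<bar> \<le> m + m'"
    using lip_on_upper_bound[OF assms(1) z] lip_on_upper_bound[OF assms(2) z] by linarith
  fix w :: complex assume w: "Im w > 0"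
  have "\<bar>h z - h' z - (h w - h' w)\<bar> \<le> m * rho z w + m' * rho z w"
    using lip_on_upper_rho[OF assms(1) z w] lip_on_upper_rho[OF assms(2) z w] by linarith
  then show "\<bar>h z - h' z - (h w - h' w)\<bar> \<le> (m + m') * rho z w"
    by (simp add: distrib_right)
qed

lemma lip_on_upper_const: "lip_on_upper \<bar>c\<bar> (\<lambda>_. c)"
  by (auto simp: lip_on_upper_def intro!: mult_nonneg_nonneg rho_nonneg)

lemma lip_on_upper_mono:
  assumes "lip_on_upper m h" "m \<le> m'"
  shows "lip_on_upper m' h"
proof -
  have "\<bar>h z - h w\<bar> \<le> m' * rho z w" if "Im z > 0" "Im w > 0" for z w
    using lip_on_upper_rho[OF assms(1) that] mult_right_mono[OF assms(2) rho_nonneg[OF that]] by linarith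
  moreover have "\<bar>h z\<bar> \<le> m'" if "Im z > 0" for z
    using lip_on_upper_bound[OF assms(1) that] assms(2) by linarith
  ultimately show ?thesis
    unfolding lip_on_upper_def by blast
qed

section \<open>Functions of level two and the operator U\<close>

definition gamma0_2_invariant :: "(complex \<Rightarrow> real) \<Rightarrow> bool" where
  "gamma0_2_invariant h \<longleftrightarrow> (\<forall>a b c d. a * d - b * c = 1 \<longrightarrow> even c \<longrightarrow>
     (\<forall>z. Im z > 0 \<longrightarrow> h (moebius_int a b c d z) = h z))"

lemma gamma0_2_invariantD:
  "gamma0_2_invariant h \<Longrightarrow> a * d - b * c = 1 \<Longrightarrow> even c \<Longrightarrow> Im z > 0 \<Longrightarrow> h (moebius_int a b c d z) = h z"
  by (auto simp: gamma0_2_invariant_def)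

lemma SL2Z_invariant_imp_gamma0_2: "SL2Z_invariant h \<Longrightarrow> gamma0_2_invariant h"
  by (auto simp: SL2Z_invariant_def gamma0_2_invariant_def upper_iff)

lemma gamma0_2_invariant_translate:
  "gamma0_2_invariant h \<Longrightarrow> Im z > 0 \<Longrightarrow> h (z + 1) = h z"
  using gamma0_2_invariantD[of h 1 1 1 0 z] by (simp add: moebius_int_def)

lemma gamma0_2_invariant_parabolic:
  "gamma0_2_invariant h \<Longrightarrow> Im z > 0 \<Longrightarrow> h (z / (2 * z + 1)) = h z"
  using gamma0_2_invariantD[of h 1 1 0 2 z] by (simp add: moebius_int_def)

definition hecke_U :: "(complex \<Rightarrow> real) \<Rightarrow> complex \<Rightarrow> real" where
  "hecke_U h z = (h (z / 2) + h ((z + 1) / 2)) / 2"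

text \<open>With M_j the matrix of z -> (z+j)/2 and A the given matrix, M_j A = A' M_k with A' again
  of even lower left entry, for the k with b + j d = k (a + j c) modulo 2. Such a k exists because a
  and d are odd: even b fixes the two branches, odd b swaps them.\<close>

lemma hecke_U_invariant:
  assumes h: "gamma0_2_invariant h"
  shows "gamma0_2_invariant (hecke_U h)"
  unfolding gamma0_2_invariant_def
proof (intro allI impI)
  fix a b c d :: int and z :: complex
  assume det: "a * d - b * c = 1" and c: "even c" and z: "Im z > 0"
  let ?w = "moebius_int a b c d z"
  have nz: "of_int c * z + of_int d \<noteq> 0" using moebius_int_denom_nz[OF z det] .
  have "a * d = 1 + b * c" using det by simp
  then have "odd (a * d)" using c by simp
  then have odd: "odd a" "odd d" by auto
  have step: "h ((?w + of_int j) / 2) = h ((z + of_int k) / 2)"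
    if ev: "even (b + j * d - k * (a + j * c))" for j k
  proof -
    \<comment> \<open>This e is the upper right entry of A'; the parity condition is exactly its
      integrality.\<close>
    obtain e where e: "b + j * d - k * (a + j * c) = 2 * e" using ev by (rule evenE)
    have "(a + j * c) * (d - c * k) - e * (2 * c) = a * d - a * c * k + j * c * d - j * c * c * k - c * (2 * e)"
      by (simp add: algebra_simps)
    also have "\<dots> = 1" unfolding e[symmetric] using det by (simp add: algebra_simps)
    finally have det': "(a + j * c) * (d - c * k) - e * (2 * c) = 1" .
    have "of_int (2 * e) = (of_int (b + j * d - k * (a + j * c)) :: complex)" using e by simp
    then have e': "2 * of_int e = (of_int b + of_int j * of_int d - of_int k * (of_int a + of_int j * of_int c) :: complex)"
      by simp
    have "moebius_int (a + j * c) e (2 * c) (d - c * k) ((z + of_int k) / 2)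
        = ((of_int a + of_int j * of_int c) * (z + of_int k) + 2 * of_int e) / (2 * (of_int c * z + of_int d))"
    proof -
      have den: "of_int (2 * c) * ((z + of_int k) / 2) + of_int (d - c * k) = of_int c * z + (of_int d :: complex)"
        by (simp add: algebra_simps)
      have num: "of_int (a + j * c) * ((z + of_int k) / 2) + of_int e
          = ((of_int a + of_int j * of_int c) * (z + of_int k) + 2 * of_int e) / (2 :: complex)"
        by (simp add: field_simps)
      show ?thesis unfolding moebius_int_def den num by (simp only: divide_divide_eq_left)
    qed
    also have "(of_int a + of_int j * of_int c) * (z + of_int k) + 2 * of_int e
        = (of_int a * z + of_int b) + of_int j * (of_int c * z + of_int d)"
      unfolding e' by (simp add: algebra_simps)
    also have "\<dots> / (2 * (of_int c * z + of_int d)) = (?w + of_int j) / 2"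
    proof -
      have "(p + t * q) / (2 * q) = (p / q + t) / 2" if "q \<noteq> 0" for p q t :: complex
        using that by (simp add: field_simps)
      from this[OF nz] show ?thesis unfolding moebius_int_def .
    qed
    finally have eq: "moebius_int (a + j * c) e (2 * c) (d - c * k) ((z + of_int k) / 2) = (?w + of_int j) / 2" .
    show ?thesis
      unfolding eq[symmetric] using gamma0_2_invariantD[OF h det'] z by simp
  qed
  show "hecke_U h ?w = hecke_U h z"
  proof (cases "even b")
    case True
    then show ?thesis
      using step[of 0 0] step[of 1 1] odd c by (simp add: hecke_U_def)
  next
    case False
    then show ?thesis
      using step[of 0 1] step[of 1 0] odd c by (simp add: hecke_U_def)
  qed
qed

text \<open>Both branches preserve \<open>rho\<close>, so averaging over them cannot raise the
  constant.\<close>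

lemma lip_on_upper_hecke_U:
  assumes "lip_on_upper m h"
  shows "lip_on_upper m (hecke_U h)"
  unfolding lip_on_upper_def
proof (intro conjI allI impI)
  fix z :: complex assume z: "Im z > 0"
  then have z': "Im (z / 2) > 0" "Im ((z + 1) / 2) > 0" by auto
  show "\<bar>hecke_U h z\<bar> \<le> m"
    using lip_on_upper_bound[OF assms z'(1)] lip_on_upper_bound[OF assms z'(2)]
    by (auto simp: hecke_U_def abs_le_iff field_simps)
  fix w :: complex assume w: "Im w > 0"
  then have w': "Im (w / 2) > 0" "Im ((w + 1) / 2) > 0" by auto
  have "\<bar>h (z / 2) - h (w / 2)\<bar> \<le> m * rho z w" "\<bar>h ((z + 1) / 2) - h ((w + 1) / 2)\<bar> \<le> m * rho z w"
    using lip_on_upper_rho[OF assms z'(1) w'(1)] lip_on_upper_rho[OF assms z'(2) w'(2)]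
      rho_half[OF z w, of 0] rho_half[OF z w, of 1] by auto
  then show "\<bar>hecke_U h z - hecke_U h w\<bar> \<le> m * rho z w"
    by (auto simp: hecke_U_def abs_le_iff field_simps)
qed

text \<open>The branch chosen by the outermost application of U is the lowest binary digit of j, so
  the induction splits the sum by the parity of j.\<close>

lemma hecke_U_iterate:
  "(hecke_U ^^ k) h z = (\<Sum>j<2 ^ k. h ((z + of_nat j) / 2 ^ k)) / 2 ^ k"
proof (induction k arbitrary: z)
  case (Suc k)
  have split: "(\<Sum>j<2 * n. F j) = (\<Sum>j<n. F (2 * j) + F (2 * j + 1))" for F :: "nat \<Rightarrow> real" and n
    by (induction n) (auto simp: algebra_simps)
  have "(hecke_U ^^ Suc k) h z = ((hecke_U ^^ k) h (z / 2) + (hecke_U ^^ k) h ((z + 1) / 2)) / 2"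
    by (simp add: hecke_U_def)
  also have "\<dots> = (\<Sum>j<2 ^ k. h ((z / 2 + of_nat j) / 2 ^ k) + h (((z + 1) / 2 + of_nat j) / 2 ^ k)) / 2 ^ Suc k"
    by (simp add: Suc sum.distrib add_divide_distrib)
  also have "(\<Sum>j<2 ^ k. h ((z / 2 + of_nat j) / 2 ^ k) + h (((z + 1) / 2 + of_nat j) / 2 ^ k)) =
      (\<Sum>j<2 ^ k. h ((z + of_nat (2 * j)) / 2 ^ Suc k) + h ((z + of_nat (2 * j + 1)) / 2 ^ Suc k))"
    by (intro sum.cong refl arg_cong2[where f = "(+)"] arg_cong[where f = h]) (simp_all add: add_divide_distrib)
  also have "\<dots> = (\<Sum>j<2 ^ Suc k. h ((z + of_nat j) / 2 ^ Suc k))"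
    using split[of "\<lambda>j. h ((z + of_nat j) / 2 ^ Suc k)" "2 ^ k"] by simp
  finally show ?case .
qed simp

definition level2_lip :: "real \<Rightarrow> (complex \<Rightarrow> real) set" where
  "level2_lip m = {h. lip_on_upper m h \<and> gamma0_2_invariant h}"

lemma level2_lip_hecke_U: "h \<in> level2_lip m \<Longrightarrow> (hecke_U ^^ k) h \<in> level2_lip m"
  by (induction k) (auto simp: level2_lip_def lip_on_upper_hecke_U hecke_U_invariant)

section \<open>Reduction theory and integration over the fundamental domain\<close>

text \<open>Choose a nonzero integer pair (c, d) minimizing |cz + d|. It is coprime, since dividing
  by a common factor would shrink it, and so it is the lower row of a matrix; a translation brings
  the real part into [-1/2, 1/2]. The upper row is a competing pair, so |az + b| >= |cz + d|, which
  puts the image outside the open unit disc.\<close>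

lemma reduction_to_fund_domain:
  assumes z: "Im z > 0"
  obtains a b c d where "a * d - b * c = (1::int)" "moebius_int a b c d z \<in> fund_domain"
proof -
  define N where "N p = cmod (of_int (fst p) * z + of_int (snd p))" for p :: "int \<times> int"
  define X where "X = {p. p \<noteq> (0, 0) \<and> N p \<le> 1}"
  have "X \<subseteq> {- \<lceil>1 / Im z\<rceil>..\<lceil>1 / Im z\<rceil>} \<times> {- \<lceil>1 + cmod z / Im z\<rceil>..\<lceil>1 + cmod z / Im z\<rceil>}"
  proof
    fix p assume "p \<in> X"
    then have N: "N p \<le> 1" by (simp add: X_def)
    obtain c d where p: "p = (c, d)" by fastforce
    have "\<bar>real_of_int c\<bar> * Im z = \<bar>Im (of_int c * z + of_int d)\<bar>" using z by (simp add: abs_mult)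
    also have "\<dots> \<le> 1" using N abs_Im_le_cmod[of "of_int c * z + of_int d"] by (simp add: N_def p)
    finally have c: "\<bar>real_of_int c\<bar> \<le> 1 / Im z" using z by (simp add: field_simps)
    have "\<bar>real_of_int d\<bar> = cmod ((of_int c * z + of_int d) - of_int c * z)" by simp
    also have "\<dots> \<le> 1 + \<bar>real_of_int c\<bar> * cmod z"
      using norm_triangle_ineq4[of "of_int c * z + of_int d" "of_int c * z"] N by (simp add: N_def p norm_mult)
    also have "\<dots> \<le> 1 + (1 / Im z) * cmod z" using c by (intro add_left_mono mult_right_mono) auto
    finally have d: "\<bar>real_of_int d\<bar> \<le> 1 + cmod z / Im z" by simp
    have "\<bar>real_of_int c\<bar> \<le> real_of_int \<lceil>1 / Im z\<rceil>" "\<bar>real_of_int d\<bar> \<le> real_of_int \<lceil>1 + cmod z / Im z\<rceil>"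
      using c d le_of_int_ceiling order_trans by blast+
    then have "\<bar>c\<bar> \<le> \<lceil>1 / Im z\<rceil>" "\<bar>d\<bar> \<le> \<lceil>1 + cmod z / Im z\<rceil>" by linarith+
    then show "p \<in> {- \<lceil>1 / Im z\<rceil>..\<lceil>1 / Im z\<rceil>} \<times> {- \<lceil>1 + cmod z / Im z\<rceil>..\<lceil>1 + cmod z / Im z\<rceil>}"
      unfolding p by auto
  qed
  then have fin: "finite X" by (rule finite_subset) auto
  have "(0, 1) \<in> X" by (simp add: X_def N_def)
  then obtain p where p: "p \<in> X" "\<And>q. q \<in> X \<Longrightarrow> N p \<le> N q"
    using ex_is_arg_min_if_finite[OF fin, of N] by (auto simp: is_arg_min_linorder)
  \<comment> \<open>As (0, 1) has size 1, the minimum over the finite set \<open>X\<close> is a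
    minimum over all nonzero pairs.\<close>
  have min: "N p \<le> N q" if "q \<noteq> (0, 0)" for q
    using p(2)[of q] p(1) that by (cases "N q \<le> 1") (auto simp: X_def)
  obtain c d where cd: "p = (c, d)" by fastforce
  have Npos: "N q > 0" if "q \<noteq> (0, 0)" for q
  proof -
    have "of_int (fst q) * z + of_int (snd q) \<noteq> 0"
    proof
      assume "of_int (fst q) * z + of_int (snd q) = 0"
      then have "of_int (fst q) * Im z = 0" "of_int (fst q) * Re z + of_int (snd q) = 0"
        by (auto simp: complex_eq_iff)
      then show False using z that by (cases q) auto
    qed
    then show ?thesis by (simp add: N_def)
  qed
  have p0: "p \<noteq> (0, 0)" using p by (simp add: X_def)
  have "coprime c d"
  proof (rule ccontr)
    assume "\<not> coprime c d"
    define g where "g = gcd c d"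
    have g: "g > 1"
      using \<open>\<not> coprime c d\<close> p0 cd unfolding g_def coprime_iff_gcd_eq_1
      by (smt (verit) gcd_eq_0_iff gcd_ge_0_int)
    obtain c' d' where c': "c = g * c'" "d = g * d'"
      by (metis dvdE g_def gcd_dvd1 gcd_dvd2)
    have nz: "(c', d') \<noteq> (0, 0)" using c' p0 cd by auto
    have "of_int c * z + of_int d = of_int g * (of_int c' * z + of_int d')"
      by (simp add: c' algebra_simps)
    then have "N p = real_of_int g * N (c', d')"
      using g by (simp add: N_def cd norm_mult)
    moreover have "N (c', d') < real_of_int g * N (c', d')"
      using g Npos[OF nz] by simp
    ultimately show False using min[OF nz] by linarith
  qed
  then obtain u v where uv: "u * c + v * d = 1"
    using bezout_int[of c d] by (auto simp: coprime_iff_gcd_eq_1)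
  define n where "n = - round (Re (moebius_int v (-u) c d z))"
  define a b where "a = v + n * c" and "b = - u + n * d"
  have det: "a * d - b * c = 1"
    using uv by (simp add: a_def b_def algebra_simps)
  have nz: "of_int c * z + of_int d \<noteq> 0" using moebius_int_denom_nz[OF z det] .
  have w: "moebius_int a b c d z = moebius_int v (-u) c d z + of_int n"
    using nz by (simp add: moebius_int_def a_def b_def field_simps)
  have "\<bar>Re (moebius_int a b c d z)\<bar> \<le> 1 / 2"
    unfolding w n_def using of_int_round_abs_le[of "Re (moebius_int v (-u) c d z)"] by (simp add: abs_minus_commute)
  moreover have "cmod (moebius_int a b c d z) \<ge> 1"
  proof -
    have "(a, b) \<noteq> (0, 0)" using det by auto
    from min[OF this] show ?thesis
      using nz by (simp add: moebius_int_def N_def cd norm_divide)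
  qed
  ultimately have "moebius_int a b c d z \<in> fund_domain"
    using Im_moebius_int_pos[OF z det] by (simp add: fund_domain_def)
  with det show thesis by (rule that)
qed

text \<open>The column (a, c) is nonzero modulo 2, so one of c, a, a + c is even. These are, up to
  sign, the lower left entries of the matrix multiplied by 1, S and ST, and the product with an even
  entry leaves h unchanged.\<close>

lemma gamma0_2_cosets:
  assumes h: "gamma0_2_invariant h" and z: "Im z > 0" and det: "a * d - b * c = 1"
  defines "w \<equiv> moebius_int a b c d z"
  shows "h z = h w \<or> h z = h (- 1 / w) \<or> h z = h (- 1 / (w + 1))"
proof -
  have nz: "of_int c * z + of_int d \<noteq> 0" using moebius_int_denom_nz[OF z det] .
  consider "even c" | "even a" | "even (a + c)" by auto
  then show ?thesis
  proof cases
    case 1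
    then show ?thesis using gamma0_2_invariantD[OF h det _ z] by (simp add: w_def)
  next
    case 2
    have "moebius_int (- c) (- d) a b z = - 1 / w"
      unfolding w_def moebius_int_def by (simp add: minus_divide_left)
    moreover have "(- c) * b - (- d) * a = 1" using det by (simp add: algebra_simps)
    ultimately show ?thesis using gamma0_2_invariantD[OF h _ 2 z] by metis
  next
    case 3
    have "w + 1 = (of_int (a + c) * z + of_int (b + d)) / (of_int c * z + of_int d)"
      unfolding w_def moebius_int_def using nz by (simp add: field_simps)
    then have "moebius_int (- c) (- d) (a + c) (b + d) z = - 1 / (w + 1)"
      unfolding moebius_int_def by (simp add: minus_divide_left)
    moreover have "(- c) * (b + d) - (- d) * (a + c) = 1" using det by (simp add: algebra_simps)
    ultimately show ?thesis using gamma0_2_invariantD[OF h _ 3 z] by metis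
  qed
qed

section \<open>Integration over the fundamental domain\<close>

definition nuF :: "complex measure" where
  "nuF = restrict_space hyp fund_domain"

lemma space_nuF [simp]: "space nuF = fund_domain"
  by (simp add: nuF_def space_restrict_space)

lemma sets_nuF: "sets nuF = sets (restrict_space borel fund_domain)"
  by (simp add: nuF_def sets_restrict_space)

lemma emeasure_nuF_space: "emeasure nuF fund_domain = ennreal (pi / 3)"
  by (simp add: nuF_def emeasure_restrict_space emeasure_hyp_fund_domain)

lemma finite_measure_nuF: "finite_measure nuF"
  by standard (simp add: emeasure_nuF_space)

interpretation nuF: finite_measure nuF by (rule finite_measure_nuF)

lemma measure_nuF_space: "measure nuF fund_domain = pi / 3"
  by (simp add: measure_def emeasure_nuF_space)

lemma Im_fund_domain: "z \<in> fund_domain \<Longrightarrow> Im z > 0"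
  by (simp add: fund_domain_def)

lemma continuous_on_upper_measurable_nuF:
  assumes "continuous_on upper_half_plane q"
  shows "q \<in> borel_measurable nuF"
proof -
  have "continuous_on fund_domain q"
    using assms by (rule continuous_on_subset) (auto simp: upper_iff Im_fund_domain)
  then show ?thesis
    using borel_measurable_continuous_on_restrict measurable_cong_sets[OF sets_nuF refl] by blast
qed

lemma bounded_integrable_nuF:
  fixes q :: "complex \<Rightarrow> real"
  assumes "continuous_on upper_half_plane q" "\<And>z. Im z > 0 \<Longrightarrow> \<bar>q z\<bar> \<le> B"
  shows "integrable nuF q"
  by (rule nuF.integrable_const_bound[where B = B])
    (use assms in \<open>auto intro!: AE_I2 continuous_on_upper_measurable_nuF simp: Im_fund_domain\<close>)

lemma lip_on_upper_integrable_nuF: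
  assumes "lip_on_upper m q"
  shows "integrable nuF q"
  using bounded_integrable_nuF[OF lip_on_upper_continuous[OF assms]] lip_on_upper_bound[OF assms] by blast

definition coset_sum :: "(complex \<Rightarrow> real) \<Rightarrow> complex \<Rightarrow> real" where
  "coset_sum h z = h z + h (- 1 / z) + h (- 1 / (z + 1))"

text \<open>For Gamma_0(2)-invariant h this is the hyperbolic integral over the quotient by
  Gamma_0(2), of total mass pi. Summing over the three cosets keeps everything on one finite measure
  space.\<close>

definition level2_integral :: "(complex \<Rightarrow> real) \<Rightarrow> real" where
  "level2_integral h = (\<integral>z. coset_sum h z \<partial>nuF)"

lemma lip_on_upper_S: "lip_on_upper m h \<Longrightarrow> lip_on_upper m (\<lambda>z. h (- 1 / z))"
  and lip_on_upper_ST: "lip_on_upper m h \<Longrightarrow> lip_on_upper m (\<lambda>z. h (- 1 / (z + 1)))"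
  using lip_on_upper_inversion[of m h 0] lip_on_upper_inversion[of m h 1] by simp_all

lemma coset_sum_integrable:
  assumes "lip_on_upper m h"
  shows "integrable nuF (coset_sum h)"
  unfolding coset_sum_def
  using lip_on_upper_integrable_nuF[OF assms] lip_on_upper_integrable_nuF[OF lip_on_upper_S[OF assms]]
    lip_on_upper_integrable_nuF[OF lip_on_upper_ST[OF assms]] by simp

lemma level2_integral_eq:
  assumes "lip_on_upper m h"
  shows "level2_integral h = (\<integral>z. h z \<partial>nuF) + (\<integral>z. h (- 1 / z) \<partial>nuF) + (\<integral>z. h (- 1 / (z + 1)) \<partial>nuF)"
  unfolding level2_integral_def coset_sum_def
  using lip_on_upper_integrable_nuF[OF assms] lip_on_upper_integrable_nuF[OF lip_on_upper_S[OF assms]]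
    lip_on_upper_integrable_nuF[OF lip_on_upper_ST[OF assms]] by simp

lemma level2_integral_diff:
  assumes "lip_on_upper m h" "lip_on_upper m' h'"
  shows "level2_integral (\<lambda>z. h z - h' z) = level2_integral h - level2_integral h'"
proof -
  have "coset_sum (\<lambda>z. h z - h' z) = (\<lambda>z. coset_sum h z - coset_sum h' z)"
    by (auto simp: coset_sum_def)
  then show ?thesis
    unfolding level2_integral_def using coset_sum_integrable[OF assms(1)] coset_sum_integrable[OF assms(2)] by simp
qed

lemma level2_integral_const: "level2_integral (\<lambda>_. c) = pi * c"
  by (simp add: level2_integral_def coset_sum_def measure_nuF_space)

lemma coset_sum_cong:
  assumes "\<And>w. Im w > 0 \<Longrightarrow> h w = h' w" "Im z > 0"
  shows "coset_sum h z = coset_sum h' z"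
proof -
  have "Im (- 1 / z) > 0" "Im (- 1 / (z + 1)) > 0"
    using assms(2) Im_inversion_pos[of z] Im_inversion_pos[of "z + 1"] by simp_all
  then show ?thesis unfolding coset_sum_def using assms by metis
qed

lemma coset_sum_nonneg:
  assumes "\<And>w. Im w > 0 \<Longrightarrow> h w \<ge> 0" "Im z > 0"
  shows "coset_sum h z \<ge> 0"
  unfolding coset_sum_def using Im_inversion_pos[of z] Im_inversion_pos[of "z + 1"]
  by (intro add_nonneg_nonneg assms) (use assms(2) in simp_all)

lemma level2_integral_nonneg:
  assumes "\<And>w. Im w > 0 \<Longrightarrow> h w \<ge> 0"
  shows "level2_integral h \<ge> 0"
  unfolding level2_integral_def
  by (rule Bochner_Integration.integral_nonneg_AE) (use assms in \<open>auto intro!: AE_I2 coset_sum_nonneg Im_fund_domain\<close>)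

lemma level2_integral_cong:
  assumes "\<And>w. Im w > 0 \<Longrightarrow> h w = h' w"
  shows "level2_integral h = level2_integral h'"
  unfolding level2_integral_def using assms
  by (intro Bochner_Integration.integral_cong refl coset_sum_cong) (auto intro: Im_fund_domain)

lemma level2_integral_hecke_U:
  assumes h: "lip_on_upper m h" and inv: "gamma0_2_invariant h"
  shows "level2_integral (hecke_U h) = level2_integral h"
proof -
  \<comment> \<open>Adding m makes the function nonnegative, as the cut and paste identity for
    nonnegative integrals requires. Cutting off outside the half-plane makes it Borel on the whole
    plane, since h is controlled only inside.\<close>
  define k where "k z = ennreal (indicator upper_half_plane z * (h z + m))" for z
  define q where "q z = k (z / 2) + k ((z + 1) / 2)" for z
  have nn: "h z + m \<ge> 0" if "Im z > 0" for z
    using lip_on_upper_bound[OF h that] by linarith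
  have k: "k z = ennreal (h z + m)" if "Im z > 0" for z
    using that by (simp add: k_def indicator_def upper_iff)
  have [measurable]: "k \<in> borel_measurable borel"
  proof -
    have "(\<lambda>z. indicator upper_half_plane z *\<^sub>R (h z + m)) \<in> borel_measurable borel"
      by (intro borel_measurable_continuous_on_indicator continuous_intros lip_on_upper_continuous[OF h]) simp
    then show ?thesis unfolding k_def by simp
  qed
  have im: "Im (- 1 / z) > 0" "Im (- 1 / (z + 1)) > 0" if "Im z > 0" for z
    using that Im_inversion_pos[of z] Im_inversion_pos[of "z + 1"] by simp_all
  have q: "q z = 2 * ennreal (hecke_U h z + m)" if "Im z > 0" for z
  proof -
    have "q z = ennreal (h (z / 2) + m + (h ((z + 1) / 2) + m))"
      unfolding q_def using that k[of "z / 2"] k[of "(z + 1) / 2"] nn[of "z / 2"] nn[of "(z + 1) / 2"]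
      by (subst ennreal_plus) simp_all
    also have "\<dots> = ennreal (2 * (hecke_U h z + m))"
      by (rule arg_cong[where f = ennreal]) (simp add: hecke_U_def)
    also have "\<dots> = ennreal 2 * ennreal (hecke_U h z + m)"
      by (rule ennreal_mult') simp
    finally show ?thesis by simp
  qed
  have int: "(\<integral>\<^sup>+z. indicator fund_domain z * (ennreal (g z + m) + ennreal (g (- 1 / z) + m) + ennreal (g (- 1 / (z + 1)) + m)) \<partial>hyp)
      = ennreal (level2_integral g + pi * m)" if g: "lip_on_upper m g" for g
  proof -
    have nn: "g z + m \<ge> 0" if "Im z > 0" for z
      using lip_on_upper_bound[OF g that] by linarith
    have pos: "coset_sum g z + 3 * m \<ge> 0" if "Im z > 0" for z
      using nn[OF that] nn[OF im(1)[OF that]] nn[OF im(2)[OF that]] by (simp add: coset_sum_def)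
    have "(\<integral>\<^sup>+z. indicator fund_domain z * (ennreal (g z + m) + ennreal (g (- 1 / z) + m) + ennreal (g (- 1 / (z + 1)) + m)) \<partial>hyp)
        = (\<integral>\<^sup>+z. ennreal (coset_sum g z + 3 * m) * indicator fund_domain z \<partial>hyp)"
    proof (intro nn_integral_cong)
      fix z
      have "ennreal (g z + m) + ennreal (g (- 1 / z) + m) + ennreal (g (- 1 / (z + 1)) + m) = ennreal (coset_sum g z + 3 * m)"
        if "Im z > 0"
        using nn[OF that] nn[OF im(1)[OF that]] nn[OF im(2)[OF that]]
        by (simp add: ennreal_plus[symmetric] coset_sum_def add_ac del: ennreal_plus)
      then show "indicator fund_domain z * (ennreal (g z + m) + ennreal (g (- 1 / z) + m) + ennreal (g (- 1 / (z + 1)) + m))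
          = ennreal (coset_sum g z + 3 * m) * indicator fund_domain z"
        by (auto simp: indicator_def Im_fund_domain)
    qed
    also have "\<dots> = (\<integral>\<^sup>+z. ennreal (coset_sum g z + 3 * m) \<partial>nuF)"
      unfolding nuF_def by (rule nn_integral_restrict_space[symmetric]) simp
    also have "\<dots> = ennreal (\<integral>z. coset_sum g z + 3 * m \<partial>nuF)"
      using coset_sum_integrable[OF g] pos by (intro nn_integral_eq_integral) (auto intro!: AE_I2 simp: Im_fund_domain)
    also have "(\<integral>z. coset_sum g z + 3 * m \<partial>nuF) = level2_integral g + pi * m"
      using coset_sum_integrable[OF g] by (simp add: level2_integral_def measure_nuF_space)
    finally show ?thesis .
  qed
  have pos: "level2_integral g + pi * m \<ge> 0" if g: "lip_on_upper m g" for g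
  proof -
    have "level2_integral (\<lambda>z. g z - (- m)) \<ge> 0"
    proof (rule level2_integral_nonneg)
      show "g w - - m \<ge> 0" if "Im w > 0" for w
        using lip_on_upper_bound[OF g that] by linarith
    qed
    then show ?thesis
      unfolding level2_integral_diff[OF g lip_on_upper_const] level2_integral_const by simp
  qed
  have "2 * ennreal (level2_integral (hecke_U h) + pi * m) =
      2 * (\<integral>\<^sup>+z. indicator fund_domain z * (ennreal (hecke_U h z + m) + ennreal (hecke_U h (- 1 / z) + m) + ennreal (hecke_U h (- 1 / (z + 1)) + m)) \<partial>hyp)"
    using int[OF lip_on_upper_hecke_U[OF h]] by simp
  also have "\<dots> = (\<integral>\<^sup>+z. 2 * (indicator fund_domain z * (ennreal (hecke_U h z + m) + ennreal (hecke_U h (- 1 / z) + m) + ennreal (hecke_U h (- 1 / (z + 1)) + m))) \<partial>hyp)"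
  proof (rule nn_integral_cmult[symmetric])
    have c: "continuous_on upper_half_plane (hecke_U h)"
      by (rule lip_on_upper_continuous[OF lip_on_upper_hecke_U[OF h]])
    have [measurable]: "(\<lambda>z. ennreal (indicator upper_half_plane z * (hecke_U h z + m))) \<in> borel_measurable borel"
      using borel_measurable_continuous_on_indicator[OF upper_half_plane_measurable, of "\<lambda>z. hecke_U h z + m"] c
      by (simp add: continuous_on_add)
    define k' where "k' z = ennreal (indicator upper_half_plane z * (hecke_U h z + m))" for z
    have [measurable]: "k' \<in> borel_measurable borel" unfolding k'_def by measurable
    have "(\<lambda>z. indicator fund_domain z * (ennreal (hecke_U h z + m) + ennreal (hecke_U h (- 1 / z) + m) + ennreal (hecke_U h (- 1 / (z + 1)) + m)))
        = (\<lambda>z. indicator fund_domain z * (k' z + k' (- 1 / z) + k' (- 1 / (z + 1))))"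
      using im by (intro ext) (simp add: k'_def indicator_def upper_iff Im_fund_domain)
    then show "(\<lambda>z. indicator fund_domain z * (ennreal (hecke_U h z + m) + ennreal (hecke_U h (- 1 / z) + m) + ennreal (hecke_U h (- 1 / (z + 1)) + m)))
        \<in> borel_measurable hyp"
      by simp
  qed
  also have "\<dots> = (\<integral>\<^sup>+z. indicator fund_domain z * (q z + q (- 1 / z) + q (- 1 / (z + 1))) \<partial>hyp)"
  proof (intro nn_integral_cong)
    fix z
    show "2 * (indicator fund_domain z * (ennreal (hecke_U h z + m) + ennreal (hecke_U h (- 1 / z) + m) + ennreal (hecke_U h (- 1 / (z + 1)) + m)))
        = indicator fund_domain z * (q z + q (- 1 / z) + q (- 1 / (z + 1)))"
    proof (cases "z \<in> fund_domain")
      case True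
      then have "Im z > 0" by (rule Im_fund_domain)
      then show ?thesis
        using True by (simp only: q im distrib_left indicator_simps if_True mult_1)
    qed simp
  qed
  also have "\<dots> = 2 * (\<integral>\<^sup>+z. indicator fund_domain z * (k z + k (- 1 / z) + k (- 1 / (z + 1))) \<partial>hyp)"
    unfolding q_def
  proof (rule nn_integral_hecke_invariant)
    fix z :: complex assume z: "Im z > 0"
    then show "k (z + 1) = k z"
      using gamma0_2_invariant_translate[OF inv z] by (simp add: k)
    have "Im (z / (2 * z + 1)) > 0"
      using Im_moebius_pos[OF z, of 1 1 0 2] by simp
    then show "k (z / (2 * z + 1)) = k z"
      using gamma0_2_invariant_parabolic[OF inv z] z by (simp add: k)
  qed simp
  also have "(\<integral>\<^sup>+z. indicator fund_domain z * (k z + k (- 1 / z) + k (- 1 / (z + 1))) \<partial>hyp)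
      = (\<integral>\<^sup>+z. indicator fund_domain z * (ennreal (h z + m) + ennreal (h (- 1 / z) + m) + ennreal (h (- 1 / (z + 1)) + m)) \<partial>hyp)"
  proof (intro nn_integral_cong)
    fix z
    show "indicator fund_domain z * (k z + k (- 1 / z) + k (- 1 / (z + 1)))
      = indicator fund_domain z * (ennreal (h z + m) + ennreal (h (- 1 / z) + m) + ennreal (h (- 1 / (z + 1)) + m))"
      by (cases "z \<in> fund_domain") (simp only: k im Im_fund_domain, simp)
  qed
  also have "\<dots> = ennreal (level2_integral h + pi * m)"
    by (rule int[OF h])
  finally have "ennreal (level2_integral (hecke_U h) + pi * m) = ennreal (level2_integral h + pi * m)"
    by (simp add: ennreal_mult_cancel_left)
  then show ?thesis
    using pos[OF h] pos[OF lip_on_upper_hecke_U[OF h]] by simp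
qed

section \<open>From small square integrals to small values\<close>

lemma Im_fund_domain_ge:
  assumes "w \<in> fund_domain"
  shows "Im w \<ge> 3/4"
proof (rule ccontr)
  \<comment> \<open>3/4 is a rational number below the true minimum, sqrt(3)/2.\<close>
  assume "\<not> Im w \<ge> 3/4"
  then have "(Im w)\<^sup>2 < (3/4)\<^sup>2"
    using Im_fund_domain[OF assms] by (intro power_strict_mono) auto
  moreover have "(Re w)\<^sup>2 \<le> (1/2)\<^sup>2"
    using assms by (auto simp: fund_domain_iff intro: abs_le_square_iff[THEN iffD1])
  ultimately show False
    using assms by (simp add: fund_domain_iff power2_eq_square)
qed

text \<open>Square integrals are taken over \<open>fund_domain\<close> only, so even a point on its
  boundary or at a corner needs a nearby square lying inside the domain.\<close>

lemma fund_domain_box: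
  assumes w: "w \<in> fund_domain" and s: "0 < s" "s \<le> 1/4"
  obtains l u where "cbox l u \<subseteq> fund_domain" "Re u - Re l = s" "Im u - Im l = s"
    "\<And>v. v \<in> cbox l u \<Longrightarrow> Im w \<le> Im v \<and> Im v \<le> Im w + 1/2 \<and> rho w v \<le> 4 * s"
proof -
  have y: "Im w \<ge> 3/4" using Im_fund_domain_ge[OF w] .
  have x: "\<bar>Re w\<bar> \<le> 1/2" and n: "(Re w)\<^sup>2 + (Im w)\<^sup>2 \<ge> 1" using w by (auto simp: fund_domain_iff)
  \<comment> \<open>The square goes towards the imaginary axis and up by s. The first move costs at
    most 2 s |Re w| in |v|^2 and the second gains at least 2 s Im w, which is enough because |Re w|
    <= 1/2 < Im w.\<close>
  define x0 where "x0 = (if Re w \<ge> 0 then Re w - s else Re w)"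
  define l u where "l = Complex x0 (Im w + s)" and "u = Complex (x0 + s) (Im w + 2 * s)"
  have box: "v \<in> cbox l u \<longleftrightarrow> x0 \<le> Re v \<and> Re v \<le> x0 + s \<and> Im w + s \<le> Im v \<and> Im v \<le> Im w + 2 * s" for v
    by (auto simp: cbox_def Basis_complex_def l_def u_def)
  have *: "v \<in> fund_domain \<and> rho w v \<le> 4 * s" if v: "v \<in> cbox l u" for v
  proof
    have v': "x0 \<le> Re v" "Re v \<le> x0 + s" "Im w + s \<le> Im v" "Im v \<le> Im w + 2 * s" using v box by auto
    have dx: "\<bar>Re w\<bar> - s \<le> \<bar>Re v\<bar>" "\<bar>Re v\<bar> \<le> 1/2" "\<bar>Re w - Re v\<bar> \<le> s"
      using v'(1,2) x s unfolding x0_def by (auto split: if_splits)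
    have "(Re v)\<^sup>2 + (Im v)\<^sup>2 \<ge> 1"
    proof -
      have iv: "(Im v)\<^sup>2 \<ge> (Im w + s)\<^sup>2" using v' y s by (intro power_mono) auto
      have "(Re v)\<^sup>2 \<ge> (Re w)\<^sup>2 - 2 * s * \<bar>Re w\<bar>"
      proof (cases "\<bar>Re w\<bar> \<ge> s")
        case True
        then have "(\<bar>Re w\<bar> - s)\<^sup>2 \<le> \<bar>Re v\<bar>\<^sup>2" using dx by (intro power_mono) auto
        then have "\<bar>Re w\<bar>\<^sup>2 - 2 * s * \<bar>Re w\<bar> + s\<^sup>2 \<le> (Re v)\<^sup>2"
          by (simp add: power2_diff algebra_simps)
        then show ?thesis using zero_le_power2[of s] unfolding power2_abs by linarith
      next
        case False
        then have "\<bar>Re w\<bar> * \<bar>Re w\<bar> \<le> 2 * s * \<bar>Re w\<bar>" by (intro mult_right_mono) auto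
        then have "(Re w)\<^sup>2 \<le> 2 * s * \<bar>Re w\<bar>" by (simp add: power2_eq_square)
        then show ?thesis using zero_le_power2[of "Re v"] by linarith
      qed
      moreover have "(Im w + s)\<^sup>2 \<ge> (Im w)\<^sup>2 + 2 * s * Im w" by (simp add: power2_sum)
      moreover have "2 * s * \<bar>Re w\<bar> \<le> 2 * s * Im w" using x y s by (intro mult_left_mono) auto
      ultimately show ?thesis using n iv by linarith
    qed
    then show "v \<in> fund_domain" using dx v' y s by (auto simp: fund_domain_iff)
    have "cmod (w - v) \<le> \<bar>Re (w - v)\<bar> + \<bar>Im (w - v)\<bar>" by (rule cmod_le)
    also have "\<dots> \<le> s + 2 * s" using dx v' s by (intro add_mono) auto
    finally have 1: "cmod (w - v) \<le> 3 * s" by simp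
    have "(3/4)\<^sup>2 \<le> Im w * Im v"
      unfolding power2_eq_square using y v' s by (intro mult_mono) auto
    then have "sqrt (Im w * Im v) \<ge> 3/4" by (rule real_le_rsqrt)
    then have "rho w v \<le> 3 * s / (3/4)"
      unfolding rho_def using 1 s by (intro frac_le) auto
    then show "rho w v \<le> 4 * s" by simp
  qed
  show thesis
  proof
    show "cbox l u \<subseteq> fund_domain" using * by blast
    show "Im w \<le> Im v \<and> Im v \<le> Im w + 1/2 \<and> rho w v \<le> 4 * s" if "v \<in> cbox l u" for v
      using *[OF that] that s by (auto simp: box)
  qed (auto simp: l_def u_def)
qed

lemma hyp_box_ge:
  assumes "Re u - Re l = s" "Im u - Im l = s" "s > 0" "H > 0"
    and box: "\<And>v. v \<in> cbox l u \<Longrightarrow> 0 < Im v \<and> Im v \<le> H"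
  shows "emeasure hyp (cbox l u) \<ge> ennreal (s\<^sup>2 / H\<^sup>2)"
proof -
  have "ennreal (s\<^sup>2 / H\<^sup>2) = ennreal (1 / H\<^sup>2) * emeasure lborel (cbox l u)"
  proof -
    have "emeasure lborel (cbox l u) = (\<Prod>b\<in>Basis. (u - l) \<bullet> b)"
      using assms by (intro emeasure_lborel_cbox) (auto simp: Basis_complex_def)
    also have "\<dots> = ennreal (s\<^sup>2)"
      using assms by (simp add: Basis_complex_def power2_eq_square)
    finally show ?thesis by (simp add: ennreal_mult''[symmetric])
  qed
  also have "\<dots> = (\<integral>\<^sup>+z. ennreal (1 / H\<^sup>2) * indicator (cbox l u) z \<partial>lborel)"
    by (simp add: nn_integral_cmult_indicator)
  also have "\<dots> \<le> (\<integral>\<^sup>+z. ennreal (indicator upper_half_plane z / (Im z)\<^sup>2) * indicator (cbox l u) z \<partial>lborel)"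
  proof (intro nn_integral_mono)
    fix z
    show "ennreal (1 / H\<^sup>2) * indicator (cbox l u) z
        \<le> ennreal (indicator upper_half_plane z / (Im z)\<^sup>2) * indicator (cbox l u) z"
    proof (cases "z \<in> cbox l u")
      case True
      from box[OF this] have "1 / H\<^sup>2 \<le> 1 / (Im z)\<^sup>2"
        by (intro divide_left_mono power_mono) auto
      then show ?thesis using True box[OF True] by (simp add: upper_iff ennreal_leI)
    qed simp
  qed
  also have "\<dots> = emeasure hyp (cbox l u)"
    unfolding hyp_def by (rule emeasure_density[symmetric]) auto
  finally show ?thesis .
qed

text \<open>If |q w| >= e, then |q| >= e/2 on a whole square near w, which forces a definite square
  integral. The bound H on the height is essential, as the area of such a square decays like 1/y^2
  in the cusp.\<close>

lemma lip_L2_small_imp_small: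
  assumes m: "m > 0" and e: "e > 0" and H: "H > 0"
  obtains \<eta> where "\<eta> > 0"
    "\<And>q w. lip_on_upper m q \<Longrightarrow> w \<in> fund_domain \<Longrightarrow> Im w \<le> H \<Longrightarrow>
       (\<integral>z. (q z)\<^sup>2 \<partial>nuF) < \<eta> \<Longrightarrow> \<bar>q w\<bar> < e"
proof -
  \<comment> \<open>With \<open>rho\<close> at most 4 s on the square, q varies there by at most 4 s
    m <= e/2. The square lies below height H + 1, whence the area bound in \<eta>.\<close>
  define s where "s = min (1/4) (e / (8 * m))"
  have s: "s > 0" "s \<le> 1/4" "4 * s * m \<le> e / 2" using m e by (auto simp: s_def min_def field_simps)
  define \<eta> where "\<eta> = (e / 2)\<^sup>2 * (s\<^sup>2 / (H + 1)\<^sup>2)"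
  have "\<eta> > 0" using s e H by (simp add: \<eta>_def)
  moreover have "\<bar>q w\<bar> < e"
    if q: "lip_on_upper m q" and w: "w \<in> fund_domain" "Im w \<le> H" and small: "(\<integral>z. (q z)\<^sup>2 \<partial>nuF) < \<eta>" for q w
  proof (rule ccontr)
    assume large: "\<not> \<bar>q w\<bar> < e"
    obtain l u where lu: "cbox l u \<subseteq> fund_domain" "Re u - Re l = s" "Im u - Im l = s"
      "\<And>v. v \<in> cbox l u \<Longrightarrow> Im w \<le> Im v \<and> Im v \<le> Im w + 1/2 \<and> rho w v \<le> 4 * s"
      using fund_domain_box[OF w(1) s(1,2)] by blast
    have wpos: "Im w > 0" using Im_fund_domain[OF w(1)] .
    have sets: "cbox l u \<in> sets nuF"
      unfolding sets_nuF using lu(1) by (auto simp: sets_restrict_space image_iff intro!: bexI[of _ "cbox l u"])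
    have "ennreal (s\<^sup>2 / (H + 1)\<^sup>2) \<le> emeasure hyp (cbox l u)"
    proof (rule hyp_box_ge[OF lu(2,3) s(1)])
      show "0 < Im v \<and> Im v \<le> H + 1" if "v \<in> cbox l u" for v
        using lu(4)[OF that] wpos w(2) by linarith
    qed (use H in simp)
    also have "\<dots> = emeasure nuF (cbox l u)"
      unfolding nuF_def using lu(1) by (intro emeasure_restrict_space[symmetric]) auto
    also have "\<dots> = ennreal (measure nuF (cbox l u))"
      by (rule nuF.emeasure_eq_measure)
    finally have meas: "s\<^sup>2 / (H + 1)\<^sup>2 \<le> measure nuF (cbox l u)" by simp
    have q2: "lip_on_upper (2 * m\<^sup>2) (\<lambda>z. (q z)\<^sup>2)" by (rule lip_on_upper_square[OF q])
    have "\<eta> \<le> (e / 2)\<^sup>2 * measure nuF (cbox l u)"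
      unfolding \<eta>_def using meas by (intro mult_left_mono) auto
    also have "\<dots> = (\<integral>z. (e / 2)\<^sup>2 * indicator (cbox l u) z \<partial>nuF)"
      using sets lu(1) by (simp add: Int_absorb2)
    also have "\<dots> \<le> (\<integral>z. (q z)\<^sup>2 \<partial>nuF)"
    proof (rule integral_mono)
      show "integrable nuF (\<lambda>z. (e / 2)\<^sup>2 * indicator (cbox l u) z)"
        using sets by (intro integrable_mult_right integrable_real_indicator) (auto simp: nuF.emeasure_eq_measure)
      show "integrable nuF (\<lambda>z. (q z)\<^sup>2)" by (rule lip_on_upper_integrable_nuF[OF q2])
      fix z assume z: "z \<in> space nuF"
      show "(e / 2)\<^sup>2 * indicator (cbox l u) z \<le> (q z)\<^sup>2"
      proof (cases "z \<in> cbox l u")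
        case True
        have "\<bar>q w - q z\<bar> \<le> m * rho w z"
          using z wpos by (intro lip_on_upper_rho[OF q]) (auto intro: Im_fund_domain)
        also have "\<dots> \<le> m * (4 * s)" using lu(4)[OF True] m by (intro mult_left_mono) auto
        also have "\<dots> \<le> e / 2" using s(3) by (simp add: mult_ac)
        finally have "\<bar>q z\<bar> \<ge> e / 2" using large by linarith
        then have "(e / 2)\<^sup>2 \<le> \<bar>q z\<bar>\<^sup>2" using e by (intro power_mono) auto
        then show ?thesis using True by simp
      qed simp
    qed
    finally show False using small by simp
  qed
  ultimately show thesis using that by blast
qed

lemma level2_square_integral_ge:
  assumes "lip_on_upper m h"
  shows "(\<integral>z. (h z)\<^sup>2 \<partial>nuF) \<le> level2_integral (\<lambda>z. (h z)\<^sup>2)"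
    "(\<integral>z. (h (- 1 / z))\<^sup>2 \<partial>nuF) \<le> level2_integral (\<lambda>z. (h z)\<^sup>2)"
    "(\<integral>z. (h (- 1 / (z + 1)))\<^sup>2 \<partial>nuF) \<le> level2_integral (\<lambda>z. (h z)\<^sup>2)"
proof -
  have "(\<integral>z. (k z)\<^sup>2 \<partial>nuF) \<ge> 0" for k :: "complex \<Rightarrow> real"
    by (rule Bochner_Integration.integral_nonneg) simp
  from this[of h] this[of "\<lambda>z. h (- 1 / z)"] this[of "\<lambda>z. h (- 1 / (z + 1))"]
  show "(\<integral>z. (h z)\<^sup>2 \<partial>nuF) \<le> level2_integral (\<lambda>z. (h z)\<^sup>2)"
    "(\<integral>z. (h (- 1 / z))\<^sup>2 \<partial>nuF) \<le> level2_integral (\<lambda>z. (h z)\<^sup>2)"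
    "(\<integral>z. (h (- 1 / (z + 1)))\<^sup>2 \<partial>nuF) \<le> level2_integral (\<lambda>z. (h z)\<^sup>2)"
    unfolding level2_integral_eq[OF lip_on_upper_square[OF assms]] by linarith+
qed

text \<open>Non-escape is measured at level one: a reduced point of bounded height is away from the
  cusp for all three cosets at once, hence away from both cusps of Gamma_0(2).\<close>

definition reduces_below :: "real \<Rightarrow> complex \<Rightarrow> bool" where
  "reduces_below H z \<longleftrightarrow> (\<exists>a b c d. a * d - b * c = 1 \<and> moebius_int a b c d z \<in> fund_domain \<and>
     Im (moebius_int a b c d z) \<le> H)"

text \<open>The value at z is one of h, h o S, h o ST at the reduced point. Each of the three has
  the same Lipschitz bound and a square integral dominated by the level two one.\<close>

lemma level2_L2_small_imp_small:
  assumes m: "m > 0" and e: "e > 0" and H: "H > 0"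
  obtains \<eta> where "\<eta> > 0"
    "\<And>h z. h \<in> level2_lip m \<Longrightarrow> Im z > 0 \<Longrightarrow> reduces_below H z \<Longrightarrow>
       level2_integral (\<lambda>z. (h z)\<^sup>2) < \<eta> \<Longrightarrow> \<bar>h z\<bar> < e"
proof -
  obtain \<eta> where \<eta>: "\<eta> > 0"
    "\<And>q w. lip_on_upper m q \<Longrightarrow> w \<in> fund_domain \<Longrightarrow> Im w \<le> H \<Longrightarrow>
       (\<integral>z. (q z)\<^sup>2 \<partial>nuF) < \<eta> \<Longrightarrow> \<bar>q w\<bar> < e"
    using lip_L2_small_imp_small[OF assms] by blast
  have "\<bar>h z\<bar> < e"
    if h: "h \<in> level2_lip m" and z: "Im z > 0" and red: "reduces_below H z"
      and small: "level2_integral (\<lambda>z. (h z)\<^sup>2) < \<eta>" for h z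
  proof -
    have lip: "lip_on_upper m h" and inv: "gamma0_2_invariant h" using h by (auto simp: level2_lip_def)
    obtain a b c d where det: "a * d - b * c = 1" and w: "moebius_int a b c d z \<in> fund_domain"
      "Im (moebius_int a b c d z) \<le> H" using red by (auto simp: reduces_below_def)
    let ?w = "moebius_int a b c d z"
    have "\<bar>h ?w\<bar> < e" "\<bar>h (- 1 / ?w)\<bar> < e" "\<bar>h (- 1 / (?w + 1))\<bar> < e"
      using \<eta>(2)[OF lip w] \<eta>(2)[OF lip_on_upper_S[OF lip] w] \<eta>(2)[OF lip_on_upper_ST[OF lip] w]
        level2_square_integral_ge[OF lip] small by auto
    then show ?thesis using gamma0_2_cosets[OF inv z det] by metis
  qed
  with \<eta>(1) show thesis using that by blast
qed

text \<open>From 0 <= h <= m follows h^2 <= m h, so the square integral vanishes too, and the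
  preceding smallness criterion is applied with e = |h z| itself.\<close>

lemma level2_integral_zero_imp_zero:
  assumes h: "h \<in> level2_lip m" and z: "Im z > 0" and nn: "\<And>w. Im w > 0 \<Longrightarrow> h w \<ge> 0"
    and zero: "level2_integral h = 0"
  shows "h z = 0"
proof (rule ccontr)
  assume nz: "h z \<noteq> 0"
  have lip: "lip_on_upper m h" using h by (auto simp: level2_lip_def)
  obtain a b c d where "a * d - b * c = (1::int)" "moebius_int a b c d z \<in> fund_domain"
    using reduction_to_fund_domain[OF z] .
  then have red: "reduces_below (max 1 (Im (moebius_int a b c d z))) z"
    unfolding reduces_below_def by (intro exI[of _ a] exI[of _ b] exI[of _ c] exI[of _ d]) auto
  \<comment> \<open>The criterion asks for a positive bound, while m may be 0.\<close>
  have h': "h \<in> level2_lip (max 1 m)"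
    using h lip_on_upper_mono[OF lip, of "max 1 m"] by (auto simp: level2_lip_def)
  have "level2_integral (\<lambda>z. (h z)\<^sup>2) \<le> 0"
  proof -
    have "level2_integral (\<lambda>z. (h z)\<^sup>2) \<le> (\<integral>z. m * coset_sum h z \<partial>nuF)"
      unfolding level2_integral_def
    proof (rule integral_mono)
      show "integrable nuF (coset_sum (\<lambda>z. (h z)\<^sup>2))" by (rule coset_sum_integrable[OF lip_on_upper_square[OF lip]])
      show "integrable nuF (\<lambda>z. m * coset_sum h z)" using coset_sum_integrable[OF lip] by simp
      fix z assume "z \<in> space nuF"
      then have z: "Im z > 0" by (auto intro: Im_fund_domain)
      have sq: "(h w)\<^sup>2 \<le> m * h w" if "Im w > 0" for w
        using mult_right_mono[of "h w" m "h w"] nn[OF that] lip_on_upper_bound[OF lip that]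
        by (simp add: power2_eq_square)
      have im: "Im (- 1 / z) > 0" "Im (- 1 / (z + 1)) > 0"
        using z Im_inversion_pos[of z] Im_inversion_pos[of "z + 1"] by simp_all
      show "coset_sum (\<lambda>z. (h z)\<^sup>2) z \<le> m * coset_sum h z"
        unfolding coset_sum_def using sq[OF z] sq[OF im(1)] sq[OF im(2)] by (simp add: distrib_left)
    qed
    then show ?thesis using zero by (simp add: level2_integral_def)
  qed
  moreover obtain \<eta> where "\<eta> > 0"
    "\<And>k v. k \<in> level2_lip (max 1 m) \<Longrightarrow> Im v > 0 \<Longrightarrow> reduces_below (max 1 (Im (moebius_int a b c d z))) v \<Longrightarrow>
       level2_integral (\<lambda>z. (k z)\<^sup>2) < \<eta> \<Longrightarrow> \<bar>k v\<bar> < \<bar>h z\<bar>"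
  proof -
    have "max 1 m > 0" "\<bar>h z\<bar> > 0" "max 1 (Im (moebius_int a b c d z)) > 0" using nz by auto
    from level2_L2_small_imp_small[OF this] show thesis using that by blast
  qed
  ultimately show False using h' z red by fastforce
qed

section \<open>Energy decay\<close>

lemma gamma0_2_invariant_square: "gamma0_2_invariant h \<Longrightarrow> gamma0_2_invariant (\<lambda>z. (h z)\<^sup>2)"
  and gamma0_2_invariant_diff: "gamma0_2_invariant h \<Longrightarrow> gamma0_2_invariant h' \<Longrightarrow> gamma0_2_invariant (\<lambda>z. h z - h' z)"
  by (auto simp: gamma0_2_invariant_def)

lemma level2_lip_square: "h \<in> level2_lip m \<Longrightarrow> (\<lambda>z. (h z)\<^sup>2) \<in> level2_lip (2 * m\<^sup>2)"
  by (auto simp: level2_lip_def lip_on_upper_square gamma0_2_invariant_square)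

lemma level2_lip_diff: "h \<in> level2_lip m \<Longrightarrow> h' \<in> level2_lip m' \<Longrightarrow> (\<lambda>z. h z - h' z) \<in> level2_lip (m + m')"
  by (auto simp: level2_lip_def lip_on_upper_diff gamma0_2_invariant_diff)

definition energy :: "(complex \<Rightarrow> real) \<Rightarrow> real" where
  "energy h = level2_integral (\<lambda>z. (h z)\<^sup>2)"

text \<open>The variance of h over the two branches, that is, the pointwise loss in Jensen's
  inequality for the square.\<close>

definition hecke_var :: "(complex \<Rightarrow> real) \<Rightarrow> complex \<Rightarrow> real" where
  "hecke_var h z = ((h (z / 2) - h ((z + 1) / 2)) / 2)\<^sup>2"

lemma hecke_var_eq: "hecke_var h z = hecke_U (\<lambda>z. (h z)\<^sup>2) z - (hecke_U h z)\<^sup>2"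
  by (simp add: hecke_var_def hecke_U_def power2_eq_square field_simps)

lemma level2_lip_hecke_var:
  assumes "h \<in> level2_lip m"
  shows "hecke_var h \<in> level2_lip (2 * m\<^sup>2 + 2 * m\<^sup>2)"
proof -
  have "(\<lambda>z. hecke_U (\<lambda>z. (h z)\<^sup>2) z - (hecke_U h z)\<^sup>2) \<in> level2_lip (2 * m\<^sup>2 + 2 * m\<^sup>2)"
    using level2_lip_hecke_U[OF level2_lip_square[OF assms], of 1] level2_lip_square[OF level2_lip_hecke_U[OF assms, of 1]]
    by (intro level2_lip_diff) auto
  then show ?thesis by (simp add: hecke_var_eq[abs_def])
qed

text \<open>Since U preserves the integral of h^2, the energy lost in one step is exactly the
  integral of the variance.\<close>

lemma energy_hecke_U:
  assumes "h \<in> level2_lip m"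
  shows "energy (hecke_U h) = energy h - level2_integral (hecke_var h)"
proof -
  have sq: "(\<lambda>z. (h z)\<^sup>2) \<in> level2_lip (2 * m\<^sup>2)" by (rule level2_lip_square[OF assms])
  have "energy (hecke_U h) = level2_integral (\<lambda>z. hecke_U (\<lambda>z. (h z)\<^sup>2) z - hecke_var h z)"
    by (simp add: energy_def hecke_var_eq)
  also have "\<dots> = level2_integral (hecke_U (\<lambda>z. (h z)\<^sup>2)) - level2_integral (hecke_var h)"
    using level2_lip_hecke_U[OF sq, of 1] level2_lip_hecke_var[OF assms]
    by (intro level2_integral_diff) (auto simp: level2_lip_def)
  also have "level2_integral (hecke_U (\<lambda>z. (h z)\<^sup>2)) = energy h"
    unfolding energy_def using sq by (intro level2_integral_hecke_U) (auto simp: level2_lip_def)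
  finally show ?thesis .
qed

lemma hecke_var_nonneg: "hecke_var h z \<ge> 0"
  by (simp add: hecke_var_def)

lemma energy_hecke_U_le:
  assumes "h \<in> level2_lip m"
  shows "energy (hecke_U h) \<le> energy h"
  using energy_hecke_U[OF assms] level2_integral_nonneg[of "hecke_var h"] hecke_var_nonneg by simp

lemma energy_antimono:
  assumes "h \<in> level2_lip m" "j \<le> k"
  shows "energy ((hecke_U ^^ k) h) \<le> energy ((hecke_U ^^ j) h)"
proof -
  have "decseq (\<lambda>k. energy ((hecke_U ^^ k) h))"
    using energy_hecke_U_le[OF level2_lip_hecke_U[OF assms(1)]] by (intro decseq_SucI) simp
  then show ?thesis using assms(2) by (rule decseqD)
qed

lemma level2_integral_hecke_U_iterate:
  assumes "h \<in> level2_lip m"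
  shows "level2_integral ((hecke_U ^^ k) h) = level2_integral h"
proof (induction k)
  case (Suc k)
  then show ?case
    using level2_integral_hecke_U[of m "(hecke_U ^^ k) h"] level2_lip_hecke_U[OF assms, of k]
    by (auto simp: level2_lip_def)
qed simp

lemma energy_nonneg: "energy h \<ge> 0"
  unfolding energy_def by (rule level2_integral_nonneg) simp

lemma energy_le:
  assumes "lip_on_upper m h"
  shows "energy h \<le> pi * m\<^sup>2"
proof -
  have "level2_integral (\<lambda>z. m\<^sup>2 - (h z)\<^sup>2) \<ge> 0"
  proof (rule level2_integral_nonneg)
    fix w assume w: "Im w > 0"
    show "m\<^sup>2 - (h w)\<^sup>2 \<ge> 0"
      using power_mono[OF lip_on_upper_bound[OF assms w], of 2] by simp
  qed
  then show ?thesis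
    unfolding level2_integral_diff[OF lip_on_upper_const lip_on_upper_square[OF assms]] level2_integral_const
    by (simp add: energy_def)
qed

lemma rigid_imp_const:
  assumes g: "g \<in> level2_lip m" and rigid: "\<And>k. energy ((hecke_U ^^ k) g) = energy g"
  obtains c where "\<And>z. Im z > 0 \<Longrightarrow> g z = c"
proof -
  have lip: "lip_on_upper m g" and inv: "gamma0_2_invariant g" using g by (auto simp: level2_lip_def)
  have half: "(hecke_U ^^ k) g (z / 2) = (hecke_U ^^ k) g ((z + 1) / 2)" if z: "Im z > 0" for k z
  proof -
    have gk: "(hecke_U ^^ k) g \<in> level2_lip m" by (rule level2_lip_hecke_U[OF g])
    have "level2_integral (hecke_var ((hecke_U ^^ k) g)) = 0"
      using energy_hecke_U[OF gk] rigid[of k] rigid[of "Suc k"] by simp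
    then have "hecke_var ((hecke_U ^^ k) g) z = 0"
      using level2_integral_zero_imp_zero[OF level2_lip_hecke_var[OF gk] z] hecke_var_nonneg by blast
    then show ?thesis by (simp add: hecke_var_def)
  qed
  \<comment> \<open>Without variance no averaging is left, and U^k follows a single branch.
    Comparing the other branch then gives the dyadic translations.\<close>
  have iter: "(hecke_U ^^ k) g z = g (z / 2 ^ k)" if "Im z > 0" for k z
    using that
  proof (induction k arbitrary: z)
    case (Suc k)
    then have "(hecke_U ^^ Suc k) g z = (hecke_U ^^ k) g (z / 2)"
      using half[of z k] by (simp add: hecke_U_def)
    also have "\<dots> = g (z / 2 / 2 ^ k)" using Suc by (intro Suc.IH) simp
    finally show ?case by simp
  qed simp
  have dyadic: "g (z + 1 / 2 ^ Suc k) = g z" if z: "Im z > 0" for k z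
  proof -
    define v where "v = 2 ^ Suc k * z"
    have v: "Im v > 0" "Im (v / 2) > 0" "Im ((v + 1) / 2) > 0"
    proof -
      have "v = of_real (2 ^ Suc k) * z" by (simp add: v_def)
      then have "Im v = 2 ^ Suc k * Im z" by simp
      then show "Im v > 0" using z by simp
      then show "Im (v / 2) > 0" "Im ((v + 1) / 2) > 0" by simp_all
    qed
    have "g (v / 2 / 2 ^ k) = g ((v + 1) / 2 / 2 ^ k)"
      using half[OF v(1), of k] iter[OF v(2), of k] iter[OF v(3), of k] by simp
    then show ?thesis by (simp add: v_def add_divide_distrib)
  qed
  have dyadic': "g (z + of_nat n / 2 ^ Suc k) = g z" if z: "Im z > 0" for n k z
  proof (induction n)
    case (Suc n)
    have "Im (of_nat n / 2 ^ Suc k :: complex) = 0"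
      by (metis Im_complex_of_real of_real_divide of_real_numeral of_real_of_nat_eq of_real_power)
    then have "g (z + of_nat n / 2 ^ Suc k + 1 / 2 ^ Suc k) = g (z + of_nat n / 2 ^ Suc k)"
      using z by (intro dyadic) simp
    then show ?case using Suc by (simp add: add_divide_distrib add_ac)
  qed simp
  have trans_pos: "g (z + of_real t) = g z" if z: "Im z > 0" and t: "t \<ge> 0" for z t
  proof -
    define n where "n k = nat \<lfloor>t * 2 ^ Suc k\<rfloor>" for k :: nat
    have n: "\<bar>t - real (n k) / 2 ^ Suc k\<bar> \<le> 1 / 2 ^ Suc k" for k
    proof -
      have "real (n k) \<le> t * 2 ^ Suc k" "t * 2 ^ Suc k \<le> real (n k) + 1"
        using t by (auto simp: n_def of_nat_nat intro: floor_le_iff[THEN iffD1] real_of_int_floor_add_one_ge)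
      then have "real (n k) / 2 ^ Suc k \<le> t" "t \<le> (real (n k) + 1) / 2 ^ Suc k"
        by (simp_all only: pos_divide_le_eq pos_le_divide_eq zero_less_power zero_less_numeral)
      then show ?thesis by (simp add: add_divide_distrib abs_le_iff)
    qed
    \<comment> \<open>Real translations follow from dyadic ones by Lipschitz continuity, with t
      rounded down to a multiple of 2^-(k+1).\<close>
    have "\<bar>g (z + of_real t) - g z\<bar> \<le> m / Im z * (1 / 2) ^ Suc k" for k
    proof -
      have eq: "z + of_nat (n k) / 2 ^ Suc k = z + of_real (real (n k) / 2 ^ Suc k)"
        by simp
      have "\<bar>g (z + of_real t) - g z\<bar> = \<bar>g (z + of_real t) - g (z + of_real (real (n k) / 2 ^ Suc k))\<bar>"
        using dyadic'[OF z, of "n k" k] eq by simp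
      also have "\<dots> \<le> m * rho (z + of_real t) (z + of_real (real (n k) / 2 ^ Suc k))"
        using z by (intro lip_on_upper_rho[OF lip]) simp_all
      also have "rho (z + of_real t) (z + of_real (real (n k) / 2 ^ Suc k)) = \<bar>t - real (n k) / 2 ^ Suc k\<bar> / Im z"
      proof -
        have "z + of_real t - (z + of_real (real (n k) / 2 ^ Suc k)) = of_real (t - real (n k) / 2 ^ Suc k)"
          by (simp only: of_real_diff) simp
        then have "cmod (z + of_real t - (z + of_real (real (n k) / 2 ^ Suc k))) = \<bar>t - real (n k) / 2 ^ Suc k\<bar>"
          by (simp only: norm_of_real)
        then show ?thesis using z unfolding rho_def by simp
      qed
      also have "m * (\<bar>t - real (n k) / 2 ^ Suc k\<bar> / Im z) \<le> m * ((1 / 2 ^ Suc k) / Im z)"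
        using n[of k] z lip_on_upper_nonneg[OF lip] by (intro mult_left_mono divide_right_mono) auto
      finally show ?thesis by (simp add: power_one_over mult_ac)
    qed
    moreover have "(\<lambda>k. m / Im z * (1 / 2) ^ Suc k) \<longlonglongrightarrow> m / Im z * 0"
      by (intro tendsto_mult tendsto_const LIMSEQ_Suc LIMSEQ_power_zero) simp
    ultimately have "\<bar>g (z + of_real t) - g z\<bar> \<le> m / Im z * 0"
      by (intro LIMSEQ_le_const) auto
    then show ?thesis by simp
  qed
  have trans: "g (z + of_real t) = g z" if z: "Im z > 0" for z t
  proof (cases "t \<ge> 0")
    case False
    then show ?thesis using trans_pos[of "z + of_real t" "-t"] z by simp
  qed (use trans_pos z in simp)
  have vert: "g z = g (Complex 0 (Im z))" if "Im z > 0" for z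
  proof -
    have "Complex 0 (Im z) + of_real (Re z) = z" by (simp add: complex_eq_iff)
    then show ?thesis using trans[of "Complex 0 (Im z)" "Re z"] that by simp
  qed
  \<comment> \<open>The map z/(2z+1) sends the line Im z = y to a horocycle tangent at 1/2, whose
    points attain every height in (0, 1/(4y)]. As g depends on the height alone, it takes one value
    on all these heights; x is chosen so that the image has height s.\<close>
  have key: "g (Complex 0 s) = g (Complex 0 y)" if y: "y > 0" and s: "s > 0" "4 * s * y \<le> 1" for s y
  proof -
    have sq: "y / s - 4 * y\<^sup>2 \<ge> 0"
      using y s by (simp add: field_simps power2_eq_square)
    define x where "x = (sqrt (y / s - 4 * y\<^sup>2) - 1) / 2"
    have "2 * x + 1 = sqrt (y / s - 4 * y\<^sup>2)" unfolding x_def by (simp add: field_simps)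
    then have x: "(2 * x + 1)\<^sup>2 + 4 * y\<^sup>2 = y / s" using sq by (simp only: real_sqrt_pow2)
    have im: "Im (Complex x y / (2 * Complex x y + 1)) = s"
    proof -
      have "Im (Complex x y / (2 * Complex x y + 1)) = y / ((2 * x + 1)\<^sup>2 + (2 * y)\<^sup>2)"
        by (simp add: Im_divide algebra_simps)
      also have "(2 * x + 1)\<^sup>2 + (2 * y)\<^sup>2 = y / s" using x by (simp add: power_mult_distrib)
      finally show ?thesis using y s by simp
    qed
    have "g (Complex 0 s) = g (Complex x y / (2 * Complex x y + 1))"
      using vert[of "Complex x y / (2 * Complex x y + 1)"] im s by simp
    also have "\<dots> = g (Complex x y)"
      using gamma0_2_invariant_parabolic[OF inv] y by simp
    also have "\<dots> = g (Complex 0 y)" using vert[of "Complex x y"] y by simp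
    finally show ?thesis .
  qed
  show thesis
  proof
    fix z assume z: "Im z > 0"
    \<comment> \<open>A single y so small that both Im z and the reference height 1 are at most
      1/(4y).\<close>
    define y where "y = min (1/4) (1 / (4 * Im z))"
    have y: "y > 0" "4 * Im z * y \<le> 1" "4 * 1 * y \<le> 1"
      using z by (auto simp: y_def min_def field_simps)
    have "g z = g (Complex 0 (Im z))" by (rule vert[OF z])
    also have "\<dots> = g (Complex 0 y)" by (rule key[OF y(1) z y(2)])
    also have "\<dots> = g (Complex 0 1)" using key[OF y(1) _ y(3)] by simp
    finally show "g z = g (Complex 0 1)" .
  qed
qed

section \<open>Compactness and uniform decay of the energy\<close>

lemma level2_integral_tendsto:
  assumes f: "\<And>n. lip_on_upper m (f n)" and g: "lip_on_upper m g"
    and lim: "\<And>z. Im z > 0 \<Longrightarrow> (\<lambda>n. f n z) \<longlonglongrightarrow> g z"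
  shows "(\<lambda>n. level2_integral (f n)) \<longlonglongrightarrow> level2_integral g"
  unfolding level2_integral_def
proof (rule integral_dominated_convergence[where w = "\<lambda>_. 3 * m"])
  have im: "Im (- 1 / z) > 0" "Im (- 1 / (z + 1)) > 0" if "Im z > 0" for z
    using that Im_inversion_pos[of z] Im_inversion_pos[of "z + 1"] by simp_all
  show "coset_sum g \<in> borel_measurable nuF" "\<And>n. coset_sum (f n) \<in> borel_measurable nuF"
    using coset_sum_integrable[OF f] coset_sum_integrable[OF g] by auto
  show "AE z in nuF. (\<lambda>n. coset_sum (f n) z) \<longlonglongrightarrow> coset_sum g z"
  proof (rule AE_I2)
    fix z assume "z \<in> space nuF"
    then have z: "Im z > 0" by (auto intro: Im_fund_domain)
    show "(\<lambda>n. coset_sum (f n) z) \<longlonglongrightarrow> coset_sum g z"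
      unfolding coset_sum_def by (intro tendsto_add lim z im)
  qed
  show "AE z in nuF. norm (coset_sum (f n) z) \<le> 3 * m" for n
  proof (rule AE_I2)
    fix z assume "z \<in> space nuF"
    then have z: "Im z > 0" by (auto intro: Im_fund_domain)
    show "norm (coset_sum (f n) z) \<le> 3 * m"
      using lip_on_upper_bound[OF f[of n] z] lip_on_upper_bound[OF f[of n] im(1)[OF z]]
        lip_on_upper_bound[OF f[of n] im(2)[OF z]] unfolding coset_sum_def real_norm_def by linarith
  qed
qed simp

lemma hecke_U_iterate_tendsto:
  assumes "\<And>z. Im z > 0 \<Longrightarrow> (\<lambda>n. f n z) \<longlonglongrightarrow> g z" "Im z > 0"
  shows "(\<lambda>n. (hecke_U ^^ k) (f n) z) \<longlonglongrightarrow> (hecke_U ^^ k) g z"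
  using assms(2)
proof (induction k arbitrary: z)
  case (Suc k)
  then have "Im (z / 2) > 0" "Im ((z + 1) / 2) > 0" by auto
  moreover have "(hecke_U ^^ Suc k) h z = ((hecke_U ^^ k) h (z / 2) + (hecke_U ^^ k) h ((z + 1) / 2)) / 2" for h
    by (simp add: hecke_U_def)
  ultimately show ?case by (simp only:) (intro tendsto_intros Suc.IH; simp)
qed (use assms(1) in simp)

lemma energy_tendsto:
  assumes f: "\<And>n. f n \<in> level2_lip m" and g: "g \<in> level2_lip m"
    and lim: "\<And>z. Im z > 0 \<Longrightarrow> (\<lambda>n. f n z) \<longlonglongrightarrow> g z"
  shows "(\<lambda>n. energy ((hecke_U ^^ k) (f n))) \<longlonglongrightarrow> energy ((hecke_U ^^ k) g)"
  unfolding energy_def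
proof (rule level2_integral_tendsto)
  show "lip_on_upper (2 * m\<^sup>2) (\<lambda>z. ((hecke_U ^^ k) (f n) z)\<^sup>2)" for n
    using level2_lip_hecke_U[OF f] by (auto intro!: lip_on_upper_square simp: level2_lip_def)
  show "lip_on_upper (2 * m\<^sup>2) (\<lambda>z. ((hecke_U ^^ k) g z)\<^sup>2)"
    using level2_lip_hecke_U[OF g] by (auto intro!: lip_on_upper_square simp: level2_lip_def)
  show "(\<lambda>n. ((hecke_U ^^ k) (f n) z)\<^sup>2) \<longlonglongrightarrow> ((hecke_U ^^ k) g z)\<^sup>2" if "Im z > 0" for z
    by (intro tendsto_intros hecke_U_iterate_tendsto lim that)
qed

text \<open>An Arzela-Ascoli argument: a diagonal subsequence converges on a countable dense set,
  and the common Lipschitz bound carries convergence to every point. Pointwise limits are enough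
  because energies pass to the limit by dominated convergence.\<close>

lemma level2_lip_compact:
  assumes f: "\<And>n::nat. f n \<in> level2_lip m"
  obtains r g where "strict_mono (r :: nat \<Rightarrow> nat)" "g \<in> level2_lip m"
    "\<And>z. Im z > 0 \<Longrightarrow> (\<lambda>n. f (r n) z) \<longlonglongrightarrow> g z"
proof -
  have lip: "lip_on_upper m (f n)" and inv: "gamma0_2_invariant (f n)" for n
    using f by (auto simp: level2_lip_def)
  obtain D :: "complex set" where D: "countable D" "\<And>X. open X \<Longrightarrow> X \<noteq> {} \<Longrightarrow> \<exists>d\<in>D. d \<in> X"
    using countable_dense_setE by blast
  define S where "S = D \<inter> upper_half_plane"
  have "countable S" using D(1) by (auto simp: S_def)
  moreover have "norm (f n z) \<le> m" if "z \<in> S" for n z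
    using that lip_on_upper_bound[OF lip] by (auto simp: S_def upper_iff)
  ultimately obtain r where r: "strict_mono (r :: nat \<Rightarrow> nat)"
    and conv: "\<And>z. z \<in> S \<Longrightarrow> \<exists>l. (\<lambda>n. f (r n) z) \<longlonglongrightarrow> l"
    using function_convergent_subsequence[of S f m] by blast
  have cauchy: "Cauchy (\<lambda>n. f (r n) z)" if z: "Im z > 0" for z
  proof (rule metric_CauchyI)
    fix e :: real assume e: "e > 0"
    have "((\<lambda>w. m * rho w z) \<longlongrightarrow> m * 0) (at z)"
      by (intro tendsto_mult tendsto_const tendsto_rho_0 z)
    then have "\<forall>\<^sub>F w in at z. m * rho w z < e / 3"
      using e by (intro order_tendstoD(2)) auto
    then obtain d where d: "d > 0" "\<And>w. w \<noteq> z \<Longrightarrow> dist w z < d \<Longrightarrow> m * rho w z < e / 3"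
      by (auto simp: eventually_at)
    have "open (ball z d \<inter> upper_half_plane)"
      unfolding upper_half_plane_def by (intro open_Int open_ball open_halfspace_Im_gt)
    moreover have "z \<in> ball z d \<inter> upper_half_plane" using d z by (simp add: upper_iff)
    ultimately obtain w where w: "w \<in> D" "w \<in> ball z d \<inter> upper_half_plane" using D(2) by blast
    then have wS: "w \<in> S" and wpos: "Im w > 0" by (auto simp: S_def upper_iff)
    have small: "m * rho w z < e / 3"
      using d w e by (cases "w = z") (auto simp: rho_def dist_commute)
    have near: "\<bar>f n w - f n z\<bar> < e / 3" for n
      using lip_on_upper_rho[OF lip wpos z, of n] small by linarith
    obtain N where N: "\<And>i j. i \<ge> N \<Longrightarrow> j \<ge> N \<Longrightarrow> \<bar>f (r i) w - f (r j) w\<bar> < e / 3"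
    proof -
      have "Cauchy (\<lambda>n. f (r n) w)" using conv[OF wS] LIMSEQ_imp_Cauchy by blast
      from metric_CauchyD[OF this, of "e / 3"] show thesis
        using e that by (auto simp: dist_real_def)
    qed
    show "\<exists>N. \<forall>i\<ge>N. \<forall>j\<ge>N. dist (f (r i) z) (f (r j) z) < e"
    proof (intro exI allI impI)
      fix i j assume "N \<le> i" "N \<le> j"
      then show "dist (f (r i) z) (f (r j) z) < e"
        using N[of i j] near[of "r i"] near[of "r j"] unfolding dist_real_def by linarith
    qed
  qed
  define g where "g z = lim (\<lambda>n. f (r n) z)" for z
  have lim: "(\<lambda>n. f (r n) z) \<longlonglongrightarrow> g z" if "Im z > 0" for z
    using cauchy[OF that] unfolding g_def by (simp add: Cauchy_convergent_iff convergent_LIMSEQ_iff)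
  have "lip_on_upper m g"
    unfolding lip_on_upper_def
  proof (intro conjI allI impI)
    fix z :: complex assume z: "Im z > 0"
    show "\<bar>g z\<bar> \<le> m"
      by (rule LIMSEQ_le_const2[OF tendsto_rabs[OF lim[OF z]]]) (use lip_on_upper_bound[OF lip z] in auto)
    fix w :: complex assume w: "Im w > 0"
    show "\<bar>g z - g w\<bar> \<le> m * rho z w"
      by (rule LIMSEQ_le_const2[OF tendsto_rabs[OF tendsto_diff[OF lim[OF z] lim[OF w]]]])
        (use lip_on_upper_rho[OF lip z w] in auto)
  qed
  moreover have "gamma0_2_invariant g"
    unfolding gamma0_2_invariant_def
  proof (intro allI impI)
    fix a b c d :: int and z :: complex
    assume *: "a * d - b * c = 1" "even c" "Im z > 0"
    have "(\<lambda>n. f (r n) (moebius_int a b c d z)) = (\<lambda>n. f (r n) z)"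
      using gamma0_2_invariantD[OF inv *] by auto
    then show "g (moebius_int a b c d z) = g z" unfolding g_def by simp
  qed
  ultimately have "g \<in> level2_lip m" by (simp add: level2_lip_def)
  with r lim show thesis using that by blast
qed

text \<open>If uniform decay failed, the offending function would change with N, so no single orbit
  could be followed to infinity. Instead a long stretch with almost no energy loss is found in each
  orbit; a limit of the starting points of these stretches loses no energy at all, hence is
  constant, with mean 0 and energy at least \<eta>.\<close>

lemma energy_uniform_decay:
  assumes "\<eta> > 0"
  obtains N where "\<And>h k. h \<in> level2_lip m \<Longrightarrow> level2_integral h = 0 \<Longrightarrow> k \<ge> N \<Longrightarrow> energy ((hecke_U ^^ k) h) < \<eta>"
proof (rule ccontr)
  assume "\<not> thesis"
  with that have "\<forall>N. \<exists>h k. h \<in> level2_lip m \<and> level2_integral h = 0 \<and> k \<ge> N \<and> energy ((hecke_U ^^ k) h) \<ge> \<eta>"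
    by (meson not_less)
  then obtain F K where F: "\<And>N. F N \<in> level2_lip m" "\<And>N. level2_integral (F N) = 0"
    and K: "\<And>N. K N \<ge> N" "\<And>N. energy ((hecke_U ^^ K N) (F N)) \<ge> \<eta>"
    by metis
  define C where "C = pi * m\<^sup>2"
  \<comment> \<open>Pigeonhole: the first (r+1)^2 steps form r+1 blocks of length r+1, and the total
    loss is at most C, so some block loses at most C / (r+1).\<close>
  have "\<exists>i<Suc r. energy ((hecke_U ^^ (i * Suc r)) (F (Suc r * Suc r))) -
      energy ((hecke_U ^^ (Suc i * Suc r)) (F (Suc r * Suc r))) \<le> C / Suc r" for r
  proof (rule ccontr)
    let ?E = "\<lambda>i. energy ((hecke_U ^^ (i * Suc r)) (F (Suc r * Suc r)))"
    assume "\<not> ?thesis"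
    then have gt: "?E i - ?E (Suc i) > C / Suc r" if "i < Suc r" for i
      using that by (auto simp: not_le)
    have "C = (\<Sum>i<Suc r. C / Suc r)" by simp
    also have "\<dots> < (\<Sum>i<Suc r. ?E i - ?E (Suc i))"
      by (rule sum_strict_mono) (use gt in auto)
    also have "\<dots> = ?E 0 - ?E (Suc r)" by (rule sum_lessThan_telescope')
    also have "\<dots> \<le> energy (F (Suc r * Suc r))" using energy_nonneg by simp
    also have "\<dots> \<le> C" unfolding C_def using F(1) by (intro energy_le) (auto simp: level2_lip_def)
    finally show False by simp
  qed
  then obtain I where I: "\<And>r. I r < Suc r" "\<And>r. energy ((hecke_U ^^ (I r * Suc r)) (F (Suc r * Suc r))) -
      energy ((hecke_U ^^ (Suc (I r) * Suc r)) (F (Suc r * Suc r))) \<le> C / Suc r" by metis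
  \<comment> \<open>The start of the quiet block. It comes before time
    \<open>K (Suc r * Suc r)\<close>, so its energy is still at least \<eta>.\<close>
  define G where "G r = (hecke_U ^^ (I r * Suc r)) (F (Suc r * Suc r))" for r
  have G: "G r \<in> level2_lip m" for r unfolding G_def by (rule level2_lip_hecke_U[OF F(1)])
  have G0: "level2_integral (G r) = 0" for r
    unfolding G_def using level2_integral_hecke_U_iterate[OF F(1)] F(2) by simp
  have G\<eta>: "energy (G r) \<ge> \<eta>" for r
  proof -
    have "I r * Suc r \<le> Suc r * Suc r" using I(1)[of r] by (intro mult_right_mono) auto
    also have "\<dots> \<le> K (Suc r * Suc r)" by (rule K(1))
    finally show ?thesis
      unfolding G_def using energy_antimono[OF F(1)] K(2) order_trans by blast
  qed
  have Gdiff: "energy (G r) - energy ((hecke_U ^^ j) (G r)) \<le> C / Suc r" if "j \<le> Suc r" for r j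
  proof -
    have "energy ((hecke_U ^^ Suc r) (G r)) \<le> energy ((hecke_U ^^ j) (G r))"
      by (rule energy_antimono[OF G that])
    moreover have "energy ((hecke_U ^^ Suc r) (G r)) = energy ((hecke_U ^^ (Suc (I r) * Suc r)) (F (Suc r * Suc r)))"
      unfolding G_def mult_Suc funpow_add o_def ..
    moreover have "energy (G r) - energy ((hecke_U ^^ (Suc (I r) * Suc r)) (F (Suc r * Suc r))) \<le> C / Suc r"
      using I(2)[of r] unfolding G_def .
    ultimately show ?thesis by linarith
  qed
  obtain s g where s: "strict_mono (s :: nat \<Rightarrow> nat)" and g: "g \<in> level2_lip m"
    and lim: "\<And>z. Im z > 0 \<Longrightarrow> (\<lambda>n. G (s n) z) \<longlonglongrightarrow> g z"
  proof (rule level2_lip_compact[of G m, OF G])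
    fix s :: "nat \<Rightarrow> nat" and g
    assume "strict_mono s" "g \<in> level2_lip m" "\<And>z. Im z > 0 \<Longrightarrow> (\<lambda>n. G (s n) z) \<longlonglongrightarrow> g z"
    then show thesis by (rule that)
  qed
  have E: "(\<lambda>n. energy ((hecke_U ^^ j) (G (s n)))) \<longlonglongrightarrow> energy ((hecke_U ^^ j) g)" for j
    by (rule energy_tendsto[OF G g lim])
  have rigid: "energy ((hecke_U ^^ j) g) = energy g" for j
  proof (rule antisym)
    show "energy ((hecke_U ^^ j) g) \<le> energy g" using energy_antimono[OF g, of 0 j] by simp
    have "energy g - energy ((hecke_U ^^ j) g) \<le> 0"
    proof (rule LIMSEQ_le)
      show "(\<lambda>n. energy (G (s n)) - energy ((hecke_U ^^ j) (G (s n)))) \<longlonglongrightarrow> energy g - energy ((hecke_U ^^ j) g)"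
        using tendsto_diff[OF E[of 0] E[of j]] by simp
      have "(\<lambda>n. C / real (Suc n)) \<longlonglongrightarrow> 0" by (rule LIMSEQ_Suc[OF lim_const_over_n])
      then show "(\<lambda>n. C / real (Suc (s n))) \<longlonglongrightarrow> 0"
        using LIMSEQ_subseq_LIMSEQ[OF _ s, of "\<lambda>n. C / real (Suc n)" 0] by (simp add: o_def)
      show "\<exists>N. \<forall>n\<ge>N. energy (G (s n)) - energy ((hecke_U ^^ j) (G (s n))) \<le> C / real (Suc (s n))"
      proof (intro exI allI impI)
        fix n assume "j \<le> n"
        then have "j \<le> Suc (s n)" using seq_suble[OF s, of n] by linarith
        then show "energy (G (s n)) - energy ((hecke_U ^^ j) (G (s n))) \<le> C / real (Suc (s n))"
          by (rule Gdiff)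
      qed
    qed
    then show "energy g \<le> energy ((hecke_U ^^ j) g)" by simp
  qed
  obtain c where c: "\<And>z. Im z > 0 \<Longrightarrow> g z = c" using rigid_imp_const[OF g rigid] by blast
  have "(\<lambda>n. level2_integral (G (s n))) \<longlonglongrightarrow> level2_integral g"
    using G g lim by (intro level2_integral_tendsto[where m = m]) (auto simp: level2_lip_def)
  then have "level2_integral g = 0" using G0 by (simp add: LIMSEQ_const_iff)
  moreover have "level2_integral g = pi * c"
    using level2_integral_cong[of g "\<lambda>_. c"] c by (simp add: level2_integral_const)
  ultimately have "c = 0" by simp
  then have "energy g = 0"
    unfolding energy_def using level2_integral_cong[of "\<lambda>z. (g z)\<^sup>2" "\<lambda>_. 0"] c
    by (simp add: level2_integral_const)
  moreover have "energy g \<ge> \<eta>"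
    using E[of 0] G\<eta> by (intro LIMSEQ_le_const[of "\<lambda>n. energy (G (s n))"]) auto
  ultimately show False using assms by simp
qed

lemma hecke_equidistribution:
  assumes "m > 0" "e > 0" "H > 0"
  obtains N where "\<And>h k z. h \<in> level2_lip m \<Longrightarrow> level2_integral h = 0 \<Longrightarrow> k \<ge> N \<Longrightarrow>
    Im z > 0 \<Longrightarrow> reduces_below H z \<Longrightarrow> \<bar>(hecke_U ^^ k) h z\<bar> < e"
proof -
  obtain \<eta> where \<eta>: "\<eta> > 0"
    "\<And>h z. h \<in> level2_lip m \<Longrightarrow> Im z > 0 \<Longrightarrow> reduces_below H z \<Longrightarrow>
       level2_integral (\<lambda>z. (h z)\<^sup>2) < \<eta> \<Longrightarrow> \<bar>h z\<bar> < e"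
    using level2_L2_small_imp_small[OF assms] by blast
  obtain N where N: "\<And>h k. h \<in> level2_lip m \<Longrightarrow> level2_integral h = 0 \<Longrightarrow> k \<ge> N \<Longrightarrow> energy ((hecke_U ^^ k) h) < \<eta>"
    using energy_uniform_decay[OF \<eta>(1)] by blast
  show thesis
    by (rule that[of N], rule \<eta>(2)) (use level2_lip_hecke_U N in \<open>auto simp: energy_def\<close>)
qed

section \<open>Non-divergence of closed horocycles\<close>

text \<open>The image of z under a matrix has height Im z / |cz + d|^2. Rows with c = 0 do not raise
  the height above Im z <= 1 <= H, and a change of sign makes c positive.\<close>

lemma reduces_below_if_no_small_denominator:
  assumes Y: "0 < Im z" "Im z \<le> 1" and H: "H \<ge> 1"
    and large: "\<And>c d :: int. c \<ge> 1 \<Longrightarrow> Im z / H \<le> (cmod (of_int c * z + of_int d))\<^sup>2"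
  shows "reduces_below H z"
proof -
  obtain a b c d where det: "a * d - b * c = (1::int)" and F: "moebius_int a b c d z \<in> fund_domain"
    using reduction_to_fund_domain[OF Y(1)] .
  let ?p = "of_int c * z + of_int d"
  have nz: "?p \<noteq> 0" by (rule moebius_int_denom_nz[OF Y(1) det])
  have "Im z / H \<le> (cmod ?p)\<^sup>2"
  proof -
    consider "c \<ge> 1" | "- c \<ge> 1" | "c = 0" by linarith
    then show ?thesis
    proof cases
      case 2
      have "cmod (of_int (- c) * z + of_int (- d)) = cmod (- ?p)" by (intro arg_cong[where f = cmod]) simp
      then show ?thesis using large[OF 2, of "- d"] by (simp only: norm_minus_cancel)
    next
      case 3
      then have "d \<noteq> 0" using det by auto
      then have "\<bar>real_of_int d\<bar> \<ge> 1" by linarith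
      then have "1 \<le> (cmod ?p)\<^sup>2" using 3 power_mono[of 1 "\<bar>real_of_int d\<bar>" 2] by simp
      moreover have "Im z / H \<le> 1" using Y H by simp
      ultimately show ?thesis by linarith
    qed (rule large)
  qed
  then have "Im (moebius_int a b c d z) \<le> H"
    unfolding Im_moebius_int[OF det] using nz H by (simp add: divide_le_eq field_simps)
  with det F show ?thesis unfolding reduces_below_def by blast
qed

text \<open>Escape above H needs |cz + d|^2 < Y/H with z = qx + iY. The imaginary part forces c <= t
  = 1/sqrt(YH), the real part puts x within s/(cq) of -d/(cq), where s = sqrt(Y/H). For each c the
  measure of these intervals adds up to at most 10 R s, so the total is at most 10 R s t = 10 R / H,
  independently of the stretching factor q and of Y.\<close>

lemma horocycle_nondivergence:
  fixes q Y H R :: real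
  assumes q: "q \<ge> 1" and Y: "0 < Y" "Y \<le> 1" and H: "H \<ge> 1" and R: "R \<ge> 1"
  obtains A where "A \<in> sets lborel" "emeasure lborel A \<le> ennreal (10 * R / H)"
    "\<And>x. \<bar>x\<bar> \<le> R \<Longrightarrow> x \<notin> A \<Longrightarrow> reduces_below H (Complex (q * x) Y)"
proof -
  define s where "s = sqrt (Y / H)"
  define t where "t = 1 / sqrt (Y * H)"
  define Z where "Z = \<lfloor>t\<rfloor>"
  define D where "D c = \<lfloor>of_int c * q * R + 1\<rfloor>" for c :: int
  define B where "B p = ball (- of_int (snd p) / (of_int (fst p) * q)) (s / (of_int (fst p) * q))" for p :: "int \<times> int"
  define P where "P = (SIGMA c:{1..Z}. {- D c..D c})"
  have s: "s > 0" "s \<le> 1" using Y H by (auto simp: s_def)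
  have t: "t > 0" using Y H by (simp add: t_def)
  have st: "s * t = 1 / H"
  proof -
    have "sqrt (Y / H) / sqrt (Y * H) = sqrt ((Y / H) / (Y * H))" by (simp only: real_sqrt_divide)
    also have "(Y / H) / (Y * H) = (1 / H)\<^sup>2" using Y H by (simp add: power2_eq_square)
    finally show ?thesis using H by (simp add: s_def t_def)
  qed
  have fin: "finite P" by (auto simp: P_def)
  let ?A = "\<Union>p\<in>P. B p"
  have "?A \<in> sets lborel" using fin by (intro sets.finite_UN) (auto simp: B_def)
  moreover have "emeasure lborel ?A \<le> ennreal (10 * R / H)"
  proof -
    have Bm: "emeasure lborel (B p) = ennreal (2 * s / (of_int (fst p) * q))" if "p \<in> P" for p
    proof -
      have "of_int (fst p) * q > 0" using that q by (auto simp: P_def)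
      then have "s / (of_int (fst p) * q) \<ge> 0" using s by simp
      then show ?thesis unfolding B_def by (simp add: ball_eq_greaterThanLessThan mult.commute)
    qed
    have "emeasure lborel ?A \<le> (\<Sum>p\<in>P. emeasure lborel (B p))"
      using fin by (intro emeasure_subadditive_finite) (auto simp: B_def)
    also have "\<dots> = (\<Sum>p\<in>P. ennreal (2 * s / (of_int (fst p) * q)))"
      using Bm by (intro sum.cong) auto
    also have "\<dots> = ennreal (\<Sum>p\<in>P. 2 * s / (of_int (fst p) * q))"
      using s q by (intro sum_ennreal) (auto simp: P_def)
    also have "\<dots> \<le> ennreal (10 * R / H)"
    proof (rule ennreal_leI)
      have "(\<Sum>p\<in>P. 2 * s / (of_int (fst p) * q)) = (\<Sum>c\<in>{1..Z}. \<Sum>d\<in>{- D c..D c}. 2 * s / (of_int c * q))"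
        unfolding P_def by (subst sum.Sigma) (auto simp: case_prod_beta)
      also have "\<dots> \<le> (\<Sum>c\<in>{1..Z}. 10 * R * s)"
      proof (rule sum_mono)
        fix c assume "c \<in> {1..Z}"
        then have c: "real_of_int c \<ge> 1" by auto
        have cq: "real_of_int c * q \<ge> 1" using mult_mono[OF c q] c by simp
        then have cqR: "real_of_int c * q * R \<ge> 1" using mult_mono[OF cq R] by simp
        have D: "0 \<le> D c" "real_of_int (D c) \<le> of_int c * q * R + 1" using cqR unfolding D_def by auto
        have "(\<Sum>d\<in>{- D c..D c}. 2 * s / (of_int c * q)) = (2 * real_of_int (D c) + 1) * (2 * s / (of_int c * q))"
          using D by simp
        \<comment> \<open>The number of d is at most 2 (cqR + 1) + 1, which is at most 5 cqR because
          cqR >= 1.\<close>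
        also have "\<dots> \<le> (5 * (of_int c * q * R)) * (2 * s / (of_int c * q))"
          using D cqR s cq by (intro mult_right_mono) auto
        also have "\<dots> = 10 * R * s" using c q by (simp add: field_simps)
        finally show "(\<Sum>d\<in>{- D c..D c}. 2 * s / (of_int c * q)) \<le> 10 * R * s" .
      qed
      also have "\<dots> = real (nat Z) * (10 * R * s)" by simp
      also have "\<dots> \<le> t * (10 * R * s)"
        using t s R by (intro mult_right_mono) (auto simp: Z_def of_nat_nat)
      also have "\<dots> = 10 * R * (s * t)" by simp
      also have "\<dots> = 10 * R / H" by (simp add: st)
      finally show "(\<Sum>p\<in>P. 2 * s / (of_int (fst p) * q)) \<le> 10 * R / H" .
    qed
    finally show ?thesis .
  qed
  moreover have "reduces_below H (Complex (q * x) Y)" if x: "\<bar>x\<bar> \<le> R" and xA: "x \<notin> ?A" for x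
  proof (rule reduces_below_if_no_small_denominator)
    fix c d :: int assume c: "c \<ge> 1"
    show "Im (Complex (q * x) Y) / H \<le> (cmod (of_int c * Complex (q * x) Y + of_int d))\<^sup>2"
    proof (rule ccontr)
      assume "\<not> ?thesis"
      then have small: "(of_int c * (q * x) + of_int d)\<^sup>2 + (of_int c * Y)\<^sup>2 < Y / H"
        by (simp add: cmod_power2)
      have cq: "real_of_int c * q > 0" using c q by simp
      have s2: "s\<^sup>2 = Y / H" using Y H by (simp add: s_def)
      have "(of_int c * (q * x) + of_int d)\<^sup>2 < s\<^sup>2"
        using small s2 zero_le_power2[of "of_int c * Y"] by linarith
      then have "\<bar>of_int c * (q * x) + of_int d\<bar>\<^sup>2 < s\<^sup>2" by simp
      then have 1: "\<bar>of_int c * (q * x) + of_int d\<bar> < s"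
        by (rule power2_less_imp_less) (use s in simp)
      have "(of_int c * Y)\<^sup>2 < Y / H" using small zero_le_power2[of "of_int c * (q * x) + of_int d"] by linarith
      then have "(of_int c)\<^sup>2 * (Y * H) < 1"
        using Y H by (simp add: power_mult_distrib power2_eq_square field_simps)
      then have "(of_int c * sqrt (Y * H))\<^sup>2 < 1\<^sup>2"
        using Y H by (simp add: power_mult_distrib)
      then have "of_int c * sqrt (Y * H) < 1" by (rule power2_less_imp_less) simp
      then have "of_int c \<le> t" using Y H unfolding t_def by (simp add: field_simps)
      then have cZ: "c \<le> Z" unfolding Z_def by (simp add: le_floor_iff)
      have "\<bar>real_of_int d\<bar> \<le> of_int c * q * \<bar>x\<bar> + 1"
      proof -
        have "\<bar>of_int c * (q * x)\<bar> = of_int c * q * \<bar>x\<bar>" using c q by (simp add: abs_mult)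
        then show ?thesis using 1 s by linarith
      qed
      also have "\<dots> \<le> of_int c * q * R + 1" using x cq by (intro add_right_mono mult_left_mono) auto
      finally have "\<bar>d\<bar> \<le> D c" unfolding D_def by (simp only: le_floor_iff of_int_abs)
      then have mem: "(c, d) \<in> P" using c cZ unfolding P_def by auto
      have "\<bar>x - (- of_int d / (of_int c * q))\<bar> = \<bar>of_int c * (q * x) + of_int d\<bar> / (of_int c * q)"
      proof -
        have "x - (- of_int d / (of_int c * q)) = (of_int c * (q * x) + of_int d) / (of_int c * q)"
          using cq c q by (simp add: field_simps)
        then show ?thesis using cq by (simp only: abs_divide abs_of_pos)
      qed
      also have "\<dots> < s / (of_int c * q)" using 1 cq by (rule divide_strict_right_mono)
      finally have "x \<in> B (c, d)" unfolding B_def by (simp add: dist_real_def abs_minus_commute)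
      with mem xA show False by blast
    qed
  qed (use Y H in auto)
  ultimately show thesis by (rule that)
qed

section \<open>Lipschitz regularization of test functions\<close>

lemma moebius_int_inverse:
  assumes "Im z > 0" "a * d - b * c = (1::int)"
  shows "moebius_int d (- b) (- c) a (moebius_int a b c d z) = z"
proof -
  have nz: "of_int c * z + of_int d \<noteq> 0" by (rule moebius_int_denom_nz[OF assms])
  have "of_int (a * d - b * c) = (1 :: complex)" using assms(2) by simp
  then have det: "of_int a * of_int d - of_int b * of_int c = (1 :: complex)" by simp
  have num: "of_int d * moebius_int a b c d z + of_int (- b) = z / (of_int c * z + of_int d)"
  proof -
    have "of_int d * (of_int a * z + of_int b) + of_int (- b) * (of_int c * z + of_int d)
        = (of_int a * of_int d - of_int b * of_int c) * z" by (simp add: algebra_simps)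
    then show ?thesis using nz unfolding det moebius_int_def by (simp add: field_simps)
  qed
  have den: "of_int (- c) * moebius_int a b c d z + of_int a = 1 / (of_int c * z + of_int d)"
  proof -
    have "of_int (- c) * (of_int a * z + of_int b) + of_int a * (of_int c * z + of_int d)
        = of_int a * of_int d - of_int b * of_int c" by (simp add: algebra_simps)
    then show ?thesis using nz unfolding det moebius_int_def by (simp add: field_simps)
  qed
  show ?thesis
    unfolding moebius_int_def[of d] num den using nz by simp
qed

text \<open>The Pasch-Hausdorff envelope with respect to \<open>rho\<close>. A bounded continuous
  function on the noncompact quotient need not be uniformly continuous, so uniform Lipschitz
  approximation may fail; monotone pointwise approximation from below does not. Invariance of
  \<open>rho\<close> makes the envelope inherit invariance.\<close>

definition inf_conv :: "real \<Rightarrow> (complex \<Rightarrow> real) \<Rightarrow> complex \<Rightarrow> real" where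
  "inf_conv L f z = (INF w\<in>upper_half_plane. f w + L * rho z w)"

context
  fixes f :: "complex \<Rightarrow> real" and B L :: real
  assumes B: "\<And>z. Im z > 0 \<Longrightarrow> \<bar>f z\<bar> \<le> B" and L: "L \<ge> 0"
begin

lemma inf_conv_bdd: "Im z > 0 \<Longrightarrow> bdd_below ((\<lambda>w. f w + L * rho z w) ` upper_half_plane)"
  using B L by (intro bdd_belowI2[of _ "- B"])
    (smt (verit) mult_nonneg_nonneg rho_nonneg upper_iff)

lemma inf_conv_le: "Im z > 0 \<Longrightarrow> Im w > 0 \<Longrightarrow> inf_conv L f z \<le> f w + L * rho z w"
  unfolding inf_conv_def by (intro cINF_lower inf_conv_bdd) (auto simp: upper_iff)

lemma inf_conv_le_self: "Im z > 0 \<Longrightarrow> inf_conv L f z \<le> f z"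
  using inf_conv_le[of z z] by (simp add: rho_def)

lemma inf_conv_greatest:
  "(\<And>w. Im w > 0 \<Longrightarrow> c \<le> f w + L * rho z w) \<Longrightarrow> c \<le> inf_conv L f z"
  unfolding inf_conv_def
proof (rule cINF_greatest)
  have "\<i> \<in> upper_half_plane" by (simp add: upper_iff)
  then show "upper_half_plane \<noteq> {}" by blast
qed (auto simp: upper_iff)

lemma inf_conv_ge: "Im z > 0 \<Longrightarrow> - B \<le> inf_conv L f z"
proof (rule inf_conv_greatest)
  fix w :: complex assume "Im z > 0" "Im w > 0"
  then show "- B \<le> f w + L * rho z w"
    using B[of w] mult_nonneg_nonneg[OF L rho_nonneg[of z w]] by linarith
qed

lemma inf_conv_abs_le: "Im z > 0 \<Longrightarrow> \<bar>inf_conv L f z\<bar> \<le> B"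
  using inf_conv_ge[of z] inf_conv_le_self[of z] B[of z] by linarith

text \<open>For a metric the constant would be L. Here the quasi-triangle inequality adds 2 L
  \<open>rho z w\<close> \<open>rho z u\<close>; a near-minimizer w at z satisfies L
  \<open>rho z w\<close> <= 2 B + e', because f takes values in [-B, B], and this costs the
  additional 4 B.\<close>

lemma inf_conv_lip: "lip_on_upper (L + 4 * B) (inf_conv L f)"
proof -
  have Bnn: "B \<ge> 0" using B[of \<i>] by simp
  have step: "inf_conv L f u \<le> inf_conv L f z + (L + 4 * B) * rho z u"
    if z: "Im z > 0" and u: "Im u > 0" for z u
  proof (rule field_le_epsilon)
    fix e :: real assume e: "e > 0"
    define r where "r = rho z u"
    have r: "r \<ge> 0" unfolding r_def by (rule rho_nonneg[OF z u])
    \<comment> \<open>The slack of the near-minimizer enters twice, as e' and as 2 r e'; together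
      this is e.\<close>
    define e' where "e' = e / (1 + 2 * r)"
    have e': "e' > 0" "e' * (1 + 2 * r) = e" using e r by (auto simp: e'_def)
    obtain w where w: "Im w > 0" "f w + L * rho z w < inf_conv L f z + e'"
    proof (rule ccontr)
      assume "\<not> thesis"
      then have "\<And>w. Im w > 0 \<Longrightarrow> inf_conv L f z + e' \<le> f w + L * rho z w" using that not_less by blast
      then have "inf_conv L f z + e' \<le> inf_conv L f z" by (rule inf_conv_greatest)
      then show False using e' by simp
    qed
    have "L * rho z w \<le> 2 * B + e'"
      using w inf_conv_abs_le[OF z] B[OF w(1)] by linarith
    then have "2 * r * (L * rho z w) \<le> 2 * r * (2 * B + e')" using r by (intro mult_left_mono) auto
    moreover have "inf_conv L f u \<le> f w + L * rho u w" by (rule inf_conv_le[OF u w(1)])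
    moreover have "L * rho u w \<le> L * (rho z w + rho z u * (1 + 2 * rho z w))"
      using L by (intro mult_left_mono rho_quasi_triangle z u w)
    ultimately have "inf_conv L f u \<le> inf_conv L f z + e' + L * r + 2 * r * (2 * B + e')"
      using w(2) by (simp add: r_def[symmetric] algebra_simps)
    also have "\<dots> = inf_conv L f z + (L + 4 * B) * r + e' * (1 + 2 * r)" by (simp add: algebra_simps)
    finally show "inf_conv L f u \<le> inf_conv L f z + (L + 4 * B) * rho z u + e" by (simp add: e' r_def[symmetric])
  qed
  show ?thesis
    unfolding lip_on_upper_def
  proof (intro conjI allI impI)
    fix z :: complex assume z: "Im z > 0"
    show "\<bar>inf_conv L f z\<bar> \<le> L + 4 * B" using inf_conv_abs_le[OF z] L Bnn by linarith
    fix w :: complex assume w: "Im w > 0"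
    show "\<bar>inf_conv L f z - inf_conv L f w\<bar> \<le> (L + 4 * B) * rho z w"
      using step[OF z w] step[OF w z] rho_commute[of z w] by simp
  qed
qed

lemma inf_conv_SL2Z_invariant:
  assumes "SL2Z_invariant f"
  shows "SL2Z_invariant (inf_conv L f)"
proof -
  have le: "inf_conv L f (moebius_int a b c d z) \<le> inf_conv L f z"
    if det: "a * d - b * c = 1" and z: "Im z > 0" for a b c d z
  proof (rule inf_conv_greatest)
    fix w :: complex assume w: "Im w > 0"
    have "inf_conv L f (moebius_int a b c d z) \<le>
        f (moebius_int a b c d w) + L * rho (moebius_int a b c d z) (moebius_int a b c d w)"
      by (intro inf_conv_le Im_moebius_int_pos z w det)
    also have "\<dots> = f w + L * rho z w"
      using assms det w by (simp add: rho_moebius_int[OF z w det] SL2Z_invariant_def upper_iff)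
    finally show "inf_conv L f (moebius_int a b c d z) \<le> f w + L * rho z w" .
  qed
  show ?thesis
    unfolding SL2Z_invariant_def upper_iff
  proof (intro allI impI ballI antisym)
    fix a b c d :: int and z :: complex
    assume det: "a * d - b * c = 1" and "z \<in> upper_half_plane"
    then have z: "Im z > 0" by (simp add: upper_iff)
    show "inf_conv L f (moebius_int a b c d z) \<le> inf_conv L f z" by (rule le[OF det z])
    have "d * a - (- b) * (- c) = 1" using det by (simp add: mult.commute)
    from le[OF this Im_moebius_int_pos[OF z det]]
    show "inf_conv L f z \<le> inf_conv L f (moebius_int a b c d z)"
      by (simp add: moebius_int_inverse[OF z det])
  qed
qed

end

text \<open>Points w near z have f w close to f z, while a far w pays at least n r >= 2 B, which no
  gain in a function bounded by B can offset.\<close>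

lemma inf_conv_tendsto:
  fixes f :: "complex \<Rightarrow> real"
  assumes B: "\<And>z. Im z > 0 \<Longrightarrow> \<bar>f z\<bar> \<le> B" and cont: "continuous_on upper_half_plane f" and z: "Im z > 0"
  shows "(\<lambda>n. inf_conv (real n) f z) \<longlonglongrightarrow> f z"
proof (rule LIMSEQ_I)
  fix e :: real assume e: "e > 0"
  then obtain \<delta> where \<delta>: "\<delta> > 0" "\<And>w. Im w > 0 \<Longrightarrow> dist w z < \<delta> \<Longrightarrow> \<bar>f w - f z\<bar> < e / 2"
    using cont z unfolding continuous_on_iff upper_iff Ball_def dist_real_def
    by (metis half_gt_zero)
  \<comment> \<open>For \<open>rho z w\<close> < r <= 1 the height of w is at most 4 Im z, so the
    Euclidean distance is below 2 r Im z <= \<delta>.\<close>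
  define r where "r = min 1 (\<delta> / (2 * Im z))"
  have r: "r > 0" "r \<le> 1" "2 * r * Im z \<le> \<delta>" using \<delta> z by (auto simp: r_def min_def field_simps)
  obtain N where N: "real N \<ge> 2 * B / r" using real_arch_simple by blast
  show "\<exists>N. \<forall>n\<ge>N. norm (inf_conv (real n) f z - f z) < e"
  proof (intro exI allI impI)
    fix n assume "N \<le> n"
    have "2 * B \<le> real N * r" using N r by (simp add: pos_divide_le_eq)
    also have "\<dots> \<le> real n * r" using r \<open>N \<le> n\<close> by (intro mult_right_mono) auto
    finally have n: "2 * B \<le> real n * r" .
    have "f z - e / 2 \<le> inf_conv (real n) f z"
    proof (rule inf_conv_greatest[OF B])
      fix w :: complex assume w: "Im w > 0"
      have rn: "rho z w \<ge> 0" by (rule rho_nonneg[OF z w])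
      show "f z - e / 2 \<le> f w + real n * rho z w"
      proof (cases "rho z w < r")
        case True
        have "sqrt (Im w) \<le> (1 + rho z w) * sqrt (Im z)"
          using sqrt_ratio_le[OF w z] z rho_commute[of w z] by (simp add: pos_divide_le_eq)
        also have "\<dots> \<le> 2 * sqrt (Im z)"
          using True r z by (intro mult_right_mono) auto
        finally have "sqrt (Im w) \<le> 2 * sqrt (Im z)" .
        have "cmod (z - w) = rho z w * (sqrt (Im z) * sqrt (Im w))"
          using z w by (simp add: rho_def real_sqrt_mult)
        also have "\<dots> \<le> rho z w * (sqrt (Im z) * (2 * sqrt (Im z)))"
          using rn z \<open>sqrt (Im w) \<le> 2 * sqrt (Im z)\<close> by (intro mult_left_mono) auto
        also have "\<dots> = 2 * rho z w * Im z" using z by simp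
        also have "\<dots> < 2 * r * Im z" using True z by simp
        also have "\<dots> \<le> \<delta>" by (rule r(3))
        finally have "\<bar>f w - f z\<bar> < e / 2" by (intro \<delta>(2) w) (simp add: dist_norm norm_minus_commute)
        then show ?thesis using rn mult_nonneg_nonneg[of "real n" "rho z w"] by linarith
      next
        case False
        then have "real n * r \<le> real n * rho z w" by (intro mult_left_mono) auto
        then show ?thesis using n B[OF z] B[OF w] e by linarith
      qed
    qed auto
    moreover have "inf_conv (real n) f z \<le> f z" using inf_conv_le_self[where f = f and B = B and L = "real n" and z = z] B z by simp
    ultimately show "norm (inf_conv (real n) f z - f z) < e" using e unfolding real_norm_def by linarith
  qed
qed

section \<open>Comparison with the normalized area\<close>

lemma mu_M_integral_nuF:
  assumes "continuous_on upper_half_plane f"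
  shows "mu_M_integral f = (3 / pi) * (\<integral>z. f z \<partial>nuF)"
proof -
  have "(\<lambda>z. indicator upper_half_plane z *\<^sub>R f z) \<in> borel_measurable borel"
    by (intro borel_measurable_continuous_on_indicator assms) simp
  then have "(\<lambda>z. indicator fund_domain z *\<^sub>R (indicator upper_half_plane z *\<^sub>R f z)) \<in> borel_measurable borel"
    by measurable
  moreover have "(\<lambda>z. indicator fund_domain z *\<^sub>R (indicator upper_half_plane z *\<^sub>R f z)) = (\<lambda>z. indicator fund_domain z *\<^sub>R f z)"
    by (auto simp: indicator_def upper_iff Im_fund_domain)
  ultimately have meas [measurable]: "(\<lambda>z. indicator fund_domain z *\<^sub>R f z) \<in> borel_measurable borel" by simp
  have "(\<integral>z. f z \<partial>nuF) = (\<integral>z. indicator fund_domain z *\<^sub>R f z \<partial>hyp)"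
    unfolding nuF_def by (rule integral_restrict_space) simp
  also have "\<dots> = (\<integral>z. (indicator upper_half_plane z / (Im z)\<^sup>2) *\<^sub>R (indicator fund_domain z *\<^sub>R f z) \<partial>lborel)"
    unfolding hyp_def using meas by (intro integral_density) (auto simp: indicator_def)
  also have "\<dots> = (\<integral>z. indicator fund_domain z *\<^sub>R (f z / (Im z)\<^sup>2) \<partial>lborel)"
    by (intro Bochner_Integration.integral_cong) (auto simp: indicator_def upper_iff Im_fund_domain)
  finally show ?thesis unfolding mu_M_integral_def set_lebesgue_integral_def by simp
qed

lemma mu_M_integral_inf_conv_tendsto:
  fixes f :: "complex \<Rightarrow> real"
  assumes B: "\<And>z. Im z > 0 \<Longrightarrow> \<bar>f z\<bar> \<le> B" and cont: "continuous_on upper_half_plane f"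
  shows "(\<lambda>n. mu_M_integral (inf_conv (real n) f)) \<longlonglongrightarrow> mu_M_integral f"
proof -
  have c: "continuous_on upper_half_plane (inf_conv (real n) f)" for n
    by (rule lip_on_upper_continuous[OF inf_conv_lip[OF B]]) auto
  have "(\<lambda>n. \<integral>z. inf_conv (real n) f z \<partial>nuF) \<longlonglongrightarrow> (\<integral>z. f z \<partial>nuF)"
  proof (rule integral_dominated_convergence[where w = "\<lambda>_. B"])
    show "AE z in nuF. (\<lambda>n. inf_conv (real n) f z) \<longlonglongrightarrow> f z"
      by (rule AE_I2) (use inf_conv_tendsto[OF B cont] Im_fund_domain in auto)
    show "AE z in nuF. norm (inf_conv (real n) f z) \<le> B" for n
      by (rule AE_I2) (use inf_conv_abs_le[where f = f and B = B and L = "real n"] B Im_fund_domain in auto)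
  qed (auto intro!: continuous_on_upper_measurable_nuF c cont)
  then show ?thesis
    unfolding mu_M_integral_nuF[OF c] mu_M_integral_nuF[OF cont] by (intro tendsto_intros)
qed

lemma SL2Z_invariant_level2_integral:
  assumes inv: "SL2Z_invariant f" and lip: "lip_on_upper m f"
  shows "level2_integral f = pi * mu_M_integral f"
proof -
  have "coset_sum f z = 3 * f z" if z: "Im z > 0" for z
  proof -
    have "f (moebius_int 0 (-1) 1 d z) = f z" for d
      using inv z unfolding SL2Z_invariant_def by (auto simp: upper_iff)
    from this[of 0] this[of 1] have "f (moebius_int 0 (-1) 1 0 z) = f z" "f (moebius_int 0 (-1) 1 1 z) = f z" .
    then show ?thesis by (simp add: coset_sum_def moebius_int_def)
  qed
  then have "level2_integral f = (\<integral>z. 3 * f z \<partial>nuF)"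
    unfolding level2_integral_def by (intro Bochner_Integration.integral_cong) (auto intro: Im_fund_domain)
  then show ?thesis
    by (simp add: mu_M_integral_nuF[OF lip_on_upper_continuous[OF lip]])
qed

section \<open>The averages for powers of two\<close>

lemma hecke_U_iterate_diff_const:
  "(hecke_U ^^ k) (\<lambda>z. f z - c) z = (hecke_U ^^ k) f z - c"
  unfolding hecke_U_iterate by (simp add: sum_subtractf diff_divide_distrib)

lemma delta_integral_hecke_U:
  "delta_integral (2 ^ k) x y f = (hecke_U ^^ k) f (Complex (2 ^ k * x) (2 ^ k * y))"
proof -
  have "(Complex (2 ^ k * x) (2 ^ k * y) + of_nat j) / 2 ^ k = Complex (x + real j / 2 ^ k) y" for j
  proof -
    have "Complex (2 ^ k * x) (2 ^ k * y) + of_nat j = of_real (2 ^ k) * Complex (x + real j / 2 ^ k) y"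
      by (simp add: complex_eq_iff field_simps)
    then show ?thesis by simp
  qed
  then show ?thesis
    by (simp add: delta_integral_def hecke_U_iterate)
qed

text \<open>Being coprime to 2^(k+1) means being odd, and the even j give the points of the average
  for 2^k. Since the totient is half of 2^(k+1), the weights become 2 and -1.\<close>

lemma delta_pr_integral_eq:
  "delta_pr_integral (2 ^ Suc k) x y f = 2 * delta_integral (2 ^ Suc k) x y f - delta_integral (2 ^ k) x y f"
proof -
  define g where "g j = f (Complex (x + real j / 2 ^ Suc k) y)" for j
  have split: "(\<Sum>j<2 * n. F j) = (\<Sum>j<n. F (2 * j)) + (\<Sum>j\<in>{j. j < 2 * n \<and> odd j}. F j)" for F :: "nat \<Rightarrow> real" and n
  proof -
    have "{..<2 * n} = (\<lambda>j. 2 * j) ` {..<n} \<union> {j. j < 2 * n \<and> odd j}"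
      by (auto simp: image_iff elim!: evenE)
    then have "(\<Sum>j<2 * n. F j) = sum F ((\<lambda>j. 2 * j) ` {..<n} \<union> {j. j < 2 * n \<and> odd j})" by simp
    also have "\<dots> = sum F ((\<lambda>j. 2 * j) ` {..<n}) + sum F {j. j < 2 * n \<and> odd j}"
      by (rule sum.union_disjoint) auto
    also have "sum F ((\<lambda>j. 2 * j) ` {..<n}) = (\<Sum>j<n. F (2 * j))"
      by (subst sum.reindex) (auto simp: inj_on_def)
    finally show ?thesis .
  qed
  have cop: "{j. j < 2 ^ Suc k \<and> coprime j (2 ^ Suc k)} = {j. j < 2 * 2 ^ k \<and> odd (j::nat)}"
    by auto
  have "totient (2 ^ Suc k) = 2 ^ k"
    using totient_prime_power_Suc[of 2 k] by simp
  then have "delta_pr_integral (2 ^ Suc k) x y f = (1 / 2 ^ k) * (\<Sum>j\<in>{j. j < 2 * 2 ^ k \<and> odd j}. g j)"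
    unfolding delta_pr_integral_def cop by (simp add: g_def)
  also have "(\<Sum>j\<in>{j. j < 2 * 2 ^ k \<and> odd j}. g j) = (\<Sum>j<2 ^ Suc k. g j) - (\<Sum>j<2 ^ k. g (2 * j))"
    using split[of g "2 ^ k"] by simp
  also have "(\<Sum>j<2 ^ Suc k. g j) = 2 ^ Suc k * delta_integral (2 ^ Suc k) x y f"
    by (simp add: delta_integral_def g_def)
  also have "(\<Sum>j<2 ^ k. g (2 * j)) = 2 ^ k * delta_integral (2 ^ k) x y f"
    by (simp add: delta_integral_def g_def)
  finally show ?thesis by (simp add: diff_divide_distrib)
qed

section \<open>Equidistribution\<close>

text \<open>The exponents are chosen before any heights or x are given. The condition is
  \<open>K i \<le> Suc k\<close> so that it covers k = \<open>K i - 1\<close> as well, which the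
  primitive averages need.\<close>

lemma hecke_sparse_exponents:
  obtains K :: "nat \<Rightarrow> nat" where "strict_mono K" "\<And>i. K i \<ge> 1"
    "\<And>i h k z. h \<in> level2_lip (real (Suc i)) \<Longrightarrow> level2_integral h = 0 \<Longrightarrow> K i \<le> Suc k \<Longrightarrow>
       Im z > 0 \<Longrightarrow> reduces_below (2 ^ i) z \<Longrightarrow> \<bar>(hecke_U ^^ k) h z\<bar> < 1 / real (Suc i)"
proof -
  have "\<exists>N. \<forall>h k z. h \<in> level2_lip (real (Suc i)) \<longrightarrow> level2_integral h = 0 \<longrightarrow> N \<le> k \<longrightarrow>
      Im z > 0 \<longrightarrow> reduces_below (2 ^ i) z \<longrightarrow> \<bar>(hecke_U ^^ k) h z\<bar> < 1 / real (Suc i)" for i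
  proof -
    obtain N where "\<And>h k z. h \<in> level2_lip (real (Suc i)) \<Longrightarrow> level2_integral h = 0 \<Longrightarrow> k \<ge> N \<Longrightarrow>
      Im z > 0 \<Longrightarrow> reduces_below (2 ^ i) z \<Longrightarrow> \<bar>(hecke_U ^^ k) h z\<bar> < 1 / real (Suc i)"
      using hecke_equidistribution[of "real (Suc i)" "1 / real (Suc i)" "2 ^ i"] by auto
    then show ?thesis by blast
  qed
  then obtain N where N: "\<And>i h k z. h \<in> level2_lip (real (Suc i)) \<Longrightarrow> level2_integral h = 0 \<Longrightarrow> N i \<le> k \<Longrightarrow>
      Im z > 0 \<Longrightarrow> reduces_below (2 ^ i) z \<Longrightarrow> \<bar>(hecke_U ^^ k) h z\<bar> < 1 / real (Suc i)"
    by metis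
  \<comment> \<open>Partial sums dominate each \<open>N i\<close> and are strictly
    increasing.\<close>
  define K where "K i = (\<Sum>j\<le>i. Suc (N j))" for i
  have K: "K i \<ge> Suc (N i)" for i
    unfolding K_def by (rule member_le_sum) auto
  show thesis
  proof (rule that)
    show "strict_mono K" unfolding K_def by (rule strict_mono_Suc_iff[THEN iffD2]) simp
    show "K i \<ge> 1" for i using K[of i] by simp
    show "\<bar>(hecke_U ^^ k) h z\<bar> < 1 / real (Suc i)"
      if "h \<in> level2_lip (real (Suc i))" "level2_integral h = 0" "K i \<le> Suc k" "Im z > 0" "reduces_below (2 ^ i) z" for i h k z
      using K[of i] that(3) by (intro N[OF that(1,2) _ that(4,5)]) linarith
  qed
qed

text \<open>Borel-Cantelli on each window |x| <= r+1, followed by a countable union of the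
  exceptional sets. The bound 10 R / 2^i is used for both exponents, hence 20, and is summable in
  i.\<close>

lemma AE_eventually_reduces:
  fixes K :: "nat \<Rightarrow> nat" and y :: "nat \<Rightarrow> real"
  assumes K: "\<And>i. K i \<ge> 1" and y: "\<And>i. y i > 0"
    and small: "\<forall>\<^sub>F i in sequentially. 2 ^ K i * y i \<le> 1"
  shows "AE x in lborel. \<forall>\<^sub>F i in sequentially.
    reduces_below (2 ^ i) (Complex (2 ^ K i * x) (2 ^ K i * y i)) \<and>
    reduces_below (2 ^ i) (Complex (2 ^ (K i - 1) * x) (2 ^ (K i - 1) * y i))"
proof -
  define Q where "Q i x \<longleftrightarrow> reduces_below (2 ^ i) (Complex (2 ^ K i * x) (2 ^ K i * y i)) \<and>
    reduces_below (2 ^ i) (Complex (2 ^ (K i - 1) * x) (2 ^ (K i - 1) * y i))" for i x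
  have ae: "AE x in lborel. \<forall>\<^sub>F i in sequentially. \<bar>x\<bar> \<le> real (Suc r) \<longrightarrow> Q i x" for r
  proof -
    let ?R = "real (Suc r)"
    have "\<exists>A. A \<in> sets lborel \<and> emeasure lborel A \<le> ennreal (20 * ?R * (1 / 2) ^ i) \<and>
        (2 ^ K i * y i \<le> 1 \<longrightarrow> (\<forall>x. \<bar>x\<bar> \<le> ?R \<longrightarrow> x \<notin> A \<longrightarrow> Q i x))" for i
    proof (cases "2 ^ K i * y i \<le> 1")
      case True
      have half: "2 ^ (K i - 1) * y i \<le> 1"
      proof -
        have "2 ^ (K i - 1) * y i \<le> 2 ^ K i * y i"
          using y[of i] by (intro mult_right_mono power_increasing) auto
        then show ?thesis using True by linarith
      qed
      obtain A where A: "A \<in> sets lborel" "emeasure lborel A \<le> ennreal (10 * ?R / 2 ^ i)"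
        "\<And>x. \<bar>x\<bar> \<le> ?R \<Longrightarrow> x \<notin> A \<Longrightarrow> reduces_below (2 ^ i) (Complex (2 ^ K i * x) (2 ^ K i * y i))"
        using horocycle_nondivergence[of "2 ^ K i" "2 ^ K i * y i" "2 ^ i" ?R] True y[of i] by auto
      obtain A' where A': "A' \<in> sets lborel" "emeasure lborel A' \<le> ennreal (10 * ?R / 2 ^ i)"
        "\<And>x. \<bar>x\<bar> \<le> ?R \<Longrightarrow> x \<notin> A' \<Longrightarrow> reduces_below (2 ^ i) (Complex (2 ^ (K i - 1) * x) (2 ^ (K i - 1) * y i))"
        using horocycle_nondivergence[of "2 ^ (K i - 1)" "2 ^ (K i - 1) * y i" "2 ^ i" ?R] half y[of i] by auto
      have "emeasure lborel (A \<union> A') \<le> emeasure lborel A + emeasure lborel A'"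
        using A A' by (intro emeasure_subadditive) auto
      also have "\<dots> \<le> ennreal (10 * ?R / 2 ^ i) + ennreal (10 * ?R / 2 ^ i)"
        by (intro add_mono A A')
      also have "\<dots> = ennreal (20 * ?R * (1 / 2) ^ i)"
        by (subst ennreal_plus[symmetric]) (auto simp: power_one_over field_simps)
      finally show ?thesis
        using A A' by (intro exI[of _ "A \<union> A'"]) (auto simp: Q_def)
    \<comment> \<open>Indices whose stretched height exceeds 1 claim nothing; by
      \<open>small\<close> there are only finitely many.\<close>
    qed (intro exI[of _ "{}"], simp)
    then obtain A where A: "\<And>i. A i \<in> sets lborel" "\<And>i. emeasure lborel (A i) \<le> ennreal (20 * ?R * (1 / 2) ^ i)"
      "\<And>i x. 2 ^ K i * y i \<le> 1 \<Longrightarrow> \<bar>x\<bar> \<le> ?R \<Longrightarrow> x \<notin> A i \<Longrightarrow> Q i x"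
      by metis
    have fin: "emeasure lborel (A i) < \<infinity>" for i
      using A(2)[of i] by (rule order_le_less_trans) simp
    have "AE x in lborel. \<forall>\<^sub>F i in sequentially. x \<in> space lborel - A i"
    proof (rule borel_cantelli_AE1[OF A(1) fin])
      have bound: "norm (measure lborel (A i)) \<le> 20 * ?R * (1 / 2) ^ i" for i
        using enn2real_mono[OF A(2)[of i]] by (simp add: measure_def)
      show "summable (\<lambda>i. measure lborel (A i))"
        by (rule summable_comparison_test'[where g = "\<lambda>i. 20 * ?R * (1 / 2) ^ i"])
          (use bound in \<open>auto intro!: summable_mult summable_geometric\<close>)
    qed
    then show ?thesis
    proof eventually_elim
      case (elim x)
      then show ?case
        using small by eventually_elim (use A(3) in auto)
    qed
  qed
  then have "AE x in lborel. \<forall>r. \<forall>\<^sub>F i in sequentially. \<bar>x\<bar> \<le> real (Suc r) \<longrightarrow> Q i x"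
    by (subst AE_all_countable) auto
  then show ?thesis
  proof eventually_elim
    case (elim x)
    obtain r where "\<bar>x\<bar> \<le> real r" using real_arch_simple by blast
    then have "\<bar>x\<bar> \<le> real (Suc r)" by simp
    with elim[rule_format, of r] show ?case unfolding Q_def by simp
  qed
qed

text \<open>The condition \<open>red\<close> on x does not involve F, so a single null set serves
  all test functions although there are uncountably many.\<close>

lemma delta_tendsto_lipschitz:
  fixes K :: "nat \<Rightarrow> nat"
  assumes K: "\<And>i. K i \<ge> 1"
    and equi: "\<And>i h k z. h \<in> level2_lip (real (Suc i)) \<Longrightarrow> level2_integral h = 0 \<Longrightarrow> K i \<le> Suc k \<Longrightarrow>
       Im z > 0 \<Longrightarrow> reduces_below (2 ^ i) z \<Longrightarrow> \<bar>(hecke_U ^^ k) h z\<bar> < 1 / real (Suc i)"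
    and y: "\<And>i. y i > 0"
    and red: "\<forall>\<^sub>F i in sequentially.
      reduces_below (2 ^ i) (Complex (2 ^ K i * x) (2 ^ K i * y i)) \<and>
      reduces_below (2 ^ i) (Complex (2 ^ (K i - 1) * x) (2 ^ (K i - 1) * y i))"
    and lip: "lip_on_upper m F" and inv: "SL2Z_invariant F"
  shows "(\<lambda>i. delta_integral (2 ^ K i) x (y i) F) \<longlonglongrightarrow> mu_M_integral F"
    "(\<lambda>i. delta_pr_integral (2 ^ K i) x (y i) F) \<longlonglongrightarrow> mu_M_integral F"
proof -
  define c where "c = mu_M_integral F"
  define h where "h z = F z - c" for z
  have hlip: "lip_on_upper (m + \<bar>c\<bar>) h"
    unfolding h_def by (rule lip_on_upper_diff[OF lip lip_on_upper_const])
  have hinv: "gamma0_2_invariant h"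
    unfolding h_def by (intro gamma0_2_invariant_diff SL2Z_invariant_imp_gamma0_2[OF inv])
      (simp add: gamma0_2_invariant_def)
  have h0: "level2_integral h = 0"
    unfolding h_def level2_integral_diff[OF lip lip_on_upper_const] level2_integral_const
      SL2Z_invariant_level2_integral[OF inv lip] by (simp add: c_def)
  have U: "(hecke_U ^^ k) h z = (hecke_U ^^ k) F z - c" for k z
    unfolding h_def by (rule hecke_U_iterate_diff_const)
  obtain M where M: "m + \<bar>c\<bar> \<le> real M" using real_arch_simple by blast
  have hl: "h \<in> level2_lip (real (Suc i))" if "i \<ge> M" for i
    using lip_on_upper_mono[OF hlip, of "real (Suc i)"] hinv M that by (auto simp: level2_lip_def)
  have bounds: "\<forall>\<^sub>F i in sequentially. \<bar>delta_integral (2 ^ K i) x (y i) F - c\<bar> < 1 / real (Suc i) \<and>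
      \<bar>delta_integral (2 ^ (K i - 1)) x (y i) F - c\<bar> < 1 / real (Suc i)"
    using red eventually_ge_at_top[of M]
  proof eventually_elim
    case (elim i)
    have "\<bar>(hecke_U ^^ K i) h (Complex (2 ^ K i * x) (2 ^ K i * y i))\<bar> < 1 / real (Suc i)"
      using elim y[of i] by (intro equi hl h0) auto
    moreover have "\<bar>(hecke_U ^^ (K i - 1)) h (Complex (2 ^ (K i - 1) * x) (2 ^ (K i - 1) * y i))\<bar> < 1 / real (Suc i)"
      using elim y[of i] by (intro equi hl h0) auto
    ultimately show ?case unfolding U delta_integral_hecke_U by blast
  qed
  \<comment> \<open>The factor 3 is |2| + |-1|, from the weights in the primitive average; it covers
    the plain average too.\<close>
  have lim3: "(\<lambda>i. 3 * (1 / real (Suc i))) \<longlonglongrightarrow> 3 * 0"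
    by (intro tendsto_mult tendsto_const LIMSEQ_Suc[OF lim_const_over_n])
  have "(\<lambda>i. delta_integral (2 ^ K i) x (y i) F - c) \<longlonglongrightarrow> 0"
  proof (rule Lim_null_comparison[OF _ lim3[simplified mult_zero_right]])
    show "\<forall>\<^sub>F i in sequentially. norm (delta_integral (2 ^ K i) x (y i) F - c) \<le> 3 * (1 / real (Suc i))"
      using bounds
    proof eventually_elim
      case (elim i)
      have "1 / real (Suc i) > 0" by simp
      then show ?case using elim unfolding real_norm_def by linarith
    qed
  qed
  then show "(\<lambda>i. delta_integral (2 ^ K i) x (y i) F) \<longlonglongrightarrow> mu_M_integral F"
    unfolding c_def by (rule LIM_zero_cancel)
  have "(\<lambda>i. delta_pr_integral (2 ^ K i) x (y i) F - c) \<longlonglongrightarrow> 0"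
  proof (rule Lim_null_comparison[OF _ lim3[simplified mult_zero_right]])
    show "\<forall>\<^sub>F i in sequentially. norm (delta_pr_integral (2 ^ K i) x (y i) F - c) \<le> 3 * (1 / real (Suc i))"
      using bounds
    proof eventually_elim
      case (elim i)
      have "delta_pr_integral (2 ^ K i) x (y i) F
          = 2 * delta_integral (2 ^ K i) x (y i) F - delta_integral (2 ^ (K i - 1)) x (y i) F"
        using delta_pr_integral_eq[of "K i - 1" x "y i" F] K[of i] by simp
      then show ?case using elim unfolding real_norm_def by linarith
    qed
  qed
  then show "(\<lambda>i. delta_pr_integral (2 ^ K i) x (y i) F) \<longlonglongrightarrow> mu_M_integral F"
    unfolding c_def by (rule LIM_zero_cancel)
qed

text \<open>Infimal convolutions are Lipschitz and increase to the given function, so monotonicity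
  of averages lets Lipschitz test functions control all of \<open>Cb_modular\<close>.\<close>

lemma tendsto_Cb_modular_from_lipschitz:
  fixes D :: "nat \<Rightarrow> (complex \<Rightarrow> real) \<Rightarrow> real"
  assumes mono: "\<And>i f g. (\<And>z. Im z > 0 \<Longrightarrow> f z \<le> g z) \<Longrightarrow> D i f \<le> D i g"
    and neg: "\<And>i f. D i (\<lambda>z. - f z) = - D i f"
    and lip: "\<And>m F. lip_on_upper m F \<Longrightarrow> SL2Z_invariant F \<Longrightarrow> (\<lambda>i. D i F) \<longlonglongrightarrow> mu_M_integral F"
    and f: "f \<in> Cb_modular"
  shows "(\<lambda>i. D i f) \<longlonglongrightarrow> mu_M_integral f"
proof -
  have lower: "\<forall>\<^sub>F i in sequentially. a < D i g" if g: "g \<in> Cb_modular" and a: "a < mu_M_integral g" for g a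
  proof -
    obtain B where B: "\<And>z. Im z > 0 \<Longrightarrow> \<bar>g z\<bar> \<le> B" and cont: "continuous_on upper_half_plane g"
      and inv: "SL2Z_invariant g"
      using g unfolding Cb_modular_def upper_iff[symmetric] by blast
    have "\<forall>\<^sub>F n in sequentially. a < mu_M_integral (inf_conv (real n) g)"
      by (rule order_tendstoD(1)[OF mu_M_integral_inf_conv_tendsto[OF B cont] a])
    then obtain n where n: "a < mu_M_integral (inf_conv (real n) g)"
      by (auto simp: eventually_sequentially)
    have "(\<lambda>i. D i (inf_conv (real n) g)) \<longlonglongrightarrow> mu_M_integral (inf_conv (real n) g)"
    proof (rule lip)
      show "lip_on_upper (real n + 4 * B) (inf_conv (real n) g)" by (rule inf_conv_lip[OF B]) auto
      show "SL2Z_invariant (inf_conv (real n) g)" by (rule inf_conv_SL2Z_invariant[OF B _ inv]) auto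
    qed
    from order_tendstoD(1)[OF this n] show ?thesis
    proof eventually_elim
      case (elim i)
      have "D i (inf_conv (real n) g) \<le> D i g"
        by (rule mono) (rule inf_conv_le_self[OF B], auto)
      with elim show ?case by linarith
    qed
  qed
  \<comment> \<open>Approximation from below yields only lower bounds; the upper bound is the lower
    bound for -f.\<close>
  have neg_f: "(\<lambda>z. - f z) \<in> Cb_modular"
    using f unfolding Cb_modular_def SL2Z_invariant_def by (auto intro!: continuous_intros)
  have neg_mu: "mu_M_integral (\<lambda>z. - f z) = - mu_M_integral f"
    by (simp add: mu_M_integral_def set_lebesgue_integral_def)
  show ?thesis
  proof (rule order_tendstoI)
    show "\<forall>\<^sub>F i in sequentially. a < D i f" if "a < mu_M_integral f" for a
      by (rule lower[OF f that])
    show "\<forall>\<^sub>F i in sequentially. D i f < a" if "mu_M_integral f < a" for a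
      using lower[OF neg_f, of "- a"] that by (simp add: neg neg_mu)
  qed
qed

text \<open>An element of the range that is at least \<open>s N\<close> has index at least N,
  because s is strictly increasing.\<close>

lemma tendsto_along_range:
  fixes s :: "nat \<Rightarrow> nat" and a :: "nat \<Rightarrow> real"
  assumes "strict_mono s" and lim: "(\<lambda>i. a (s i)) \<longlonglongrightarrow> l"
  shows "(a \<longlongrightarrow> l) (inf sequentially (principal (range s)))"
proof (rule topological_tendstoI)
  fix S assume "open S" "l \<in> S"
  from topological_tendstoD[OF lim this] obtain N where N: "\<And>i. i \<ge> N \<Longrightarrow> a (s i) \<in> S"
    by (auto simp: eventually_sequentially)
  have "\<forall>\<^sub>F n in sequentially. n \<in> range s \<longrightarrow> a n \<in> S"
    using eventually_ge_at_top[of "s N"]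
  proof eventually_elim
    case (elim n)
    then show ?case using N assms(1) by (auto simp: strict_mono_less_eq)
  qed
  then show "\<forall>\<^sub>F n in inf sequentially (principal (range s)). a n \<in> S"
    by (simp add: eventually_inf_principal)
qed

theorem theorem1p5:
  shows "\<exists>NN :: nat set. infinite NN \<and>
    (\<forall>y :: nat \<Rightarrow> real.
       (\<forall>n. y n > 0) \<and> (\<exists>C. \<forall>n\<ge>1. y n \<le> C * real n powr (-2 + 4 * theta)) \<longrightarrow>
       (AE x in lborel.
          \<forall>f \<in> Cb_modular.
            ((\<lambda>n. delta_integral n x (y n) f) \<longlongrightarrow> mu_M_integral f)
               (inf sequentially (principal NN)) \<and>
            ((\<lambda>n. delta_pr_integral n x (y n) f) \<longlongrightarrow> mu_M_integral f)
               (inf sequentially (principal NN))))"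
proof -
  obtain K :: "nat \<Rightarrow> nat" where K: "strict_mono K" "\<And>i. K i \<ge> 1"
    and equi: "\<And>i h k z. h \<in> level2_lip (real (Suc i)) \<Longrightarrow> level2_integral h = 0 \<Longrightarrow> K i \<le> Suc k \<Longrightarrow>
       Im z > 0 \<Longrightarrow> reduces_below (2 ^ i) z \<Longrightarrow> \<bar>(hecke_U ^^ k) h z\<bar> < 1 / real (Suc i)"
    by (rule hecke_sparse_exponents) blast
  define s where "s i = (2::nat) ^ K i" for i
  have s: "strict_mono s"
    using K(1) by (auto simp: s_def strict_mono_def)
  show ?thesis
  proof (intro exI[of _ "range s"] conjI allI impI)
    show "infinite (range s)"
      using s by (simp add: range_inj_infinite strict_mono_imp_inj_on)
    fix y :: "nat \<Rightarrow> real"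
    assume "(\<forall>n. y n > 0) \<and> (\<exists>C. \<forall>n\<ge>1. y n \<le> C * real n powr (-2 + 4 * theta))"
    then obtain C where y: "\<And>n. y n > 0" and C: "\<And>n. n \<ge> 1 \<Longrightarrow> y n \<le> C * real n powr (-2 + 4 * theta)"
      by blast
    \<comment> \<open>The exponent of n y_n is 1 - 2 + 4 (7/64) = -9/16, so n y_n falls below 1, as
      the non-divergence estimate requires of the stretched height.\<close>
    have "(\<lambda>n. C * real n powr (- 9 / 16)) \<longlonglongrightarrow> C * 0"
      by (intro tendsto_mult tendsto_const tendsto_neg_powr filterlim_real_sequentially) simp
    then have "\<forall>\<^sub>F n in sequentially. C * real n powr (- 9 / 16) < 1"
      by (intro order_tendstoD(2)) auto
    then have "\<forall>\<^sub>F n in sequentially. real n * y n \<le> 1"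
      using eventually_ge_at_top[of 1]
    proof eventually_elim
      case (elim n)
      have "real n * y n \<le> real n powr 1 * (C * real n powr (-2 + 4 * theta))"
        using C[of n] elim by (auto intro!: mult_left_mono)
      also have "\<dots> = C * real n powr (1 + (-2 + 4 * theta))"
        unfolding powr_add by simp
      also have "1 + (-2 + 4 * theta) = - 9 / 16" by (simp add: theta_def)
      finally show ?case using elim by linarith
    qed
    then have "\<forall>\<^sub>F i in sequentially. real (s i) * y (s i) \<le> 1"
      by (rule eventually_subseq[OF s])
    then have small: "\<forall>\<^sub>F i in sequentially. 2 ^ K i * y (s i) \<le> 1"
      by (simp add: s_def)
    have "AE x in lborel. \<forall>\<^sub>F i in sequentially.
      reduces_below (2 ^ i) (Complex (2 ^ K i * x) (2 ^ K i * y (s i))) \<and>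
      reduces_below (2 ^ i) (Complex (2 ^ (K i - 1) * x) (2 ^ (K i - 1) * y (s i)))"
      by (rule AE_eventually_reduces[OF K(2) y small])
    then show "AE x in lborel. \<forall>f \<in> Cb_modular.
            ((\<lambda>n. delta_integral n x (y n) f) \<longlongrightarrow> mu_M_integral f)
               (inf sequentially (principal (range s))) \<and>
            ((\<lambda>n. delta_pr_integral n x (y n) f) \<longlongrightarrow> mu_M_integral f)
               (inf sequentially (principal (range s)))"
    proof eventually_elim
      case (elim x)
      show ?case
      proof (intro ballI conjI)
        fix f assume f: "f \<in> Cb_modular"
        have "(\<lambda>i. delta_integral (s i) x (y (s i)) f) \<longlonglongrightarrow> mu_M_integral f"
        proof (rule tendsto_Cb_modular_from_lipschitz[OF _ _ _ f])
          show "delta_integral (s i) x (y (s i)) F \<le> delta_integral (s i) x (y (s i)) G"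
            if "\<And>z. Im z > 0 \<Longrightarrow> F z \<le> G z" for i F G
            unfolding delta_integral_def using that y by (intro mult_left_mono sum_mono) auto
          show "delta_integral (s i) x (y (s i)) (\<lambda>z. - F z) = - delta_integral (s i) x (y (s i)) F" for i F
            by (simp add: delta_integral_def sum_negf)
          show "(\<lambda>i. delta_integral (s i) x (y (s i)) F) \<longlonglongrightarrow> mu_M_integral F"
            if "lip_on_upper m F" "SL2Z_invariant F" for m F
            using delta_tendsto_lipschitz(1)[OF K(2) equi y elim that] by (simp add: s_def)
        qed
        then show "((\<lambda>n. delta_integral n x (y n) f) \<longlongrightarrow> mu_M_integral f) (inf sequentially (principal (range s)))"
          by (rule tendsto_along_range[OF s])
        have "(\<lambda>i. delta_pr_integral (s i) x (y (s i)) f) \<longlonglongrightarrow> mu_M_integral f"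
        proof (rule tendsto_Cb_modular_from_lipschitz[OF _ _ _ f])
          show "delta_pr_integral (s i) x (y (s i)) F \<le> delta_pr_integral (s i) x (y (s i)) G"
            if "\<And>z. Im z > 0 \<Longrightarrow> F z \<le> G z" for i F G
            unfolding delta_pr_integral_def using that y by (intro mult_left_mono sum_mono) auto
          show "delta_pr_integral (s i) x (y (s i)) (\<lambda>z. - F z) = - delta_pr_integral (s i) x (y (s i)) F" for i F
            by (simp add: delta_pr_integral_def sum_negf)
          show "(\<lambda>i. delta_pr_integral (s i) x (y (s i)) F) \<longlonglongrightarrow> mu_M_integral F"
            if "lip_on_upper m F" "SL2Z_invariant F" for m F
            using delta_tendsto_lipschitz(2)[OF K(2) equi y elim that] by (simp add: s_def)
        qed
        then show "((\<lambda>n. delta_pr_integral n x (y n) f) \<longlongrightarrow> mu_M_integral f) (inf sequentially (principal (range s)))"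
          by (rule tendsto_along_range[OF s])
      qed
    qed
  qed
qed

end
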